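(* For every integer $d\geq 2$, as $n\to\infty$, \[ n-o(n)\;\leq\; f([n]^d,\mathbb{R}^d)\;\leq\; d\cdot n. \]
   Context: For a positive integer $n$ let $[n]=\{1,2,\dots,n\}$, and regard $[n]^d\subset\mathbb{R}^d$. A subset $D\subseteq[n]^d$ satisfies the no-$(d+2)$-on-a-sphere condition in $\mathbb{R}^d$ if (i) no $d+1$ points of $D$ lie on a common affine hyperplane of $\mathbb{R}^d$, and (ii) no $d+2$ points of $D$ lie on a common hypersphere of $\mathbb{R}^d$. $f([n]^d,\mathbb{R}^d)$ denotes the maximum size of a subset $D\subseteq [n]^d$ satisfying this condition. *)

theory Defs
  imports "HOL-Analysis.Analysis" "HOL-Library.Landau_Symbols"
begin

definition grid :: "nat \<Rightarrow> (real ^ 'd::finite) set" where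
  "grid n = {x. \<forall>i. \<exists>k\<in>{1..n}. x $ i = real k}"

definition on_common_hyperplane :: "(real ^ 'd::finite) set \<Rightarrow> bool" where
  "on_common_hyperplane S \<longleftrightarrow> (\<exists>a b. a \<noteq> 0 \<and> S \<subseteq> {x. a \<bullet> x = b})"

definition on_common_hypersphere :: "(real ^ 'd::finite) set \<Rightarrow> bool" where
  "on_common_hypersphere S \<longleftrightarrow> (\<exists>c r. r > 0 \<and> S \<subseteq> sphere c r)"

definition no_d_plus_2_on_sphere :: "(real ^ 'd::finite) set \<Rightarrow> bool" where
  "no_d_plus_2_on_sphere D \<longleftrightarrow>
     (\<forall>S\<subseteq>D. card S = CARD('d) + 1 \<longrightarrow> \<not> on_common_hyperplane S) \<and>
     (\<forall>S\<subseteq>D. card S = CARD('d) + 2 \<longrightarrow> \<not> on_common_hypersphere S)"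

text \<open>The maximum is meaningful for finite \<open>X\<close> only, which is the case for the grids
  (\<open>finite_grid\<close>, \<open>max_no_sphere_attained\<close> below).\<close>

definition max_no_sphere :: "(real ^ 'd::finite) set \<Rightarrow> nat" where
  "max_no_sphere X = Max {card D |D. D \<subseteq> X \<and> no_d_plus_2_on_sphere D}"

lemma finite_grid: "finite (grid n :: (real ^ 'd::finite) set)"
proof -
  have "(grid n :: (real ^ 'd) set) \<subseteq> vec_lambda ` (UNIV \<rightarrow>\<^sub>E real ` {1..n})"
  proof
    fix x :: "real ^ 'd" assume "x \<in> grid n"
    then have "vec_nth x \<in> UNIV \<rightarrow>\<^sub>E real ` {1..n}"
      unfolding grid_def by (auto simp: PiE_def Pi_def image_def)
    then show "x \<in> vec_lambda ` (UNIV \<rightarrow>\<^sub>E real ` {1..n})"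
      by (metis image_eqI vec_nth_inverse)
  qed
  then show ?thesis
    by (rule finite_subset) (simp add: finite_PiE)
qed

lemma max_no_sphere_attained:
  fixes X :: "(real ^ 'd::finite) set"
  assumes "finite X"
  shows "\<exists>D\<subseteq>X. no_d_plus_2_on_sphere D \<and> card D = max_no_sphere X"
    and "\<And>D. D \<subseteq> X \<Longrightarrow> no_d_plus_2_on_sphere D \<Longrightarrow> card D \<le> max_no_sphere X"
proof -
  let ?C = "{card D |D. D \<subseteq> X \<and> no_d_plus_2_on_sphere D}"
  have "?C \<subseteq> card ` Pow X" by auto
  then have fin: "finite ?C" using assms by (meson finite_Pow_iff finite_imageI finite_subset)
  have "no_d_plus_2_on_sphere ({} :: (real ^ 'd) set)"
    by (auto simp: no_d_plus_2_on_sphere_def)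
  then have "?C \<noteq> {}" by blast
  from Max_in[OF fin this]
  show "\<exists>D\<subseteq>X. no_d_plus_2_on_sphere D \<and> card D = max_no_sphere X"
    unfolding max_no_sphere_def by auto
  show "card D \<le> max_no_sphere X" if "D \<subseteq> X" "no_d_plus_2_on_sphere D" for D
    unfolding max_no_sphere_def using that by (intro Max_ge fin) blast
qed

end

theory Submission
  imports Defs "HOL-Number_Theory.Number_Theory" "HOL-Complex_Analysis.Complex_Analysis"
    "HOL-Probability.Sinc_Integral" "HOL-Real_Asymp.Real_Asymp"
begin

text \<open>
  Upper bound: each of the \<open>n\<close> parallel hyperplanes \<open>x\<^sub>1 = k\<close> contains at most \<open>d\<close> points.

  Lower bound: for a prime \<open>p \<equiv> 1 (mod 4)\<close> with \<open>2d < p \<le> n\<close> there is a polynomial curve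
  \<open>(x\<^sub>1(t), \<dots>, x\<^sub>d(t))\<close> over the field with \<open>p\<close> elements whose coordinates span, together with
  the constants, all polynomials of degree at most \<open>d\<close>, while \<open>\<Sum> x\<^sub>k(t)\<^sup>2\<close> is a nonzero multiple of
  \<open>t\<^sup>d\<^sup>+\<^sup>1\<close>. A hyperplane or sphere therefore meets the curve in the roots of a nonzero polynomial of
  degree at most \<open>d\<close> or \<open>d + 1\<close>. A real relation between integer points yields a relation mod \<open>p\<close>,
  so the \<open>p\<close> residue vectors in \<open>[p]\<^sup>d\<close> have the required property.

  It remains to find such primes in \<open>((1 - \<epsilon>) n, n]\<close> for large \<open>n\<close>. The function
  \<open>\<zeta>(s) L(s, \<chi>\<^sub>4)\<close> has a simple pole at \<open>1\<close>, no other pole in \<open>Re s > 0\<close>, and by the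
  3-4-1 inequality no zero on \<open>Re s \<ge> 1\<close>; a Tauberian argument with the Fejer kernel turns
  this into the asymptotics of the Chebyshev function belonging to \<open>(1 + \<chi>\<^sub>4) \<Lambda>\<close>.
\<close>

subsection \<open>Integer relations modulo a prime\<close>

text \<open>The loss in the lower bound is a prime gap. To be \<open>o(n)\<close> it needs primes in
  \<open>((1 - \<epsilon>) n, n]\<close> for every \<open>\<epsilon>\<close>, which is beyond
  Chebyshev type bounds with fixed constants. The moment curve mod \<open>p\<close> would already
  handle hyperplanes, but its squared norm has degree \<open>2 d\<close>, so a sphere could meet it
  in up to \<open>2 d\<close> points. Isotropic vectors lower the degree to \<open>d + 1\<close>.
  Their price is that \<open>-1\<close> must be a square mod \<open>p\<close>, and this turns the
  problem into one about primes in a residue class. Treating the zeta function and the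
  \<open>L\<close>-function as one product keeps the analytic part short: the coefficients
  \<open>(1 + \<chi>) \<Lambda>\<close> are nonnegative, which supplies both the monotonicity for
  the Tauberian argument and the positivity behind the 3-4-1 inequality. For the modulus 4 the value
  \<open>L(1)\<close> is visibly positive.\<close>

lemma int_poly_coeffs_dvd_if_many_roots:
  fixes P :: "int poly" and p :: int
  assumes p: "prime p" and "finite S" and "degree P < card S"
    and "\<And>s. s \<in> S \<Longrightarrow> p dvd poly P s"
    and "\<And>s t. s \<in> S \<Longrightarrow> t \<in> S \<Longrightarrow> p dvd s - t \<Longrightarrow> s = t"
  shows "p dvd Polynomial.coeff P i"
  using assms(2-)
proof (induction "degree P" arbitrary: P S i)
  case 0
  then obtain s where "s \<in> S" by (metis card.empty equals0I less_zeroE)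
  obtain c where c: "P = [:c:]" using 0(1) by (metis degree_eq_zeroE)
  with \<open>s \<in> S\<close> 0(4) have "p dvd c" by fastforce
  then show ?case by (simp add: c coeff_pCons split: nat.splits)
next
  case (Suc m)
  then obtain s where s: "s \<in> S" by (metis card.empty equals0I less_zeroE)
  \<comment> \<open>This is the root bound over the field with \<open>p\<close> elements, kept in
    integer polynomials: dividing by the monic \<open>X - s\<close> stays integral, and the
    remainder \<open>poly P s\<close> is divisible by \<open>p\<close>.\<close>
  define Q where "Q = synthetic_div P s"
  have P: "P = [:poly P s:] + [:-s, 1:] * Q"
    using synthetic_div_correct'[of s P] by (simp add: Q_def)
  have degQ: "degree Q = m" using Suc(2) by (simp add: Q_def degree_synthetic_div)
  have ps: "p dvd poly P s" using Suc s by blast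
  have cQ: "p dvd Polynomial.coeff Q j" for j
  proof (rule Suc(1)[of Q "S - {s}"])
    show "m = degree Q" by (simp add: degQ)
    show "finite (S - {s})" using Suc by simp
    show "degree Q < card (S - {s})" using Suc s degQ by simp
  next
    fix t assume t: "t \<in> S - {s}"
    have "poly P t = poly P s + (t - s) * poly Q t"
      by (subst P) (simp add: algebra_simps)
    moreover have "p dvd poly P t" using Suc t by blast
    ultimately have "p dvd (t - s) * poly Q t" using ps
      by (metis dvd_add_right_iff)
    moreover have "\<not> p dvd t - s" using Suc(6)[of t s] t s by blast
    ultimately show "p dvd poly Q t" using p prime_dvd_mult_iff by blast
  next
    fix u v assume "u \<in> S - {s}" "v \<in> S - {s}" "p dvd u - v"
    then show "u = v" using Suc(6) by blast
  qed
  show ?case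
    by (subst P) (auto simp: coeff_pCons ps cQ split: nat.splits intro!: dvd_add dvd_diff dvd_mult)
qed

text \<open>The reals form a rational vector space in which \<open>{a}\<close> is independent, so
  the assignment of 1 to \<open>a\<close> extends linearly.\<close>

lemma rational_functional_exists:
  fixes a :: real
  assumes "a \<noteq> 0"
  obtains \<phi> :: "real \<Rightarrow> rat" where "\<And>x y. \<phi> (x + y) = \<phi> x + \<phi> y" "\<And>q x. \<phi> (of_rat q * x) = q * \<phi> x" "\<phi> a \<noteq> 0"
proof -
  interpret vector_space_pair "\<lambda>(q::rat) (x::real). of_rat q * x" "(*) :: rat \<Rightarrow> rat \<Rightarrow> rat"
    by unfold_locales (auto simp: algebra_simps of_rat_add of_rat_mult)
  have "vs1.independent {a}" using assms by (simp add: vs1.dependent_single)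
  from linear_independent_extend[OF this, of "\<lambda>_. 1"]
  obtain \<phi> where \<phi>: "Vector_Spaces.linear (\<lambda>q x. of_rat q * x) (*) \<phi>" "\<phi> a = 1" by auto
  show ?thesis
    using \<phi> by (intro that[of \<phi>]) (auto simp: Vector_Spaces.linear_iff)
qed

text \<open>A \<open>\<rat>\<close>-linear functional on the reals turns the real relation into a rational one; clearing
  denominators and dividing by powers of \<open>p\<close> gives the integer relation.\<close>

lemma int_relation_of_real_relation:
  fixes a :: "'k \<Rightarrow> real" and M :: "'j \<Rightarrow> 'k \<Rightarrow> int" and p :: int
  assumes p: "p > 1" and K: "finite K" and nz: "\<exists>k\<in>K. a k \<noteq> 0"
    and rel: "\<And>j. j \<in> J \<Longrightarrow> (\<Sum>k\<in>K. a k * of_int (M j k)) = 0"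
  obtains c :: "'k \<Rightarrow> int" where "\<exists>k\<in>K. \<not> p dvd c k" "\<And>k. k \<in> K \<Longrightarrow> a k = 0 \<Longrightarrow> c k = 0"
    "\<And>j. j \<in> J \<Longrightarrow> (\<Sum>k\<in>K. c k * M j k) = 0"
proof -
  obtain k0 where k0: "k0 \<in> K" "a k0 \<noteq> 0" using nz by blast
  obtain \<phi> :: "real \<Rightarrow> rat" where \<phi>: "\<And>x y. \<phi> (x + y) = \<phi> x + \<phi> y"
    "\<And>q x. \<phi> (of_rat q * x) = q * \<phi> x" "\<phi> (a k0) \<noteq> 0"
    using rational_functional_exists[OF k0(2)] by blast
  have \<phi>0: "\<phi> 0 = 0" using \<phi>(2)[of 0 0] by simp
  have \<phi>sum: "\<phi> (\<Sum>k\<in>K. f k) = (\<Sum>k\<in>K. \<phi> (f k))" for f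
    using K by (induction K rule: finite_induct) (auto simp: \<phi>0 \<phi>(1))
  have relq: "(\<Sum>k\<in>K. \<phi> (a k) * of_int (M j k)) = 0" if "j \<in> J" for j
  proof -
    have "0 = \<phi> (\<Sum>k\<in>K. of_rat (of_int (M j k)) * a k)"
      using rel[OF that] by (simp add: \<phi>0 mult.commute)
    also have "\<dots> = (\<Sum>k\<in>K. \<phi> (a k) * of_int (M j k))"
      unfolding \<phi>sum \<phi>(2) by (simp add: mult.commute)
    finally show ?thesis by simp
  qed
  \<comment> \<open>Zero coefficients have to stay zero: a hyperplane relation must not acquire a
    quadratic term, since \<open>d + 1\<close> points would then be too few.\<close>
  define good where "good c \<longleftrightarrow> (\<forall>k\<in>K. a k = 0 \<longrightarrow> c k = 0) \<and> (\<exists>k\<in>K. c k \<noteq> 0) \<and>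
      (\<forall>j\<in>J. (\<Sum>k\<in>K. c k * M j k) = 0)" for c :: "'k \<Rightarrow> int"
  have "\<exists>c. good c"
  proof -
    define m where "m = (\<Prod>k\<in>K. snd (quotient_of (\<phi> (a k))))"
    have mpos: "m > 0" unfolding m_def by (intro prod_pos) (auto simp: quotient_of_denom_pos')
    have "\<exists>z. of_int m * \<phi> (a k) = of_int z" if "k \<in> K" for k
    proof -
      obtain u v where uv: "quotient_of (\<phi> (a k)) = (u, v)" by (cases "quotient_of (\<phi> (a k))")
      have "v dvd m" unfolding m_def using dvd_prodI[OF K that, of "\<lambda>k. snd (quotient_of (\<phi> (a k)))"] uv by simp
      then obtain w where w: "m = v * w" by blast
      have "v \<noteq> 0" using uv quotient_of_denom_pos by fastforce
      then have "of_int m * \<phi> (a k) = of_int (w * u)"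
        using quotient_of_div[OF uv] by (simp add: w)
      then show ?thesis by blast
    qed
    then obtain z where z: "\<And>k. k \<in> K \<Longrightarrow> of_int m * \<phi> (a k) = of_int (z k)" by metis
    have "(\<Sum>k\<in>K. z k * M j k) = 0" if "j \<in> J" for j
    proof -
      have "(of_int (\<Sum>k\<in>K. z k * M j k) :: rat) = (\<Sum>k\<in>K. of_int m * \<phi> (a k) * of_int (M j k))"
        by (simp add: z)
      also have "\<dots> = of_int m * (\<Sum>k\<in>K. \<phi> (a k) * of_int (M j k))"
        by (simp add: sum_distrib_left mult.assoc)
      also have "\<dots> = 0" using relq[OF that] by simp
      finally show ?thesis by (simp only: of_int_eq_0_iff)
    qed
    moreover have "z k0 \<noteq> 0" using z[OF k0(1)] \<phi>(3) mpos by auto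
    moreover have "z k = 0" if "k \<in> K" "a k = 0" for k using z[OF that(1)] that(2) \<phi>0 by simp
    ultimately have "good z" using k0 unfolding good_def by blast
    then show ?thesis by blast
  qed
  \<comment> \<open>Minimality of the total absolute value replaces the division by the highest
    power of \<open>p\<close>: if \<open>p\<close> divided every entry, dividing once would give a
    smaller good vector.\<close>
  then obtain c where c: "good c"
    and min: "\<And>c'. good c' \<Longrightarrow> (\<Sum>k\<in>K. nat \<bar>c k\<bar>) \<le> (\<Sum>k\<in>K. nat \<bar>c' k\<bar>)"
    using ex_has_least_nat[of good _ "\<lambda>c. \<Sum>k\<in>K. nat \<bar>c k\<bar>"] by blast
  have "\<exists>k\<in>K. \<not> p dvd c k"
  proof (rule ccontr)
    assume "\<not> ?thesis"
    then have dv: "c k = p * (c k div p)" if "k \<in> K" for k using that by simp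
    have sum: "(\<Sum>k\<in>K. c k * M j k) = p * (\<Sum>k\<in>K. c k div p * M j k)" for j
      unfolding sum_distrib_left by (intro sum.cong refl) (metis dv mult.assoc)
    have "good (\<lambda>k. c k div p)"
      unfolding good_def
    proof (intro conjI ballI impI)
      show "c k div p = 0" if "k \<in> K" "a k = 0" for k using c that by (simp add: good_def)
      obtain k where "k \<in> K" "c k \<noteq> 0" using c unfolding good_def by blast
      then show "\<exists>k\<in>K. c k div p \<noteq> 0" using dv by (metis mult_zero_right)
      show "(\<Sum>k\<in>K. c k div p * M j k) = 0" if "j \<in> J" for j
        using sum[of j] c p that by (simp add: good_def)
    qed
    from min[OF this] have le: "(\<Sum>k\<in>K. nat \<bar>c k\<bar>) \<le> (\<Sum>k\<in>K. nat \<bar>c k div p\<bar>)" .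
    have abs: "\<bar>c k\<bar> = p * \<bar>c k div p\<bar>" if "k \<in> K" for k
      using dv[OF that] p by (metis abs_mult abs_of_pos less_trans zero_less_one)
    obtain k where k: "k \<in> K" "c k \<noteq> 0" using c unfolding good_def by blast
    have "(\<Sum>k\<in>K. nat \<bar>c k div p\<bar>) < (\<Sum>k\<in>K. nat \<bar>c k\<bar>)"
    proof (rule sum_strict_mono_ex1[OF K])
      show "\<forall>k\<in>K. nat \<bar>c k div p\<bar> \<le> nat \<bar>c k\<bar>"
      proof
        fix k assume "k \<in> K"
        have "1 * \<bar>c k div p\<bar> \<le> p * \<bar>c k div p\<bar>" using p by (intro mult_right_mono) auto
        then show "nat \<bar>c k div p\<bar> \<le> nat \<bar>c k\<bar>" using abs[OF \<open>k \<in> K\<close>] by simp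
      qed
      have "\<bar>c k div p\<bar> > 0" using k dv[of k] by (auto simp del: dvd_mult_div_cancel)
      then have "1 * \<bar>c k div p\<bar> < p * \<bar>c k div p\<bar>" using p by (intro mult_strict_right_mono) auto
      then show "\<exists>k\<in>K. nat \<bar>c k div p\<bar> < nat \<bar>c k\<bar>" using abs[OF k(1)] k by (intro bexI[of _ k]) auto
    qed
    with le show False by simp
  qed
  then show ?thesis using that[of c] c unfolding good_def by blast
qed

text \<open>For \<open>p = 4 k + 1\<close> the exponent \<open>(p - 1) div 2 = 2 k\<close> in
  Euler's criterion is even, so \<open>-1\<close> has Legendre symbol 1.\<close>

lemma sqrt_minus_one_mod_prime:
  assumes "prime (p::nat)" "p mod 4 = 1"
  obtains \<iota> :: int where "int p dvd \<iota>\<^sup>2 + 1"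
proof -
  have "p \<noteq> 2" using assms(2) by auto
  then have p2: "p > 2" using assms(1) prime_ge_2_nat[of p] by simp
  obtain k where k: "p = 4 * k + 1" using assms(2) by (metis add.commute mult_div_mod_eq)
  have "[Legendre (-1) (int p) = (-1) ^ ((p - 1) div 2)] (mod int p)"
    using euler_criterion[OF assms(1) p2] .
  moreover have "even ((p - 1) div 2)" unfolding k by simp
  ultimately have "[Legendre (-1) (int p) = 1] (mod int p)" by simp
  then have "Legendre (-1) (int p) \<noteq> -1"
    using p2 by (auto simp: cong_iff_dvd_diff zdvd_not_zless)
  then have "QuadRes (int p) (-1)"
    using p2 unfolding Legendre_def by (auto split: if_splits simp: cong_iff_dvd_diff zdvd_not_zless)
  then obtain y where "[y\<^sup>2 = -1] (mod int p)" unfolding QuadRes_def by blast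
  then show ?thesis using that[of y] by (simp add: cong_iff_dvd_diff)
qed


subsection \<open>The curve\<close>

text \<open>Over a field with \<open>\<iota>\<^sup>2 = -1\<close> the form \<open>x\<^sup>2 + y\<^sup>2\<close> is hyperbolic: \<open>x = u + v\<close>,
  \<open>y = \<iota> (u - v)\<close> gives \<open>x\<^sup>2 + y\<^sup>2 = 4 u v\<close>. Pairing \<open>u = t\<^sup>k\<close> with \<open>v = t\<^sup>d\<^sup>+\<^sup>1\<^sup>-\<^sup>k\<close> makes the
  squared norm a multiple of \<open>t\<^sup>d\<^sup>+\<^sup>1\<close>.\<close>

definition curve_coeff1 :: "int \<Rightarrow> nat \<Rightarrow> nat \<Rightarrow> int" where
  "curve_coeff1 \<iota> d k = (if 2 * k \<le> d + 1 then 1 else - \<iota>)"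

text \<open>For odd \<open>d\<close> the index \<open>(d + 1) / 2\<close> is its own partner. The
  coefficient 0 leaves it a single power, whose square is already
  \<open>t ^ (d + 1)\<close>.\<close>

definition curve_coeff2 :: "int \<Rightarrow> nat \<Rightarrow> nat \<Rightarrow> int" where
  "curve_coeff2 \<iota> d k = (if 2 * k < d + 1 then 1 else if 2 * k = d + 1 then 0 else \<iota>)"

definition curve_coord :: "int \<Rightarrow> nat \<Rightarrow> nat \<Rightarrow> int \<Rightarrow> int" where
  "curve_coord \<iota> d k t = curve_coeff1 \<iota> d k * t ^ k + curve_coeff2 \<iota> d k * t ^ (d + 1 - k)"

text \<open>The shift by 1 selects the representative in \<open>{1..p}\<close>, because the grid
  starts at 1.\<close>

definition reduced_coord :: "nat \<Rightarrow> int \<Rightarrow> nat \<Rightarrow> int \<Rightarrow> nat \<Rightarrow> int" where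
  "reduced_coord p \<iota> d t k = (curve_coord \<iota> d k t - 1) mod int p + 1"

text \<open>A pair contributes \<open>4 u v\<close>, booked as 2 on each of its two indices; a
  self-paired index contributes 1.\<close>

definition norm_coeff :: "nat \<Rightarrow> int" where
  "norm_coeff d = (\<Sum>k=1..d. if 2 * k = d + 1 then 1 else 2)"

text \<open>For \<open>d \<ge> 1\<close> these bounds make \<open>norm_coeff d\<close> a nonzero
  residue as soon as \<open>2 * d < p\<close>, which explains that condition on the prime.\<close>

lemma norm_coeff_bounds: "int d \<le> norm_coeff d" "norm_coeff d \<le> 2 * int d"
proof -
  have "(\<Sum>k=1..d. (1::int)) \<le> norm_coeff d" unfolding norm_coeff_def by (rule sum_mono) auto
  then show "int d \<le> norm_coeff d" by simp
  have "norm_coeff d \<le> (\<Sum>k=1..d. (2::int))" unfolding norm_coeff_def by (rule sum_mono) auto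
  then show "norm_coeff d \<le> 2 * int d" by simp
qed

lemma curve_norm:
  assumes "[\<iota>\<^sup>2 = -1] (mod m)"
  shows "[(\<Sum>k=1..d. (curve_coord \<iota> d k t)\<^sup>2) = norm_coeff d * t ^ (d + 1)] (mod m)"
proof -
  \<comment> \<open>Each square is \<open>e k * t ^ (d + 1)\<close> plus \<open>s k\<close>, and
    \<open>s\<close> changes sign under \<open>k \<mapsto> d + 1 - k\<close>. So the sum of
    \<open>s\<close> equals its own negative, and no list of pairs is required.\<close>
  define s where "s k = (if 2 * k = d + 1 then 0 else if 2 * k < d + 1 then 1 else -1) *
      ((t ^ k)\<^sup>2 + (t ^ (d + 1 - k))\<^sup>2)" for k
  define e :: "nat \<Rightarrow> int" where "e k = (if 2 * k = d + 1 then 1 else 2)" for k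
  have "[(curve_coord \<iota> d k t)\<^sup>2 = s k + e k * t ^ (d + 1)] (mod m)" if "k \<in> {1..d}" for k
  proof -
    have td: "t ^ (d + 1) = t ^ k * t ^ (d + 1 - k)"
      using that by (simp flip: power_add)
    consider "2 * k < d + 1" | "2 * k = d + 1" | "2 * k > d + 1" by linarith
    then show ?thesis
    proof cases
      case 1
      then show ?thesis unfolding td
        by (simp add: curve_coord_def curve_coeff1_def curve_coeff2_def s_def e_def power2_eq_square algebra_simps)
    next
      case 2
      then have "d + 1 - k = k" by simp
      with 2 show ?thesis unfolding td
        by (simp add: curve_coord_def curve_coeff1_def curve_coeff2_def s_def e_def power2_eq_square)
    next
      case 3
      have "(curve_coord \<iota> d k t)\<^sup>2 = \<iota>\<^sup>2 * (t ^ k - t ^ (d + 1 - k))\<^sup>2"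
        using 3 by (simp add: curve_coord_def curve_coeff1_def curve_coeff2_def power2_eq_square algebra_simps)
      moreover have "[\<iota>\<^sup>2 * (t ^ k - t ^ (d + 1 - k))\<^sup>2 = (-1) * (t ^ k - t ^ (d + 1 - k))\<^sup>2] (mod m)"
        by (rule cong_mult[OF assms cong_refl])
      moreover have "(-1) * (t ^ k - t ^ (d + 1 - k))\<^sup>2 = s k + e k * t ^ (d + 1)"
        using 3 unfolding td by (simp add: s_def e_def power2_eq_square algebra_simps)
      ultimately show ?thesis by simp
    qed
  qed
  then have "[(\<Sum>k=1..d. (curve_coord \<iota> d k t)\<^sup>2) = (\<Sum>k=1..d. s k + e k * t ^ (d + 1))] (mod m)"
    by (rule cong_sum)
  moreover have "(\<Sum>k=1..d. s k) = (\<Sum>k=1..d. - s k)"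
    by (rule sum.reindex_bij_witness[of _ "\<lambda>k. d + 1 - k" "\<lambda>k. d + 1 - k"])
       (auto simp: s_def)
  then have "(\<Sum>k=1..d. s k) = 0" by (simp add: sum_negf)
  then have "(\<Sum>k=1..d. s k + e k * t ^ (d + 1)) = norm_coeff d * t ^ (d + 1)"
    by (simp add: sum.distrib norm_coeff_def e_def sum_distrib_right)
  ultimately show ?thesis by simp
qed

lemma reduced_coord_cong: "[reduced_coord p \<iota> d t k = curve_coord \<iota> d k t] (mod int p)"
  unfolding reduced_coord_def cong_def by (simp add: mod_simps)

text \<open>The relation is a polynomial in \<open>t\<close> with more incongruent roots than its
  degree, so \<open>p\<close> divides all its coefficients. Those at \<open>i\<close> and
  \<open>d + 1 - i\<close> are \<open>c i + \<iota> * c (d + 1 - i)\<close> and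
  \<open>c i - \<iota> * c (d + 1 - i)\<close> when \<open>2 * i < d + 1\<close>: a system of
  determinant \<open>-2 \<iota>\<close>, invertible mod \<open>p\<close>.\<close>

lemma curve_relation_trivial_mod_prime:
  fixes p :: nat and c :: "nat \<Rightarrow> int"
  assumes p: "prime p" "2 * d < p" and \<iota>: "int p dvd \<iota>\<^sup>2 + 1" and d: "d \<ge> 1"
    and T: "T \<subseteq> {0..<int p}"
    and card: "card T \<ge> d + 1" "c (d + 1) = 0 \<or> card T \<ge> d + 2"
    and rel: "\<And>t. t \<in> T \<Longrightarrow> int p dvd c 0 + (\<Sum>k=1..d. c k * curve_coord \<iota> d k t) + c (d + 1) * (norm_coeff d * t ^ (d + 1))"
    and j: "j \<le> d + 1"
  shows "int p dvd c j"
proof -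
  have pp: "prime (int p)" using p by simp
  define Q where "Q = [:c 0:] + (\<Sum>k=1..d. Polynomial.smult (c k)
      (Polynomial.monom (curve_coeff1 \<iota> d k) k + Polynomial.monom (curve_coeff2 \<iota> d k) (d + 1 - k)))
      + Polynomial.monom (c (d + 1) * norm_coeff d) (d + 1)"
  have polyQ: "poly Q t = c 0 + (\<Sum>k=1..d. c k * curve_coord \<iota> d k t) + c (d + 1) * (norm_coeff d * t ^ (d + 1))" for t
    by (simp add: Q_def poly_sum poly_monom curve_coord_def mult.assoc)
  have coeffQ: "Polynomial.coeff Q i = (if i = 0 then c 0 else 0) + (\<Sum>k=1..d. c k *
      ((if k = i then curve_coeff1 \<iota> d k else 0) + (if d + 1 - k = i then curve_coeff2 \<iota> d k else 0)))
      + (if i = d + 1 then c (d + 1) * norm_coeff d else 0)" for i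
    by (auto simp: Q_def coeff_sum Polynomial.coeff_monom coeff_pCons split: nat.splits)
  have high: "Polynomial.coeff Q i = 0" if "i > d + 1" for i
    unfolding coeffQ using that by (auto intro!: sum.neutral)
  have top: "Polynomial.coeff Q (d + 1) = c (d + 1) * norm_coeff d"
    unfolding coeffQ by (auto intro!: sum.neutral)
  have bot: "Polynomial.coeff Q 0 = c 0"
    unfolding coeffQ by (auto intro!: sum.neutral)
  have mid: "Polynomial.coeff Q i = c i * curve_coeff1 \<iota> d i + c (d + 1 - i) * curve_coeff2 \<iota> d (d + 1 - i)"
    if "i \<in> {1..d}" for i
  proof -
    have "(\<Sum>k=1..d. c k * ((if k = i then curve_coeff1 \<iota> d k else 0) + (if d + 1 - k = i then curve_coeff2 \<iota> d k else 0)))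
      = (\<Sum>k=1..d. (if k = i then c k * curve_coeff1 \<iota> d k else 0)) +
        (\<Sum>k=1..d. (if k = d + 1 - i then c k * curve_coeff2 \<iota> d k else 0))"
      unfolding sum.distrib[symmetric]
      by (intro sum.cong refl) (use that in \<open>auto simp: algebra_simps\<close>)
    also have "\<dots> = c i * curve_coeff1 \<iota> d i + c (d + 1 - i) * curve_coeff2 \<iota> d (d + 1 - i)"
      using that by (subst (1 2) sum.delta) auto
    finally show ?thesis using that unfolding coeffQ by auto
  qed
  have finT: "finite T" using T finite_subset by blast
  have "degree Q \<le> d + 1" using high by (intro degree_le) auto
  moreover have "degree Q \<le> d" if "c (d + 1) = 0"
  proof (rule degree_le, intro allI impI)
    fix i assume "i > d"
    then show "Polynomial.coeff Q i = 0" using high[of i] top that by (cases "i = d + 1") auto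
  qed
  ultimately have "degree Q < card T" using card by auto
  moreover have "s = t" if "s \<in> T" "t \<in> T" "int p dvd s - t" for s t
    using that T by (metis atLeastLessThan_iff mod_eq_dvd_iff mod_pos_pos_trivial subsetD)
  ultimately have dv: "int p dvd Polynomial.coeff Q i" for i
    using int_poly_coeffs_dvd_if_many_roots[OF pp finT] rel polyQ by metis
  have not2: "\<not> int p dvd 2" using p d by (auto dest!: zdvd_imp_le)
  have not\<iota>: "\<not> int p dvd \<iota>"
  proof
    assume "int p dvd \<iota>"
    then have "int p dvd \<iota>\<^sup>2" by (simp add: power2_eq_square)
    with \<iota> have "int p dvd 1" using dvd_add_right_iff by blast
    then show False using pp by (metis not_prime_unit)
  qed
  have pair: "int p dvd c i \<and> int p dvd c (d + 1 - i)" if i: "i \<in> {1..d}" "2 * i < d + 1" for i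
  proof -
    have i': "d + 1 - i \<in> {1..d}" "d + 1 - (d + 1 - i) = i" "\<not> 2 * (d + 1 - i) \<le> d + 1"
      using i by auto
    have 1: "int p dvd c i + \<iota> * c (d + 1 - i)"
      using dv[of i] i i' unfolding mid[OF i(1)] curve_coeff1_def curve_coeff2_def by (simp add: mult.commute)
    have 2: "int p dvd c i - \<iota> * c (d + 1 - i)"
      using dv[of "d + 1 - i"] i i' unfolding mid[OF i'(1)] curve_coeff1_def curve_coeff2_def
      by (simp add: algebra_simps)
    have "int p dvd 2 * c i" using dvd_add[OF 1 2] by simp
    then have 3: "int p dvd c i" using not2 pp prime_dvd_mult_iff by blast
    then have "int p dvd \<iota> * c (d + 1 - i)" using 1 dvd_add_right_iff by blast
    then show ?thesis using 3 not\<iota> pp prime_dvd_mult_iff by blast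
  qed
  consider "j = 0" | "j = d + 1" | "j \<in> {1..d}" "2 * j < d + 1" | "j \<in> {1..d}" "2 * j = d + 1"
    | "j \<in> {1..d}" "2 * j > d + 1" using j by fastforce
  then show ?thesis
  proof cases
    case 1 then show ?thesis using dv[of 0] bot by simp
  next
    case 2
    have "\<not> int p dvd norm_coeff d"
      using norm_coeff_bounds[of d] p d by (auto dest!: zdvd_imp_le)
    then show ?thesis using dv[of "d + 1"] 2 pp unfolding top by (simp add: prime_dvd_mult_iff)
  next
    case 3 then show ?thesis using pair by blast
  next
    case 4
    then have "d + 1 - j = j" by simp
    then show ?thesis using dv[of j] 4 unfolding mid[OF 4(1)] curve_coeff1_def curve_coeff2_def by simp
  next
    case 5
    then have "d + 1 - j \<in> {1..d}" "2 * (d + 1 - j) < d + 1" "d + 1 - (d + 1 - j) = j" by auto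
    then show ?thesis using pair[of "d + 1 - j"] by simp
  qed
qed

text \<open>Equations of hyperplanes and spheres are linear in 1, the coordinates and the squared
  norm, so one statement serves both. The last coefficient decides whether \<open>d + 1\<close>
  points suffice or \<open>d + 2\<close> are required.\<close>

lemma curve_no_real_relation:
  fixes p :: nat and a :: "nat \<Rightarrow> real"
  assumes p: "prime p" "2 * d < p" and \<iota>: "int p dvd \<iota>\<^sup>2 + 1" and d: "d \<ge> 1"
    and T: "T \<subseteq> {0..<int p}"
    and card: "card T \<ge> d + 1" "a (d + 1) = 0 \<or> card T \<ge> d + 2"
    and rel: "\<And>t. t \<in> T \<Longrightarrow> a 0 + (\<Sum>k=1..d. a k * of_int (reduced_coord p \<iota> d t k))
        + a (d + 1) * (\<Sum>k=1..d. (of_int (reduced_coord p \<iota> d t k))\<^sup>2) = 0"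
    and j: "j \<le> d + 1"
  shows "a j = 0"
proof (rule ccontr)
  assume aj: "a j \<noteq> 0"
  define M where "M t k = (if k = 0 then 1 else if k = d + 1 then (\<Sum>k=1..d. (reduced_coord p \<iota> d t k)\<^sup>2)
      else reduced_coord p \<iota> d t k)" for t k
  have split: "(\<Sum>k\<in>{0..d+1}. f k) = f 0 + (\<Sum>k=1..d. f k) + f (d + 1)" for f :: "nat \<Rightarrow> 'x::comm_monoid_add"
    by (simp add: sum.atLeast_Suc_atMost add.assoc)
  have M: "(\<Sum>k=1..d. f k * g (M t k)) = (\<Sum>k=1..d. f k * g (reduced_coord p \<iota> d t k))"
    for f :: "nat \<Rightarrow> 'x::comm_ring_1" and g t
    by (intro sum.cong) (auto simp: M_def)
  have p1: "int p > 1" using p prime_gt_1_nat by auto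
  have relM: "(\<Sum>k\<in>{0..d+1}. a k * of_int (M t k)) = 0" if "t \<in> T" for t
    using rel[OF that] unfolding split M by (simp add: M_def)
  have nz: "\<exists>k\<in>{0..d+1}. a k \<noteq> 0" using aj j by (intro bexI[of _ j]) auto
  obtain c where c: "\<exists>k\<in>{0..d+1}. \<not> int p dvd c k" "\<And>k. k \<in> {0..d+1} \<Longrightarrow> a k = 0 \<Longrightarrow> c k = 0"
    "\<And>t. t \<in> T \<Longrightarrow> (\<Sum>k\<in>{0..d+1}. c k * M t k) = 0"
    by (rule int_relation_of_real_relation[OF p1 finite_atLeastAtMost nz relM]) (assumption | rule that)+
  have "int p dvd c k" if "k \<le> d + 1" for k
  proof (rule curve_relation_trivial_mod_prime[OF p \<iota> d T card(1) _ _ that])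
    show "c (d + 1) = 0 \<or> card T \<ge> d + 2" using card c(2)[of "d + 1"] by auto
    fix t assume t: "t \<in> T"
    have "[\<iota>\<^sup>2 = -1] (mod int p)" using \<iota> by (simp add: cong_iff_dvd_diff)
    from curve_norm[OF this]
    have nrm: "[(\<Sum>k=1..d. (reduced_coord p \<iota> d t k)\<^sup>2) = norm_coeff d * t ^ (d + 1)] (mod int p)"
      by (rule cong_trans[rotated]) (intro cong_sum cong_pow reduced_coord_cong)
    have "[c 0 + (\<Sum>k=1..d. c k * reduced_coord p \<iota> d t k) + c (d + 1) * (\<Sum>k=1..d. (reduced_coord p \<iota> d t k)\<^sup>2)
      = c 0 + (\<Sum>k=1..d. c k * curve_coord \<iota> d k t) + c (d + 1) * (norm_coeff d * t ^ (d + 1))] (mod int p)"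
      by (intro cong_add cong_mult cong_sum nrm reduced_coord_cong cong_refl)
    moreover have "c 0 + (\<Sum>k=1..d. c k * reduced_coord p \<iota> d t k) + c (d + 1) * (\<Sum>k=1..d. (reduced_coord p \<iota> d t k)\<^sup>2) = 0"
      using c(3)[OF t] M[of c "\<lambda>x. x" t] unfolding split by (simp add: M_def)
    ultimately show "int p dvd c 0 + (\<Sum>k=1..d. c k * curve_coord \<iota> d k t) + c (d + 1) * (norm_coeff d * t ^ (d + 1))"
      by (metis cong_0_iff cong_sym)
  qed
  then show False using c(1) by auto
qed

text \<open>The parameter is recovered from the paired coordinates 1 and \<open>d\<close>: with
  \<open>u = t\<close> and \<open>v = t ^ d\<close>, the combination
  \<open>(u + v) - \<iota> * (\<iota> * (u - v))\<close> is congruent to \<open>2 u\<close>. The two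
  indices are distinct because \<open>d \<ge> 2\<close>.\<close>

lemma reduced_coord_inj:
  assumes p: "prime p" "p > 2" and \<iota>: "int p dvd \<iota>\<^sup>2 + 1" and d: "d \<ge> 2"
    and st: "s \<in> {0..<int p}" "t \<in> {0..<int p}"
    and eq: "\<And>k. k \<in> {1..d} \<Longrightarrow> reduced_coord p \<iota> d s k = reduced_coord p \<iota> d t k"
  shows "s = t"
proof -
  have eq': "[curve_coord \<iota> d k s = curve_coord \<iota> d k t] (mod int p)" if "k \<in> {1..d}" for k
    using eq[OF that] reduced_coord_cong by (metis cong_sym cong_trans)
  have "[curve_coord \<iota> d 1 s - \<iota> * curve_coord \<iota> d d s = curve_coord \<iota> d 1 t - \<iota> * curve_coord \<iota> d d t] (mod int p)"
    by (intro cong_diff cong_mult cong_refl eq') (use d in auto)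
  moreover have "curve_coord \<iota> d 1 x - \<iota> * curve_coord \<iota> d d x = 2 * x + (\<iota>\<^sup>2 + 1) * (x ^ d - x)" for x
    using d by (simp add: curve_coord_def curve_coeff1_def curve_coeff2_def power2_eq_square algebra_simps)
  moreover have "[2 * x + (\<iota>\<^sup>2 + 1) * (x ^ d - x) = 2 * x + 0 * (x ^ d - x)] (mod int p)" for x
    by (intro cong_add cong_mult cong_refl) (use \<iota> in \<open>simp add: cong_0_iff\<close>)
  ultimately have "[2 * s = 2 * t] (mod int p)"
    by (metis (no_types, lifting) add.right_neutral cong_sym cong_trans mult_zero_left)
  moreover have "coprime 2 (int p)"
    using p by (metis coprime_commute coprime_left_2_iff_odd even_of_nat prime_odd_nat)
  ultimately have "[s = t] (mod int p)" by (simp add: cong_mult_lcancel)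
  then show ?thesis using st by (simp add: cong_def)
qed

section \<open>Bounds for the extremal function of the grid\<close>

lemma max_no_sphere_grid_ge_prime:
  assumes d: "CARD('d::finite) \<ge> 2" and p: "prime p" "p mod 4 = 1" "2 * CARD('d) < p" "p \<le> n"
  shows "p \<le> max_no_sphere (grid n :: (real ^ 'd) set)"
proof -
  define d where "d = CARD('d)"
  obtain \<iota> where \<iota>: "int p dvd \<iota>\<^sup>2 + 1" using sqrt_minus_one_mod_prime p by blast
  obtain \<sigma> :: "'d \<Rightarrow> nat" where \<sigma>: "bij_betw \<sigma> UNIV {1..d}"
    using bij_betw_iff_card[of "UNIV :: 'd set" "{1..d}"] by (auto simp: d_def)
  have sum\<sigma>: "(\<Sum>i\<in>UNIV. f (\<sigma> i)) = (\<Sum>k=1..d. f k)" for f :: "nat \<Rightarrow> real"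
    using sum.reindex_bij_betw[OF \<sigma>] .
  define \<tau> where "\<tau> = inv_into UNIV \<sigma>"
  have \<tau>: "\<tau> (\<sigma> i) = i" for i using \<sigma> by (simp add: \<tau>_def bij_betw_def)
  have \<sigma>in: "\<sigma> i \<in> {1..d}" for i using \<sigma> by (auto simp: bij_betw_def)
  define P :: "int \<Rightarrow> real ^ 'd" where "P t = (\<chi> i. of_int (reduced_coord p \<iota> d t (\<sigma> i)))" for t
  have p0: "p > 0" and p2: "p > 2" and pd: "2 * d < p" and d1: "d \<ge> 1" and d2: "d \<ge> 2" using p d by (auto simp: d_def)
  define D where "D = P ` {0..<int p}"
  have "inj_on P {0..<int p}"
  proof (rule inj_onI)
    fix s t assume st: "s \<in> {0..<int p}" "t \<in> {0..<int p}" and eq: "P s = P t"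
    show "s = t"
    proof (rule reduced_coord_inj[OF p(1) p2 \<iota> d2 st])
      fix k assume "k \<in> {1..d}"
      then obtain i where "k = \<sigma> i" using \<sigma> by (metis bij_betw_imp_surj_on imageE)
      then show "reduced_coord p \<iota> d s k = reduced_coord p \<iota> d t k"
        using arg_cong[OF eq, of "\<lambda>v. v $ i"] by (simp add: P_def)
    qed
  qed
  then have cardD: "card D = p" by (simp add: D_def card_image)
  have Dgrid: "D \<subseteq> grid n"
  proof -
    have "\<exists>k\<in>{1..n}. (of_int (reduced_coord p \<iota> d t j) :: real) = real k" for t j
    proof (rule bexI[of _ "nat (reduced_coord p \<iota> d t j)"])
      have "1 \<le> reduced_coord p \<iota> d t j \<and> reduced_coord p \<iota> d t j \<le> int p"
        using p0 pos_mod_bound[of "int p" "curve_coord \<iota> d j t - 1"]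
          pos_mod_sign[of "int p" "curve_coord \<iota> d j t - 1"] unfolding reduced_coord_def by linarith
      then show "nat (reduced_coord p \<iota> d t j) \<in> {1..n}" "(of_int (reduced_coord p \<iota> d t j) :: real) = real (nat (reduced_coord p \<iota> d t j))"
        using p by auto
    qed
    then show ?thesis by (auto simp: D_def grid_def P_def)
  qed
  have pre: "\<exists>T\<subseteq>{0..<int p}. card T \<ge> card S \<and> P ` T = S" if SD: "S \<subseteq> D" for S
  proof -
    obtain T where T: "T \<subseteq> {0..<int p}" "S = P ` T" using SD unfolding D_def subset_image_iff by blast
    then have "card S \<le> card T" using card_image_le[OF finite_subset[OF T(1)]] by simp
    then show ?thesis using T by blast
  qed
  have "\<not> on_common_hyperplane S" if S: "S \<subseteq> D" "card S = CARD('d) + 1" for S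
  proof
    assume "on_common_hyperplane S"
    then obtain a b where a: "a \<noteq> 0" and ab: "\<And>x. x \<in> S \<Longrightarrow> a \<bullet> x = b"
      unfolding on_common_hyperplane_def by blast
    obtain T where T: "T \<subseteq> {0..<int p}" "card T \<ge> d + 1" "P ` T = S" using pre[OF S(1)] S(2) d_def by auto
    define \<alpha> where "\<alpha> k = (if k = 0 then - b else if k = d + 1 then 0 else a $ \<tau> k)" for k
    have \<alpha>\<sigma>: "\<alpha> (\<sigma> i) = a $ i" for i using \<sigma>in[of i] by (auto simp: \<alpha>_def \<tau>)
    have "\<alpha> j = 0" if "j \<le> d + 1" for j
    proof (rule curve_no_real_relation[OF p(1) pd \<iota> d1 T(1,2) _ _ that])
      show "\<alpha> (d + 1) = 0 \<or> d + 2 \<le> card T" by (simp add: \<alpha>_def)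
      fix t assume "t \<in> T"
      then have "a \<bullet> P t = b" using T ab by blast
      then have "(\<Sum>i\<in>UNIV. \<alpha> (\<sigma> i) * of_int (reduced_coord p \<iota> d t (\<sigma> i))) = b"
        by (simp add: inner_vec_def P_def \<alpha>\<sigma>)
      then have "(\<Sum>k=1..d. \<alpha> k * of_int (reduced_coord p \<iota> d t k)) = b"
        using sum\<sigma>[of "\<lambda>k. \<alpha> k * of_int (reduced_coord p \<iota> d t k)"] by simp
      then show "\<alpha> 0 + (\<Sum>k=1..d. \<alpha> k * of_int (reduced_coord p \<iota> d t k))
          + \<alpha> (d + 1) * (\<Sum>k=1..d. (of_int (reduced_coord p \<iota> d t k))\<^sup>2) = 0"
        by (simp add: \<alpha>_def)
    qed
    then have "a $ i = 0" for i using \<alpha>\<sigma>[of i] \<sigma>in[of i] by (metis atLeastAtMost_iff le_add1 order_trans)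
    then show False using a by (simp add: vec_eq_iff)
  qed
  moreover have "\<not> on_common_hypersphere S" if S: "S \<subseteq> D" "card S = CARD('d) + 2" for S
  proof
    assume "on_common_hypersphere S"
    then obtain c r where cr: "\<And>x. x \<in> S \<Longrightarrow> dist c x = r"
      unfolding on_common_hypersphere_def sphere_def by blast
    obtain T where T: "T \<subseteq> {0..<int p}" "card T \<ge> d + 2" "P ` T = S" using pre[OF S(1)] S(2) d_def by auto
    then have T1: "card T \<ge> d + 1" by simp
    \<comment> \<open>Expanding \<open>dist c x = r\<close> puts the coefficient 1 on the squared
      norm, so the contradiction appears at index \<open>d + 1\<close> alone.\<close>
    define \<alpha> where "\<alpha> k = (if k = 0 then c \<bullet> c - r\<^sup>2 else if k = d + 1 then 1 else - 2 * c $ \<tau> k)" for k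
    have \<alpha>\<sigma>: "\<alpha> (\<sigma> i) = - 2 * c $ i" for i using \<sigma>in[of i] by (auto simp: \<alpha>_def \<tau>)
    have "\<alpha> (d + 1) = 0"
    proof (rule curve_no_real_relation[OF p(1) pd \<iota> d1 T(1) T1])
      show "\<alpha> (d + 1) = 0 \<or> d + 2 \<le> card T" using T by simp
      show "d + 1 \<le> d + 1" by simp
      fix t assume "t \<in> T"
      then have "dist c (P t) = r" using T cr by blast
      then have "(c - P t) \<bullet> (c - P t) = r\<^sup>2" by (metis dist_norm power2_norm_eq_inner)
      then have "c \<bullet> c - r\<^sup>2 - 2 * (c \<bullet> P t) + P t \<bullet> P t = 0"
        by (simp add: inner_diff_left inner_diff_right inner_commute)
      moreover have "- 2 * (c \<bullet> P t) = (\<Sum>i\<in>UNIV. \<alpha> (\<sigma> i) * of_int (reduced_coord p \<iota> d t (\<sigma> i)))"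
        by (simp add: inner_vec_def P_def \<alpha>\<sigma> sum_distrib_left mult.assoc sum_negf)
      moreover have "\<dots> = (\<Sum>k=1..d. \<alpha> k * of_int (reduced_coord p \<iota> d t k))"
        by (rule sum\<sigma>)
      moreover have "P t \<bullet> P t = (\<Sum>i\<in>UNIV. (of_int (reduced_coord p \<iota> d t (\<sigma> i)))\<^sup>2)"
        by (simp add: inner_vec_def P_def power2_eq_square)
      moreover have "\<dots> = (\<Sum>k=1..d. (of_int (reduced_coord p \<iota> d t k))\<^sup>2)"
        by (rule sum\<sigma>)
      ultimately show "\<alpha> 0 + (\<Sum>k=1..d. \<alpha> k * of_int (reduced_coord p \<iota> d t k))
          + \<alpha> (d + 1) * (\<Sum>k=1..d. (of_int (reduced_coord p \<iota> d t k))\<^sup>2) = 0"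
        by (simp add: \<alpha>_def)
    qed
    then show False by (simp add: \<alpha>_def)
  qed
  ultimately have "no_d_plus_2_on_sphere D" unfolding no_d_plus_2_on_sphere_def by blast
  then show ?thesis using max_no_sphere_attained(2)[OF finite_grid Dgrid] cardD by simp
qed

lemma max_no_sphere_grid_le:
  "max_no_sphere (grid n :: (real ^ 'd::finite) set) \<le> CARD('d) * n"
proof -
  obtain D :: "(real ^ 'd) set" where D: "D \<subseteq> grid n" "no_d_plus_2_on_sphere D" "card D = max_no_sphere (grid n :: (real ^ 'd) set)"
    using max_no_sphere_attained(1)[OF finite_grid] by blast
  define i :: 'd where "i = undefined"
  define L where "L k = {x \<in> D. x $ i = real k}" for k
  have finD: "finite D" using D(1) finite_grid finite_subset by blast
  have "D \<subseteq> (\<Union>k\<in>{1..n}. L k)" using D(1) by (fastforce simp: grid_def L_def)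
  then have "card D \<le> card (\<Union>k\<in>{1..n}. L k)" by (rule card_mono[rotated]) (auto simp: L_def finD)
  also have "\<dots> \<le> (\<Sum>k\<in>{1..n}. card (L k))" by (rule card_UN_le) simp
  also have "\<dots> \<le> (\<Sum>k\<in>{1..n}. CARD('d))"
  proof (rule sum_mono, rule ccontr)
    fix k assume "\<not> card (L k) \<le> CARD('d)"
    then obtain S where S: "S \<subseteq> L k" "card S = CARD('d) + 1"
      by (metis Suc_eq_plus1 not_less_eq_eq obtain_subset_with_card_n)
    have "on_common_hyperplane S" unfolding on_common_hyperplane_def
      using S(1) by (intro exI[of _ "axis i 1"] exI[of _ "real k"]) (auto simp: L_def inner_axis' axis_eq_0_iff)
    moreover have "S \<subseteq> D" using S(1) by (auto simp: L_def)
    ultimately show False using D(2) S(2) unfolding no_d_plus_2_on_sphere_def by blast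
  qed
  finally show ?thesis using D(3) by (simp add: mult.commute)
qed

subsection \<open>Laplace transforms and the Fejer kernel\<close>

text \<open>Serves with \<open>a = 0\<close> for the pole term of the Tauberian theorem and with
  \<open>a = ln n\<close> for the jumps of the Chebyshev function.\<close>

lemma laplace_exp_atLeast:
  fixes s :: complex
  assumes s: "Re s > 0"
  shows "integrable lborel (\<lambda>t. indicator {a..} t * exp (- s * of_real t))" (is "integrable _ ?f")
    and "(\<integral>t. indicator {a..} t * exp (- s * of_real t) \<partial>lborel) = exp (- s * of_real a) / s"
proof -
  have "(\<integral>\<^sup>+t. ennreal (exp (- Re s * t)) * indicator {a..} t \<partial>lborel) = 0 - (- exp (- Re s * a) / Re s)"
  proof (rule nn_integral_FTC_atLeast)
    show "((\<lambda>t. - exp (- Re s * t) / Re s) has_real_derivative exp (- Re s * t)) (at t)" for t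
      using s by (auto intro!: derivative_eq_intros)
    show "((\<lambda>t. - exp (- Re s * t) / Re s) \<longlongrightarrow> 0) at_top"
      using s by real_asymp
  qed auto
  moreover have "ennreal (norm (?f t)) = ennreal (exp (- Re s * t)) * indicator {a..} t" for t
    by (auto simp: norm_mult split: split_indicator)
  ultimately show int: "integrable lborel ?f"
    by (intro integrableI_bounded) auto
  have "((\<lambda>b. \<integral>t. indicator {..b} t *\<^sub>R ?f t \<partial>lborel) \<longlongrightarrow> (\<integral>t. ?f t \<partial>lborel)) at_top"
    by (rule tendsto_integral_at_top) (use int in auto)
  moreover have "((\<lambda>b. \<integral>t. indicator {..b} t *\<^sub>R ?f t \<partial>lborel) \<longlongrightarrow> exp (- s * of_real a) / s) at_top"
  proof (rule Lim_transform_eventually)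
    show "eventually (\<lambda>b. - exp (- s * of_real b) / s - (- exp (- s * of_real a) / s) =
        (\<integral>t. indicator {..b} t *\<^sub>R ?f t \<partial>lborel)) at_top"
      using eventually_ge_at_top[of a]
    proof eventually_elim
      case (elim b)
      have "(\<integral>t. indicator {a..b} t *\<^sub>R exp (- s * of_real t) \<partial>lborel) =
          - exp (- s * of_real b) / s - (- exp (- s * of_real a) / s)"
      proof (rule integral_FTC_Icc[OF elim])
        show "((\<lambda>t. - exp (- s * of_real t) / s) has_vector_derivative exp (- s * of_real t)) (at t within {a..b})" for t
          by (rule has_vector_derivative_real_field) (use s in \<open>auto intro!: derivative_eq_intros\<close>)
      qed (auto intro!: continuous_intros)
      moreover have "(\<integral>t. indicator {..b} t *\<^sub>R ?f t \<partial>lborel) = (\<integral>t. indicator {a..b} t *\<^sub>R exp (- s * of_real t) \<partial>lborel)"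
        by (intro Bochner_Integration.integral_cong) (auto split: split_indicator)
      ultimately show ?case by simp
    qed
    have "((\<lambda>b. norm (exp (- s * complex_of_real b))) \<longlongrightarrow> 0) at_top"
      using s by simp real_asymp
    then have "((\<lambda>b. exp (- s * complex_of_real b)) \<longlongrightarrow> 0) at_top" by (rule tendsto_norm_zero_cancel)
    then have "((\<lambda>b. - exp (- s * complex_of_real b) / s - (- exp (- s * of_real a) / s)) \<longlongrightarrow> - 0 / s - (- exp (- s * of_real a) / s)) at_top"
      using s by (intro tendsto_intros) auto
    then show "((\<lambda>b. - exp (- s * complex_of_real b) / s - (- exp (- s * of_real a) / s)) \<longlongrightarrow> exp (- s * of_real a) / s) at_top"
      by simp
  qed
  ultimately show "(\<integral>t. ?f t \<partial>lborel) = exp (- s * of_real a) / s"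
    using tendsto_unique trivial_limit_at_top_linorder by blast
qed

section \<open>The Fejer kernel and its Fourier representation\<close>

text \<open>This is the square of \<open>sin (u/2) / (u/2)\<close>, with its limit as value at
  0.\<close>

definition fejer :: "real \<Rightarrow> real" where
  "fejer u = (if u = 0 then 1 else 2 * (1 - cos u) / u\<^sup>2)"

text \<open>Its compact support is essential: only a bounded segment of a vertical line enters each
  average, so no growth estimate in the imaginary direction is required.\<close>

definition tent :: "real \<Rightarrow> real" where
  "tent v = max 0 (1 - \<bar>v\<bar>)"

lemma fejer_nonneg: "fejer u \<ge> 0"
  by (simp add: fejer_def)

text \<open>Provides an interval on which the kernel has definite mass. Staying away from 0 avoids
  the exceptional value, and \<open>\<bar>u\<bar> \<le> 1\<close> allows the denominator to be
  dropped.\<close>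

lemma fejer_pos_bound: "\<exists>m>0. \<forall>u. 1/2 \<le> \<bar>u\<bar> \<and> \<bar>u\<bar> \<le> 1 \<longrightarrow> m \<le> fejer u"
proof (intro exI[of _ "2 * (1 - cos (1/2))"] conjI allI impI)
  have "cos (1/2) < cos (0::real)" by (rule cos_monotone_0_pi) (use pi_gt3 in auto)
  then show "0 < 2 * (1 - cos (1/2 :: real))" by simp
  fix u :: real assume u: "1/2 \<le> \<bar>u\<bar> \<and> \<bar>u\<bar> \<le> 1"
  have "cos \<bar>u\<bar> \<le> cos (1/2)" using u pi_gt3 by (intro cos_monotone_0_pi_le) auto
  then have "2 * (1 - cos (1/2)) \<le> 2 * (1 - cos u)" by simp
  also have "\<dots> \<le> 2 * (1 - cos u) / u\<^sup>2"
  proof -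
    have "u\<^sup>2 \<le> 1" using u by (simp add: abs_square_le_1)
    moreover have "u\<^sup>2 > 0" using u by auto
    ultimately show ?thesis by (simp add: le_divide_eq mult_left_le)
  qed
  finally show "2 * (1 - cos (1/2)) \<le> fejer u" using u by (auto simp: fejer_def)
qed

text \<open>Combines \<open>1 - cos u \<le> u\<twosuperior> / 2\<close> for small \<open>u\<close>
  with \<open>1 - cos u \<le> 2\<close> for large \<open>u\<close>. The constant 8 comes from the
  second range, where \<open>1 + u\<twosuperior> \<le> 2 u\<twosuperior>\<close>.\<close>

lemma fejer_le: "fejer u \<le> 8 * inverse (1 + u\<^sup>2)"
proof (cases "u = 0")
  case False
  have "1 - cos u = 2 * (sin (u/2))\<^sup>2" using cos_double_sin[of "u/2"] by simp
  moreover have "(sin (u/2))\<^sup>2 \<le> (u/2)\<^sup>2" using abs_sin_x_le_abs_x abs_le_square_iff by blast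
  ultimately have 1: "1 - cos u \<le> u\<^sup>2 / 2" by (simp add: power2_eq_square)
  have 2: "1 - cos u \<le> 2" using cos_ge_minus_one[of u] by linarith
  have "2 * (1 - cos u) * (1 + u\<^sup>2) \<le> 8 * u\<^sup>2"
  proof (cases "u\<^sup>2 \<le> 1")
    case True
    have "2 * (1 - cos u) * (1 + u\<^sup>2) \<le> u\<^sup>2 * 2" using True 1 by (intro mult_mono) auto
    then show ?thesis by (smt (verit) zero_le_power2)
  next
    case F: False
    have "(1 - cos u) * (1 + u\<^sup>2) \<le> 2 * (2 * u\<^sup>2)" using F by (intro mult_mono 2) auto
    then show ?thesis by (simp add: algebra_simps)
  qed
  then show ?thesis using False by (simp add: fejer_def field_simps add_pos_nonneg)
qed (simp add: fejer_def)

lemma fejer_measurable [measurable]: "fejer \<in> borel_measurable borel"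
  unfolding fejer_def[abs_def] by measurable

lemma integrable_fejer: "integrable lborel fejer"
proof (rule Bochner_Integration.integrable_bound)
  show "integrable lborel (\<lambda>u::real. 8 * inverse (1 + u\<^sup>2))"
    using integrable_inverse_1_plus_square by (simp add: set_integrable_def)
  show "AE u in lborel. norm (fejer u) \<le> norm (8 * inverse (1 + u\<^sup>2))"
    using fejer_le fejer_nonneg by (intro AE_I2) (simp add: add_pos_nonneg)
qed measurable

lemma integrable_fejer_affine: "\<mu> \<noteq> 0 \<Longrightarrow> integrable lborel (\<lambda>t. fejer (\<mu> * (T - t)))"
  using lborel_integrable_real_affine[OF integrable_fejer, of "-\<mu>" "\<mu> * T"] by (simp add: algebra_simps)

lemma tent_measurable [measurable]: "tent \<in> borel_measurable borel"
  unfolding tent_def[abs_def] by measurable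

lemma tent_nonneg: "tent v \<ge> 0" and tent_le: "tent v \<le> indicator {-1..1} v"
  by (auto simp: tent_def split: split_indicator)

lemma integrable_indicator_Icc: "integrable lborel (indicator {a..b::real} :: real \<Rightarrow> real)"
  by (rule integrable_real_indicator) (auto simp: emeasure_lborel_Icc_eq)

lemma integrable_tent: "integrable lborel tent"
proof (rule Bochner_Integration.integrable_bound[OF integrable_indicator_Icc])
  show "AE v in lborel. norm (tent v) \<le> norm (indicator {-1..1} v :: real)"
    using tent_nonneg tent_le by (intro AE_I2) simp
qed measurable

lemma fejer_eq_integral_tent:
  "of_real (fejer u) = (\<integral>v. of_real (tent v) * exp (\<i> * of_real (u * v)) \<partial>lborel)"
proof -
  have eq: "(\<integral>v. of_real (tent v) * exp (\<i> * of_real (u * v)) \<partial>lborel) = (F 0 - F (-1)) + (G 1 - G 0)"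
    if F: "\<And>v. (F has_vector_derivative (of_real (1 + v) * exp (\<i> * of_real (u * v)))) (at v)"
    and G: "\<And>v. (G has_vector_derivative (of_real (1 - v) * exp (\<i> * of_real (u * v)))) (at v)" for F G
  proof -
    let ?f = "\<lambda>v. indicator {-1..0::real} v *\<^sub>R (complex_of_real (1 + v) * exp (\<i> * of_real (u * v)))"
    let ?g = "\<lambda>v. indicator {0..1::real} v *\<^sub>R (complex_of_real (1 - v) * exp (\<i> * of_real (u * v)))"
    have f: "has_bochner_integral lborel ?f (F 0 - F (-1))"
      by (rule has_bochner_integral_FTC_Icc)
         (simp; fail | rule has_vector_derivative_at_within[OF F] | intro continuous_intros)+
    have g: "has_bochner_integral lborel ?g (G 1 - G 0)"
      by (rule has_bochner_integral_FTC_Icc)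
         (simp; fail | rule has_vector_derivative_at_within[OF G] | intro continuous_intros)+
    have fg: "has_bochner_integral lborel (\<lambda>v. ?f v + ?g v) ((F 0 - F (-1)) + (G 1 - G 0))"
      by (rule has_bochner_integral_add[OF f g])
    have "(\<integral>v. of_real (tent v) * exp (\<i> * of_real (u * v)) \<partial>lborel) = (\<integral>v. ?f v + ?g v \<partial>lborel)"
    proof (rule integral_cong_AE)
      show "AE v in lborel. of_real (tent v) * exp (\<i> * of_real (u * v)) = ?f v + ?g v"
        \<comment> \<open>Both half intervals contain 0, where the two integrands add up to twice
          the tent; hence equality only almost everywhere.\<close>
        using AE_lborel_singleton[of "0::real"]
        by eventually_elim (auto simp: tent_def split: split_indicator)
    qed measurable
    then show ?thesis using has_bochner_integral_integral_eq[OF fg] by simp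
  qed
  show ?thesis
  proof (cases "u = 0")
    case True
    have "(\<integral>v. of_real (tent v) * exp (\<i> * of_real (u * v)) \<partial>lborel) =
      (of_real (0 + 0\<^sup>2/2) - of_real (-1 + (-1)\<^sup>2/2)) + (of_real (1 - 1\<^sup>2/2) - of_real (0 - 0\<^sup>2/2))"
      by (rule eq; rule has_vector_derivative_of_real[THEN has_vector_derivative_eq_rhs])
         (auto simp: True intro!: derivative_eq_intros)
    then show ?thesis by (simp add: True fejer_def)
  next
    case False
    define w where "w = \<i> * complex_of_real u"
    have w: "w \<noteq> 0" "w\<^sup>2 = - of_real (u\<^sup>2)" using False by (auto simp: w_def power_mult_distrib)
    have e: "exp (\<i> * of_real (u * v)) = exp (w * of_real v)" for v by (simp add: w_def mult.assoc)
    define F where "F v = (1 + of_real v) * exp (w * of_real v) / w - exp (w * of_real v) / w\<^sup>2" for v :: real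
    define G where "G v = (1 - of_real v) * exp (w * of_real v) / w + exp (w * of_real v) / w\<^sup>2" for v :: real
    have "(\<integral>v. of_real (tent v) * exp (\<i> * of_real (u * v)) \<partial>lborel) = (F 0 - F (-1)) + (G 1 - G 0)"
    proof (rule eq)
      show "(F has_vector_derivative (of_real (1 + v) * exp (\<i> * of_real (u * v)))) (at v)" for v
        unfolding F_def e
        by (rule has_vector_derivative_real_field)
           (use w(1) in \<open>auto intro!: derivative_eq_intros simp: field_simps power2_eq_square\<close>)
      show "(G has_vector_derivative (of_real (1 - v) * exp (\<i> * of_real (u * v)))) (at v)" for v
        unfolding G_def e
        by (rule has_vector_derivative_real_field)
           (use w(1) in \<open>auto intro!: derivative_eq_intros simp: field_simps power2_eq_square\<close>)
    qed
    also have "\<dots> = (exp w + exp (-w) - 2) / w\<^sup>2"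
      by (simp add: F_def G_def diff_divide_distrib add_divide_distrib)
    also have "exp w + exp (-w) = 2 * of_real (cos u)"
      unfolding w_def by (simp add: exp_Euler flip: cos_of_real sin_of_real)
          (simp add: exp_Euler exp_minus_Euler)
    also have "(2 * of_real (cos u) - 2) / w\<^sup>2 = of_real (fejer u)"
      using False by (simp add: w(2) fejer_def) (simp add: field_simps)
    finally show ?thesis by simp
  qed
qed

text \<open>The damping \<open>exp (- x * t)\<close> gives integrability in \<open>t\<close> and the
  tent gives it in \<open>v\<close>, so the integrals may be exchanged. This turns a local average
  of \<open>q\<close> into values of its Laplace transform on a segment of the line with real part
  \<open>x\<close>.\<close>

lemma fejer_fubini:
  fixes q :: "real \<Rightarrow> real"
  assumes [measurable]: "q \<in> borel_measurable borel"
    and int: "integrable lborel (\<lambda>t. q t * exp (- x * t))"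
  shows "of_real (\<integral>t. q t * exp (- x * t) * fejer (\<mu> * (T - t)) \<partial>lborel) =
    (\<integral>v. of_real (tent v) * exp (\<i> * of_real (\<mu> * T * v)) *
      (\<integral>t. of_real (q t) * exp (- Complex x (\<mu> * v) * of_real t) \<partial>lborel) \<partial>lborel)"
proof -
  define f where "f t v = of_real (q t * exp (- x * t)) * (of_real (tent v) * exp (\<i> * of_real (\<mu> * (T - t) * v)))" for t v
  have nf: "norm (f t v) = \<bar>q t * exp (- x * t)\<bar> * tent v" for t v
    by (simp add: f_def norm_mult tent_nonneg abs_mult)
  have int_v: "integrable lborel (f t)" for t
  proof (rule Bochner_Integration.integrable_bound[OF integrable_mult_right[OF integrable_tent, of "\<bar>q t * exp (- x * t)\<bar>"]])
    show "f t \<in> borel_measurable lborel" unfolding f_def[abs_def] by measurable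
  qed (simp add: nf tent_nonneg)
  have int_tv: "integrable (lborel \<Otimes>\<^sub>M lborel) (\<lambda>(t, v). f t v)"
  proof (rule lborel_pair.Fubini_integrable)
    show "integrable lborel (\<lambda>t. \<integral>v. norm (case (t, v) of (t, v) \<Rightarrow> f t v) \<partial>lborel)"
      using integrable_mult_left[OF integrable_abs[OF int]] by (simp add: nf)
    show "AE t in lborel. integrable lborel (\<lambda>v. case (t, v) of (t, v) \<Rightarrow> f t v)"
      using int_v by simp
  qed (simp add: f_def[abs_def])
  have "of_real (\<integral>t. q t * exp (- x * t) * fejer (\<mu> * (T - t)) \<partial>lborel) =
      (\<integral>t. complex_of_real (q t * exp (- x * t)) * of_real (fejer (\<mu> * (T - t))) \<partial>lborel)"
    unfolding of_real_mult[symmetric] integral_complex_of_real ..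
  also have "\<dots> = (\<integral>t. (\<integral>v. f t v \<partial>lborel) \<partial>lborel)"
    unfolding fejer_eq_integral_tent f_def by (simp flip: integral_mult_right_zero)
  also have "\<dots> = (\<integral>v. (\<integral>t. f t v \<partial>lborel) \<partial>lborel)"
    using lborel_pair.Fubini_integral[OF int_tv] by simp
  also have "\<dots> = (\<integral>v. of_real (tent v) * exp (\<i> * of_real (\<mu> * T * v)) *
      (\<integral>t. of_real (q t) * exp (- Complex x (\<mu> * v) * of_real t) \<partial>lborel) \<partial>lborel)"
  proof (intro Bochner_Integration.integral_cong refl)
    fix v
    have "f t v = of_real (tent v) * exp (\<i> * of_real (\<mu> * T * v)) * (of_real (q t) * exp (- Complex x (\<mu> * v) * of_real t))" for t
    proof -
      have "complex_of_real (exp (- x * t)) * exp (\<i> * of_real (\<mu> * (T - t) * v)) =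
          exp (\<i> * of_real (\<mu> * T * v)) * exp (- Complex x (\<mu> * v) * of_real t)"
        unfolding exp_of_real[symmetric] exp_add[symmetric] Complex_eq
        by (rule arg_cong[of _ _ exp]) (simp add: algebra_simps)
      then show ?thesis unfolding f_def of_real_mult by (simp only: mult_ac)
    qed
    then show "(\<integral>t. f t v \<partial>lborel) = of_real (tent v) * exp (\<i> * of_real (\<mu> * T * v)) *
        (\<integral>t. of_real (q t) * exp (- Complex x (\<mu> * v) * of_real t) \<partial>lborel)"
      by (simp only: integral_mult_right_zero)
  qed
  finally show ?thesis .
qed

text \<open>Shifting by half a period \<open>\<pi> / S\<close> flips the sign of the integral, so that it is
  controlled by the modulus of continuity.\<close>

lemma riemann_lebesgue_compact_support:
  fixes \<phi> :: "real \<Rightarrow> complex"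
  assumes cont: "continuous_on UNIV \<phi>" and supp: "\<And>v. \<bar>v\<bar> > 1 \<Longrightarrow> \<phi> v = 0"
  shows "((\<lambda>S. \<integral>v. \<phi> v * exp (\<i> * of_real (S * v)) \<partial>lborel) \<longlongrightarrow> 0) at_top"
proof -
  have [measurable]: "\<phi> \<in> borel_measurable borel"
    using cont by (rule borel_measurable_continuous_onI)
  have "compact (\<phi> ` {-1..1})"
    by (intro compact_continuous_image continuous_on_subset[OF cont]) auto
  then obtain M where M: "\<And>v. v \<in> {-1..1} \<Longrightarrow> norm (\<phi> v) \<le> M"
    using compact_imp_bounded bounded_iff by (metis (no_types, lifting) imageI)
  have M0: "M \<ge> 0" using order_trans[OF norm_ge_zero M[of 0]] by simp
  have bnd: "norm (\<phi> v) \<le> M * indicator {-1..1} v" for v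
    using M[of v] supp[of v] by (cases "v \<in> {-1..1}") (auto simp: abs_if split: if_splits)
  have int1: "integrable lborel (\<lambda>v. M * indicator {-1..1::real} v)" by simp
  define I where "I S = (\<integral>v. \<phi> v * exp (\<i> * of_real (S * v)) \<partial>lborel)" for S
  define J where "J S = (\<integral>v. norm (\<phi> v - \<phi> (v + pi / S)) \<partial>lborel)" for S
  have int: "integrable lborel (\<lambda>v. \<phi> v * exp (\<i> * of_real (S * v)))" for S
    by (rule Bochner_Integration.integrable_bound[OF int1]) (use bnd in \<open>auto simp: norm_mult M0\<close>)
  have le: "norm (I S) \<le> J S / 2" if "S > 1" for S
  proof -
    have shift: "exp (\<i> * complex_of_real (S * (pi / S + 1 * v))) = - exp (\<i> * of_real (S * v))" for v
    proof -
      have "\<i> * complex_of_real (S * (pi / S + 1 * v)) = \<i> * of_real (S * v) + \<i> * of_real pi"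
        using that by (simp add: distrib_left)
      then show ?thesis by (simp add: exp_add)
    qed
    have "I S = (\<integral>v. \<phi> (pi / S + 1 * v) * exp (\<i> * of_real (S * (pi / S + 1 * v))) \<partial>lborel)"
      unfolding I_def by (subst lborel_integral_real_affine[of 1 _ "pi / S"]) auto
    also have "\<dots> = - (\<integral>v. \<phi> (pi / S + 1 * v) * exp (\<i> * of_real (S * v)) \<partial>lborel)"
      unfolding shift by simp
    finally have 1: "I S = - (\<integral>v. \<phi> (pi / S + 1 * v) * exp (\<i> * of_real (S * v)) \<partial>lborel)" .
    have int2: "integrable lborel (\<lambda>v. \<phi> (pi / S + 1 * v) * exp (\<i> * of_real (S * v)))"
      using lborel_integrable_real_affine[OF int[of S], of 1 "pi / S"] unfolding shift by simp
    have "2 * I S = (\<integral>v. \<phi> v * exp (\<i> * of_real (S * v)) \<partial>lborel) - (\<integral>v. \<phi> (pi / S + 1 * v) * exp (\<i> * of_real (S * v)) \<partial>lborel)"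
      using 1 by (simp add: I_def)
    also have "\<dots> = (\<integral>v. \<phi> v * exp (\<i> * of_real (S * v)) - \<phi> (pi / S + 1 * v) * exp (\<i> * of_real (S * v)) \<partial>lborel)"
      by (rule Bochner_Integration.integral_diff[OF int int2, symmetric])
    finally have "norm (2 * I S) \<le> (\<integral>v. norm (\<phi> v * exp (\<i> * of_real (S * v)) - \<phi> (pi / S + 1 * v) * exp (\<i> * of_real (S * v))) \<partial>lborel)"
      by (simp only: integral_norm_bound)
    also have "\<dots> = J S"
      unfolding J_def left_diff_distrib[symmetric] norm_mult by (simp add: add.commute)
    finally show ?thesis by (simp add: norm_mult)
  qed
  have "(J \<longlongrightarrow> (\<integral>v. (0::real) \<partial>(lborel :: real measure))) at_top"
    unfolding J_def
  \<comment> \<open>For \<open>S > 1\<close> the shift \<open>pi / S\<close> is at most 4, so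
    \<open>\<phi>\<close> and its translate both vanish outside \<open>{-5..5}\<close>.\<close>
  proof (rule integral_dominated_convergence_at_top[where w = "\<lambda>v. 2 * M * indicator {-5..5} v"])
    show "AE v in lborel. ((\<lambda>S. norm (\<phi> v - \<phi> (v + pi / S))) \<longlongrightarrow> 0) at_top"
    proof (rule AE_I2)
      fix v
      have "((\<lambda>S. v + pi / S) \<longlongrightarrow> v) at_top" by real_asymp
      then have "((\<lambda>S. \<phi> (v + pi / S)) \<longlongrightarrow> \<phi> v) at_top"
        using cont by (auto intro!: continuous_on_tendsto_compose[of UNIV \<phi>])
      then have "((\<lambda>S. norm (\<phi> v - \<phi> (v + pi / S))) \<longlongrightarrow> norm (\<phi> v - \<phi> v)) at_top"
        by (intro tendsto_intros)
      then show "((\<lambda>S. norm (\<phi> v - \<phi> (v + pi / S))) \<longlongrightarrow> 0) at_top" by simp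
    qed
    show "\<forall>\<^sub>F S in at_top. AE v in lborel. norm (norm (\<phi> v - \<phi> (v + pi / S))) \<le> 2 * M * indicator {-5..5} v"
      using eventually_gt_at_top[of "1::real"]
    proof (eventually_elim, intro AE_I2)
      fix S v :: real assume S: "S > 1"
      have "pi / S \<le> pi / 1" using S by (intro divide_left_mono) auto
      then have piS: "pi / S \<le> 4" "pi / S > 0" using pi_less_4 S by auto
      have "norm (\<phi> v - \<phi> (v + pi / S)) \<le> norm (\<phi> v) + norm (\<phi> (v + pi / S))" by (rule norm_triangle_ineq4)
      also have "\<dots> \<le> M * indicator {-1..1} v + M * indicator {-1..1} (v + pi / S)"
        by (intro add_mono bnd)
      also have "\<dots> \<le> 2 * M * indicator {-5..5} v"
        using piS M0 by (auto split: split_indicator)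
      finally show "norm (norm (\<phi> v - \<phi> (v + pi / S))) \<le> 2 * M * indicator {-5..5} v" by simp
    qed
  qed auto
  then have "((\<lambda>S. J S / 2) \<longlongrightarrow> 0) at_top" by (auto intro: tendsto_eq_intros)
  then have "(I \<longlongrightarrow> 0) at_top"
    by (rule Lim_null_comparison[rotated]) (use le in \<open>auto intro: eventually_mono[OF eventually_gt_at_top[of 1]]\<close>)
  then show ?thesis unfolding I_def .
qed

subsection \<open>A Tauberian theorem of Wiener--Ikehara type\<close>

text \<open>Here \<open>\<psi> t\<close> stands for a Chebyshev function at \<open>exp t\<close>,
  and \<open>z\<close> for \<open>s - 1\<close>. The term \<open>1 / z\<close> is the transform of
  the unit step, so \<open>g\<close> is the transform of \<open>\<psi> t * exp (- t)\<close> minus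
  that step. On the boundary only continuity of \<open>g\<close> is assumed.\<close>

locale laplace_tauberian =
  fixes \<psi> :: "real \<Rightarrow> real" and g :: "complex \<Rightarrow> complex"
  assumes mono: "mono \<psi>" and neg: "\<And>t. t < 0 \<Longrightarrow> \<psi> t = 0"
    and integrable: "\<And>x. x > 0 \<Longrightarrow> integrable lborel (\<lambda>t. \<psi> t * exp (- (1 + x) * t))"
    and laplace: "\<And>z. Re z > 0 \<Longrightarrow> (\<integral>t. of_real (\<psi> t) * exp (- (1 + z) * of_real t) \<partial>lborel) = 1 / z + g z"
    and cont: "continuous_on {z. Re z \<ge> 0} g"
begin

definition h :: "real \<Rightarrow> real" where "h t = \<psi> t * exp (- t)"

definition q :: "real \<Rightarrow> real" where "q t = h t - indicator {0..} t"

lemma \<psi>_measurable [measurable]: "\<psi> \<in> borel_measurable borel"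
  using mono by (rule borel_measurable_mono)

lemma h_measurable [measurable]: "h \<in> borel_measurable borel"
  unfolding h_def[abs_def] by measurable

lemma q_measurable [measurable]: "q \<in> borel_measurable borel"
  unfolding q_def[abs_def] by measurable

lemma \<psi>_nonneg: "\<psi> t \<ge> 0"
  using monoD[OF mono, of "min t (-1)" t] neg[of "min t (-1)"] by simp

lemma h_nonneg: "h t \<ge> 0"
  by (simp add: h_def \<psi>_nonneg)

text \<open>This is the Tauberian condition: monotonicity of \<open>\<psi>\<close> limits how fast
  \<open>h\<close> can fall, which is what allows pointwise values to be read off from
  averages.\<close>

lemma h_decay: "s \<le> t \<Longrightarrow> h s * exp (- (t - s)) \<le> h t"
proof -
  assume "s \<le> t"
  have "h s * exp (- (t - s)) = \<psi> s * exp (- t)" by (simp add: h_def mult.assoc flip: exp_add)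
  also have "\<dots> \<le> h t" unfolding h_def using monoD[OF mono \<open>s \<le> t\<close>] by (intro mult_right_mono) auto
  finally show ?thesis .
qed

lemma h_integrable: "x > 0 \<Longrightarrow> integrable lborel (\<lambda>t. h t * exp (- x * t))"
proof -
  assume x: "x > 0"
  have "h t * exp (- x * t) = \<psi> t * exp (- (1 + x) * t)" for t
    by (simp add: h_def mult.assoc algebra_simps flip: exp_add)
  then show ?thesis using integrable[OF x] by simp
qed

lemma step_integrable: "x > 0 \<Longrightarrow> integrable lborel (\<lambda>t. indicator {0..} t * exp (- x * t) :: real)"
proof -
  assume "x > 0"
  then have "integrable lborel (\<lambda>t. norm (indicator {0..} t * exp (- complex_of_real x * of_real t)))"
    by (intro integrable_norm laplace_exp_atLeast) simp
  moreover have "norm (indicator {0..} t * exp (- complex_of_real x * of_real t)) = indicator {0..} t * exp (- x * t)" for t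
    by (simp add: norm_mult split: split_indicator)
  ultimately show ?thesis by simp
qed

lemma q_integrable: "x > 0 \<Longrightarrow> integrable lborel (\<lambda>t. q t * exp (- x * t))"
  using Bochner_Integration.integrable_diff[OF h_integrable step_integrable, of x x]
  by (simp add: q_def left_diff_distrib)

lemma q_laplace:
  assumes z: "Re z > 0"
  shows "(\<integral>t. of_real (q t) * exp (- z * of_real t) \<partial>lborel) = g z"
proof -
  have e: "exp (- (1 + z) * complex_of_real t) = of_real (exp (- t)) * exp (- z * of_real t)" for t
    by (simp add: exp_of_real[symmetric] algebra_simps flip: exp_add)
  have 1: "of_real (q t) * exp (- z * of_real t) =
      of_real (\<psi> t) * exp (- (1 + z) * of_real t) - indicator {0..} t * exp (- z * of_real t)" for t
    unfolding q_def h_def e by (simp add: algebra_simps split: split_indicator)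
  have "integrable lborel (\<lambda>t. complex_of_real (\<psi> t) * exp (- (1 + z) * of_real t))"
    by (rule Bochner_Integration.integrable_bound[OF integrable[OF z]])
       (auto simp: norm_mult abs_mult)
  then show ?thesis
    unfolding 1 using laplace_exp_atLeast[OF z, of 0] laplace[OF z]
    by (subst Bochner_Integration.integral_diff) auto
qed

lemma fejer_average:
  assumes x: "x > 0"
  shows "of_real (\<integral>t. q t * exp (- x * t) * fejer (\<mu> * (T - t)) \<partial>lborel) =
    (\<integral>v. of_real (tent v) * exp (\<i> * of_real (\<mu> * T * v)) * g (Complex x (\<mu> * v)) \<partial>lborel)"
  unfolding fejer_fubini[OF q_measurable q_integrable[OF x]]
  using x by (subst q_laplace) auto

text \<open>The bound is uniform in \<open>x\<close> down to the boundary value 0, as the limit of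
  vanishing damping requires.\<close>

lemma g_bounded: "\<exists>M\<ge>0. \<forall>x v. 0 \<le> x \<and> x \<le> 1 \<and> \<bar>v\<bar> \<le> 1 \<longrightarrow> norm (g (Complex x (\<mu> * v))) \<le> M"
proof -
  let ?K = "(\<lambda>(x, v). Complex x (\<mu> * v)) ` ({0..1} \<times> {-1..1})"
  have "compact ?K"
    by (intro compact_continuous_image compact_Times) (auto simp: case_prod_beta Complex_eq intro!: continuous_intros)
  then have "compact (g ` ?K)"
    by (rule compact_continuous_image[rotated]) (auto intro: continuous_on_subset[OF cont])
  then obtain M where M: "\<And>y. y \<in> g ` ?K \<Longrightarrow> norm y \<le> M"
    using compact_imp_bounded bounded_iff by metis
  show ?thesis
  proof (intro exI[of _ "max 0 M"] conjI allI impI)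
    fix x v :: real assume "0 \<le> x \<and> x \<le> 1 \<and> \<bar>v\<bar> \<le> 1"
    then have "g (Complex x (\<mu> * v)) \<in> g ` ?K" by (intro imageI image_eqI[of _ _ "(x, v)"]) auto
    then show "norm (g (Complex x (\<mu> * v))) \<le> max 0 M" using M by fastforce
  qed auto
qed

lemma g_line_continuous: "x \<ge> 0 \<Longrightarrow> continuous_on UNIV (\<lambda>v. g (Complex x (\<mu> * v)))"
  by (rule continuous_on_compose2[OF cont]) (auto simp: Complex_eq intro!: continuous_intros)

lemma g_line_measurable: "x \<ge> 0 \<Longrightarrow> (\<lambda>v. g (Complex x (\<mu> * v))) \<in> borel_measurable borel"
  by (intro borel_measurable_continuous_onI g_line_continuous)

lemma tent_g_bound:
  assumes "\<And>x v. 0 \<le> x \<and> x \<le> 1 \<and> \<bar>v\<bar> \<le> 1 \<longrightarrow> norm (g (Complex x (\<mu> * v))) \<le> M" "M \<ge> 0" "0 \<le> x" "x \<le> 1"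
  shows "norm (of_real (tent v) * exp (\<i> * of_real (\<mu> * T * v)) * g (Complex x (\<mu> * v))) \<le> M * tent v"
proof (cases "\<bar>v\<bar> \<le> 1")
  case True
  then have "tent v * norm (g (Complex x (\<mu> * v))) \<le> tent v * M"
    using assms by (intro mult_left_mono) (auto simp: tent_nonneg)
  then show ?thesis by (simp add: norm_mult tent_nonneg mult.commute)
qed (simp add: tent_def)

lemma fejer_average_integrable:
  assumes "integrable lborel (\<lambda>t. f t * exp (- x * t))" "f \<in> borel_measurable borel"
  shows "integrable lborel (\<lambda>t. f t * exp (- x * t) * fejer (\<mu> * (T - t)))"
proof (rule Bochner_Integration.integrable_bound[OF integrable_mult_right[OF assms(1), of 8]])
  show "AE t in lborel. norm (f t * exp (- x * t) * fejer (\<mu> * (T - t))) \<le> norm (8 * (f t * exp (- x * t)))"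
  proof (rule AE_I2)
    fix t
    have "inverse (1 + (\<mu> * (T - t))\<^sup>2) \<le> inverse 1" by (rule le_imp_inverse_le) auto
    then have "\<bar>fejer (\<mu> * (T - t))\<bar> \<le> 8"
      using fejer_le[of "\<mu> * (T - t)"] fejer_nonneg[of "\<mu> * (T - t)"] by simp
    from mult_left_mono[OF this, of "\<bar>f t * exp (- x * t)\<bar>"]
    show "norm (f t * exp (- x * t) * fejer (\<mu> * (T - t))) \<le> norm (8 * (f t * exp (- x * t)))"
      by (simp add: abs_mult mult_ac)
  qed
qed (use assms(2) in measurable)

text \<open>Boundedness of \<open>h\<close>, a Chebyshev type bound, already follows from the average with
  \<open>\<mu> = 1\<close>: since \<open>h\<close> cannot decrease quickly, a large value would spoil the average.\<close>

lemma h_bounded: "\<exists>B\<ge>0. \<forall>t. h t \<le> B"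
proof -
  obtain M where M: "M \<ge> 0" "\<And>x v. 0 \<le> x \<and> x \<le> 1 \<and> \<bar>v\<bar> \<le> 1 \<longrightarrow> norm (g (Complex x (1 * v))) \<le> M"
    using g_bounded[of 1] by blast
  obtain m where m: "m > 0" "\<And>u. 1/2 \<le> \<bar>u\<bar> \<and> \<bar>u\<bar> \<le> 1 \<Longrightarrow> m \<le> fejer u"
    using fejer_pos_bound by blast
  define B where "B = M * (\<integral>v. tent v \<partial>lborel) + (\<integral>u. fejer u \<partial>lborel)"
  have B0: "B \<ge> 0" unfolding B_def using M by (intro add_nonneg_nonneg mult_nonneg_nonneg integral_nonneg) (auto simp: tent_nonneg fejer_nonneg)
  \<comment> \<open>The average of \<open>h\<close> splits into that of \<open>q\<close>, controlled
    by \<open>g\<close> under the tent, and that of the step, at most the full kernel mass. The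
    bound depends on neither \<open>x\<close> nor \<open>T\<close>.\<close>
  have up: "(\<integral>t. h t * exp (- x * t) * fejer (1 * (T - t)) \<partial>lborel) \<le> B" if x: "0 < x" "x \<le> 1" for x T
  proof -
    have sum: "(\<integral>t. h t * exp (- x * t) * fejer (1 * (T - t)) \<partial>lborel) =
       (\<integral>t. q t * exp (- x * t) * fejer (1 * (T - t)) \<partial>lborel) + (\<integral>t. indicator {0..} t * exp (- x * t) * fejer (1 * (T - t)) \<partial>lborel)"
      using Bochner_Integration.integral_add[OF fejer_average_integrable[OF q_integrable[OF x(1)] q_measurable, of 1 T]
          fejer_average_integrable[OF step_integrable[OF x(1)], of 1 T]]
      by (simp add: q_def left_diff_distrib)
    have "(\<integral>t. q t * exp (- x * t) * fejer (1 * (T - t)) \<partial>lborel) \<le>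
        norm (complex_of_real (\<integral>t. q t * exp (- x * t) * fejer (1 * (T - t)) \<partial>lborel))" by simp
    also have "\<dots> \<le> (\<integral>v. norm (of_real (tent v) * exp (\<i> * of_real (1 * T * v)) * g (Complex x (1 * v))) \<partial>lborel)"
      unfolding fejer_average[OF x(1)] by (rule integral_norm_bound)
    also have "\<dots> \<le> (\<integral>v. M * tent v \<partial>lborel)"
    proof (rule integral_mono)
      show "integrable lborel (\<lambda>v. norm (of_real (tent v) * exp (\<i> * of_real (1 * T * v)) * g (Complex x (1 * v))))"
        by (rule Bochner_Integration.integrable_bound[OF integrable_mult_right[OF integrable_tent, of M]])
           (use tent_g_bound[OF M(2) M(1), of x] x g_line_measurable[of x 1] in \<open>auto simp: tent_nonneg M(1)\<close>)
    qed (use integrable_tent tent_g_bound[OF M(2) M(1), of x] x in auto)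
    finally have 1: "(\<integral>t. q t * exp (- x * t) * fejer (1 * (T - t)) \<partial>lborel) \<le> M * (\<integral>v. tent v \<partial>lborel)" by simp
    have "(\<integral>t. indicator {0..} t * exp (- x * t) * fejer (1 * (T - t)) \<partial>lborel) \<le> (\<integral>t. fejer (1 * (T - t)) \<partial>lborel)"
    proof (rule integral_mono)
      show "indicator {0..} t * exp (- x * t) * fejer (1 * (T - t)) \<le> fejer (1 * (T - t))" for t
        using fejer_nonneg[of "1 * (T - t)"] x by (auto split: split_indicator intro!: mult_left_le_one_le)
    qed (use fejer_average_integrable[OF step_integrable[OF x(1)], of 1 T] integrable_fejer_affine[of 1 T] in auto)
    also have "(\<integral>t. fejer (1 * (T - t)) \<partial>lborel) = (\<integral>u. fejer u \<partial>lborel)"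
      using lborel_integral_real_affine[of "-1" fejer T] by simp
    finally show ?thesis using 1 sum unfolding B_def by simp
  qed
  have "h T \<le> 2 * exp 1 * B / m" if T: "T \<ge> 0" for T
  proof -
    \<comment> \<open>On \<open>{T + 1/2..T + 1}\<close> the function \<open>h\<close> is still at
      least \<open>h T * exp (-1)\<close>, while \<open>T - t\<close> stays in the range where the
      kernel is at least \<open>m\<close>. The factor 1/2 is the length of this window.\<close>
    have low: "h T * exp (-1) * m * exp (- x * (T + 1)) / 2 \<le> B" if x: "0 < x" "x \<le> 1" for x
    proof -
      have "h T * exp (-1) * m * exp (- x * (T + 1)) / 2 =
          (\<integral>t. indicator {T + 1/2..T + 1} t *\<^sub>R (h T * exp (-1) * m * exp (- x * (T + 1))) \<partial>lborel)"
        by simp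
      also have "\<dots> \<le> (\<integral>t. h t * exp (- x * t) * fejer (1 * (T - t)) \<partial>lborel)"
      proof (rule integral_mono)
        show "integrable lborel (\<lambda>t. h t * exp (- x * t) * fejer (1 * (T - t)))"
          by (intro fejer_average_integrable h_integrable x) auto
        fix t
        show "indicator {T + 1/2..T + 1} t *\<^sub>R (h T * exp (-1) * m * exp (- x * (T + 1))) \<le> h t * exp (- x * t) * fejer (1 * (T - t))"
        proof (cases "t \<in> {T + 1/2..T + 1}")
          case True
          have "h T * exp (-1) \<le> h T * exp (- (t - T))" using True by (intro mult_left_mono h_nonneg) auto
          also have "\<dots> \<le> h t" using True by (intro h_decay) auto
          finally have 1: "h T * exp (-1) \<le> h t" .
          have 2: "exp (- x * (T + 1)) \<le> exp (- x * t)" using True x by (auto simp: mult_left_mono)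
          have 3: "m \<le> fejer (1 * (T - t))" using True by (intro m(2)) auto
          have "h T * exp (-1) * exp (- x * (T + 1)) * m \<le> h t * exp (- x * t) * fejer (1 * (T - t))"
            using m(1) by (intro mult_mono 1 2 3) (auto simp: h_nonneg fejer_nonneg)
          then show ?thesis using True by (simp add: mult_ac)
        qed (simp add: h_nonneg fejer_nonneg)
      qed (simp add: integrable_indicator_Icc)
      also have "\<dots> \<le> B" by (rule up[OF x])
      finally show ?thesis .
    qed
    have "((\<lambda>x. h T * exp (-1) * m * exp (- x * (T + 1)) / 2) \<longlongrightarrow> h T * exp (-1) * m * exp (- 0 * (T + 1)) / 2) (at_right 0)"
      by (intro tendsto_intros) auto
    moreover have "\<forall>\<^sub>F x in at_right 0. h T * exp (-1) * m * exp (- x * (T + 1)) / 2 \<le> B"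
    proof (rule eventually_mono[OF eventually_at_right_real[of 0 1]])
      show "h T * exp (-1) * m * exp (- x * (T + 1)) / 2 \<le> B" if "x \<in> {0<..<1}" for x
        using low[of x] that by simp
    qed simp
    ultimately have "h T * exp (-1) * m * exp (- 0 * (T + 1)) / 2 \<le> B"
      by (intro tendsto_upperbound) auto
    then show ?thesis using m(1) by (simp add: field_simps exp_minus)
  qed
  moreover have "h T \<le> 2 * exp 1 * B / m" if "T < 0" for T
    using neg[OF that] B0 m(1) by (simp add: h_def)
  ultimately show ?thesis using B0 m(1) by (intro exI[of _ "2 * exp 1 * B / m"]) (auto simp: not_less, meson not_less)
qed

lemma q_bounded: "\<exists>B\<ge>0. \<forall>t. \<bar>q t\<bar> \<le> B"
proof -
  obtain B where "B \<ge> 0" "\<And>t. h t \<le> B" using h_bounded by blast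
  moreover have "\<bar>q t\<bar> \<le> B + 1" for t
    using h_nonneg[of t] calculation(2)[of t] by (auto simp: q_def split: split_indicator)
  ultimately show ?thesis by (intro exI[of _ "B + 1"]) auto
qed

lemma q_neg: "t < 0 \<Longrightarrow> q t = 0"
  by (simp add: q_def h_def neg)

text \<open>The limit \<open>x \<rightarrow> 0\<close> of the damped identity. Dominating the left
  side by a multiple of the kernel relies on boundedness of \<open>q\<close>, which therefore had to
  be obtained from the damped averages.\<close>

lemma fejer_average_boundary:
  assumes \<mu>: "\<mu> > 0"
  shows "of_real (\<integral>t. q t * fejer (\<mu> * (T - t)) \<partial>lborel) =
    (\<integral>v. of_real (tent v) * exp (\<i> * of_real (\<mu> * T * v)) * g (Complex 0 (\<mu> * v)) \<partial>lborel)"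
proof -
  obtain B where B: "B \<ge> 0" "\<And>t. \<bar>q t\<bar> \<le> B" using q_bounded by blast
  obtain M where M: "M \<ge> 0" "\<And>x v. 0 \<le> x \<and> x \<le> 1 \<and> \<bar>v\<bar> \<le> 1 \<longrightarrow> norm (g (Complex x (\<mu> * v))) \<le> M"
    using g_bounded[of \<mu>] by blast
  define X :: "nat \<Rightarrow> real" where "X n = inverse (real (Suc n))" for n
  have X: "X n > 0" "X n \<le> 1" "X n \<ge> 0" for n by (auto simp: X_def inverse_le_1_iff)
  have X0: "X \<longlonglongrightarrow> 0" unfolding X_def by (rule LIMSEQ_inverse_real_of_nat)
  have "(\<lambda>n. \<integral>t. q t * exp (- X n * t) * fejer (\<mu> * (T - t)) \<partial>lborel) \<longlonglongrightarrow> (\<integral>t. q t * fejer (\<mu> * (T - t)) \<partial>lborel)"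
  proof (rule integral_dominated_convergence[where w = "\<lambda>t. B * fejer (\<mu> * (T - t))"])
    show "integrable lborel (\<lambda>t. B * fejer (\<mu> * (T - t)))"
      using \<mu> by (intro integrable_mult_right integrable_fejer_affine) auto
    show "AE t in lborel. (\<lambda>n. q t * exp (- X n * t) * fejer (\<mu> * (T - t))) \<longlonglongrightarrow> q t * fejer (\<mu> * (T - t))"
    proof (rule AE_I2)
      fix t
      have "(\<lambda>n. q t * exp (- X n * t) * fejer (\<mu> * (T - t))) \<longlonglongrightarrow> q t * exp (- 0 * t) * fejer (\<mu> * (T - t))"
        by (intro tendsto_intros X0)
      then show "(\<lambda>n. q t * exp (- X n * t) * fejer (\<mu> * (T - t))) \<longlonglongrightarrow> q t * fejer (\<mu> * (T - t))" by simp
    qed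
    show "AE t in lborel. norm (q t * exp (- X n * t) * fejer (\<mu> * (T - t))) \<le> B * fejer (\<mu> * (T - t))" for n
    proof (rule AE_I2)
      fix t
      have "\<bar>q t\<bar> * exp (- X n * t) \<le> B"
      proof (cases "t < 0")
        case False
        then have "\<bar>q t\<bar> * exp (- X n * t) \<le> \<bar>q t\<bar> * 1" using X(3)[of n] by (intro mult_left_mono) auto
        then show ?thesis using B(2)[of t] by linarith
      qed (use q_neg B in simp)
      then show "norm (q t * exp (- X n * t) * fejer (\<mu> * (T - t))) \<le> B * fejer (\<mu> * (T - t))"
        using mult_right_mono[OF _ fejer_nonneg] by (simp add: abs_mult fejer_nonneg)
    qed
  qed auto
  then have "(\<lambda>n. complex_of_real (\<integral>t. q t * exp (- X n * t) * fejer (\<mu> * (T - t)) \<partial>lborel)) \<longlonglongrightarrow> of_real (\<integral>t. q t * fejer (\<mu> * (T - t)) \<partial>lborel)"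
    by (rule tendsto_of_real)
  moreover have "(\<lambda>n. \<integral>v. of_real (tent v) * exp (\<i> * of_real (\<mu> * T * v)) * g (Complex (X n) (\<mu> * v)) \<partial>lborel) \<longlonglongrightarrow>
      (\<integral>v. of_real (tent v) * exp (\<i> * of_real (\<mu> * T * v)) * g (Complex 0 (\<mu> * v)) \<partial>lborel)"
  proof (rule integral_dominated_convergence[where w = "\<lambda>v. M * tent v"])
    show "integrable lborel (\<lambda>v. M * tent v)" using integrable_tent by simp
    show "AE v in lborel. (\<lambda>n. of_real (tent v) * exp (\<i> * of_real (\<mu> * T * v)) * g (Complex (X n) (\<mu> * v))) \<longlonglongrightarrow>
        of_real (tent v) * exp (\<i> * of_real (\<mu> * T * v)) * g (Complex 0 (\<mu> * v))"
      by (intro AE_I2 tendsto_intros continuous_on_tendsto_compose[OF cont] X0 tendsto_Complex) (auto simp: X)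
    show "AE v in lborel. norm (of_real (tent v) * exp (\<i> * of_real (\<mu> * T * v)) * g (Complex (X n) (\<mu> * v))) \<le> M * tent v" for n
      by (intro AE_I2 tent_g_bound[OF M(2) M(1)] X)
    show "(\<lambda>v. complex_of_real (tent v) * exp (\<i> * of_real (\<mu> * T * v)) * g (Complex (X n) (\<mu> * v))) \<in> borel_measurable lborel" for n
      using g_line_measurable[OF X(3)[of n], of \<mu>] by measurable
    show "(\<lambda>v. complex_of_real (tent v) * exp (\<i> * of_real (\<mu> * T * v)) * g (Complex 0 (\<mu> * v))) \<in> borel_measurable lborel"
      using g_line_measurable[of 0 \<mu>] by measurable
  qed
  ultimately show ?thesis
    unfolding fejer_average[OF X(1)] by (rule LIMSEQ_unique)
qed

text \<open>On the boundary line the average of \<open>q\<close> is a Fourier integral, at frequency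
  \<open>\<mu> * T\<close>, of a continuous function with compact support, so it tends to 0 by
  Riemann-Lebesgue. The step accounts for the whole limit.\<close>

lemma average_tendsto:
  assumes \<mu>: "\<mu> > 0"
  shows "((\<lambda>T. \<integral>u. h (T - u / \<mu>) * fejer u \<partial>lborel) \<longlongrightarrow> (\<integral>u. fejer u \<partial>lborel)) at_top"
proof -
  define \<phi> where "\<phi> v = complex_of_real (tent v) * g (Complex 0 (\<mu> * v))" for v
  have "continuous_on UNIV tent" unfolding tent_def[abs_def] by (intro continuous_intros)
  then have "continuous_on UNIV \<phi>" unfolding \<phi>_def
    by (intro continuous_intros g_line_continuous) auto
  then have "((\<lambda>S. \<integral>v. \<phi> v * exp (\<i> * of_real (S * v)) \<partial>lborel) \<longlongrightarrow> 0) at_top"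
    by (rule riemann_lebesgue_compact_support) (auto simp: \<phi>_def tent_def)
  moreover have "filterlim (\<lambda>T. \<mu> * T) at_top at_top" using \<mu> by real_asymp
  ultimately have "((\<lambda>T. \<integral>v. \<phi> v * exp (\<i> * of_real (\<mu> * T * v)) \<partial>lborel) \<longlongrightarrow> 0) at_top"
    by (rule filterlim_compose)
  moreover have "(\<integral>v. \<phi> v * exp (\<i> * of_real (\<mu> * T * v)) \<partial>lborel) = of_real (\<integral>t. q t * fejer (\<mu> * (T - t)) \<partial>lborel)" for T
    unfolding fejer_average_boundary[OF \<mu>] \<phi>_def by (simp only: mult_ac)
  ultimately have "((\<lambda>T. complex_of_real (\<integral>t. q t * fejer (\<mu> * (T - t)) \<partial>lborel)) \<longlongrightarrow> of_real 0) at_top"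
    by simp
  then have "((\<lambda>T. \<integral>t. q t * fejer (\<mu> * (T - t)) \<partial>lborel) \<longlongrightarrow> 0) at_top"
    by (simp only: tendsto_of_real_iff)
  moreover have "(\<integral>t. q t * fejer (\<mu> * (T - t)) \<partial>lborel) = (\<integral>u. q (T - u / \<mu>) * fejer u \<partial>lborel) / \<mu>" for T
    using lborel_integral_real_affine[of "-1/\<mu>" "\<lambda>t. q t * fejer (\<mu> * (T - t))" T] \<mu> by simp
  ultimately have "((\<lambda>T. \<mu> * ((\<integral>u. q (T - u / \<mu>) * fejer u \<partial>lborel) / \<mu>)) \<longlongrightarrow> \<mu> * 0) at_top"
    by (intro tendsto_mult tendsto_const) simp
  then have 1: "((\<lambda>T. \<integral>u. q (T - u / \<mu>) * fejer u \<partial>lborel) \<longlongrightarrow> 0) at_top"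
    using \<mu> by simp
  have 2: "((\<lambda>T. \<integral>u. indicator {0..} (T - u / \<mu>) * fejer u \<partial>lborel) \<longlongrightarrow> (\<integral>u. fejer u \<partial>lborel)) at_top"
  proof (rule integral_dominated_convergence_at_top[where w = fejer])
    show "AE u in lborel. ((\<lambda>T. indicator {0..} (T - u / \<mu>) * fejer u) \<longlongrightarrow> fejer u) at_top"
    proof (rule AE_I2, rule Lim_transform_eventually[OF tendsto_const])
      fix u
      show "\<forall>\<^sub>F T in at_top. fejer u = indicator {0..} (T - u / \<mu>) * fejer u"
        using eventually_ge_at_top[of "u / \<mu>"] by eventually_elim simp
    qed
    show "\<forall>\<^sub>F T in at_top. AE u in lborel. norm (indicator {0..} (T - u / \<mu>) * fejer u) \<le> fejer u"
      by (intro always_eventually allI AE_I2) (auto simp: fejer_nonneg split: split_indicator)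
  qed (use integrable_fejer in auto)
  obtain B where B: "B \<ge> 0" "\<And>t. \<bar>q t\<bar> \<le> B" using q_bounded by blast
  have "(\<integral>u. h (T - u / \<mu>) * fejer u \<partial>lborel) = (\<integral>u. q (T - u / \<mu>) * fejer u \<partial>lborel) + (\<integral>u. indicator {0..} (T - u / \<mu>) * fejer u \<partial>lborel)" for T
  proof -
    have a: "integrable lborel (\<lambda>u. q (T - u / \<mu>) * fejer u)"
      by (rule Bochner_Integration.integrable_bound[OF integrable_mult_right[OF integrable_fejer, of B]])
         (use B in \<open>auto simp: abs_mult fejer_nonneg intro!: mult_right_mono\<close>)
    have b: "integrable lborel (\<lambda>u. indicator {0..} (T - u / \<mu>) * fejer u)"
      by (rule Bochner_Integration.integrable_bound[OF integrable_fejer])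
         (auto simp: fejer_nonneg split: split_indicator)
    show ?thesis using Bochner_Integration.integral_add[OF a b] by (simp add: q_def left_diff_distrib)
  qed
  then show ?thesis using tendsto_add[OF 1 2] by simp
qed

lemma integrable_h_fejer: "integrable lborel (\<lambda>u. h (T - u / \<mu>) * fejer u)"
proof -
  obtain B where "B \<ge> 0" "\<And>t. h t \<le> B" using h_bounded by blast
  then show ?thesis
    by (intro Bochner_Integration.integrable_bound[OF integrable_mult_right[OF integrable_fejer, of B]])
       (auto simp: abs_mult fejer_nonneg h_nonneg intro!: mult_right_mono)
qed

text \<open>Most of the kernel mass lies in \<open>\<bar>u\<bar> \<le> \<mu> * \<delta>\<close>,
  that is, in a window of length \<open>2 * \<delta>\<close> for the argument of \<open>h\<close>.
  Centring it at \<open>T + \<delta>\<close> or \<open>T - \<delta>\<close> puts it entirely on one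
  side of \<open>T\<close>, where \<open>h\<close> compares with \<open>h T\<close> up to the factor
  \<open>exp (2 * \<delta>)\<close>. Outside the window, \<open>upper\<close> uses nonnegativity and
  \<open>lower\<close> the bound \<open>B\<close>. First \<open>\<delta>\<close> is fixed, then
  \<open>\<mu>\<close>, and \<open>T\<close> goes to infinity last.\<close>

theorem h_tendsto_1: "(h \<longlongrightarrow> 1) at_top"
proof -
  define c where "c = (\<integral>u. fejer u \<partial>lborel)"
  define tail where "tail R = (\<integral>u. indicator {u. \<bar>u\<bar> > R} u * fejer u \<partial>lborel)" for R :: real
  have [measurable]: "{u::real. \<bar>u\<bar> > R} \<in> sets borel" for R by measurable
  have int_ind: "integrable lborel (\<lambda>u. indicator A u * fejer u)" if "A \<in> sets borel" for A :: "real set"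
    by (rule Bochner_Integration.integrable_bound[OF integrable_fejer])
       (use that in \<open>auto simp: fejer_nonneg split: split_indicator\<close>)
  have tail0: "(tail \<longlongrightarrow> (\<integral>u. 0 \<partial>(lborel :: real measure))) at_top"
    unfolding tail_def
  proof (rule integral_dominated_convergence_at_top[where w = fejer])
    show "AE u in lborel. ((\<lambda>R. indicator {u. \<bar>u\<bar> > R} u * fejer u) \<longlongrightarrow> 0) at_top"
    proof (rule AE_I2, rule Lim_transform_eventually[OF tendsto_const])
      fix u :: real
      show "\<forall>\<^sub>F R in at_top. 0 = indicator {u. \<bar>u\<bar> > R} u * fejer u"
        using eventually_ge_at_top[of "\<bar>u\<bar>"] by eventually_elim simp
    qed
    show "\<forall>\<^sub>F R in at_top. AE u in lborel. norm (indicator {u. \<bar>u\<bar> > R} u * fejer u) \<le> fejer u"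
      by (intro always_eventually allI AE_I2) (auto simp: fejer_nonneg split: split_indicator)
  qed (use integrable_fejer in auto)
  have c_pos: "c > 0"
  proof -
    obtain m where m: "m > 0" "\<And>u. 1/2 \<le> \<bar>u\<bar> \<and> \<bar>u\<bar> \<le> 1 \<Longrightarrow> m \<le> fejer u"
      using fejer_pos_bound by blast
    have "m / 2 = (\<integral>u. indicator {1/2..1::real} u *\<^sub>R m \<partial>lborel)" by simp
    also have "\<dots> \<le> c" unfolding c_def
      by (rule integral_mono) (use m integrable_fejer in \<open>auto simp: fejer_nonneg integrable_indicator_Icc split: split_indicator\<close>)
    finally show ?thesis using m(1) by simp
  qed
  obtain B where B: "B \<ge> 0" "\<And>t. h t \<le> B" using h_bounded by blast
  have split: "c = (\<integral>u. indicator {u. \<bar>u\<bar> \<le> R} u * fejer u \<partial>lborel) + tail R" for R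
    unfolding c_def tail_def
    by (subst Bochner_Integration.integral_add[symmetric])
       (auto intro!: int_ind Bochner_Integration.integral_cong split: split_indicator)
  have upper: "h T * exp (- (2 * \<delta>)) * (c - tail (\<mu> * \<delta>)) \<le> (\<integral>u. h (T + \<delta> - u / \<mu>) * fejer u \<partial>lborel)"
    if "\<mu> > 0" for T \<delta> \<mu>
  proof -
    have "h T * exp (- (2 * \<delta>)) * (c - tail (\<mu> * \<delta>)) =
        (\<integral>u. (h T * exp (- (2 * \<delta>))) * (indicator {u. \<bar>u\<bar> \<le> \<mu> * \<delta>} u * fejer u) \<partial>lborel)"
      using split[of "\<mu> * \<delta>"] by simp
    also have "\<dots> \<le> (\<integral>u. h (T + \<delta> - u / \<mu>) * fejer u \<partial>lborel)"
    proof (rule integral_mono[OF integrable_mult_right[OF int_ind] integrable_h_fejer])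
      fix u
      show "(h T * exp (- (2 * \<delta>))) * (indicator {u. \<bar>u\<bar> \<le> \<mu> * \<delta>} u * fejer u) \<le> h (T + \<delta> - u / \<mu>) * fejer u"
      proof (cases "\<bar>u\<bar> \<le> \<mu> * \<delta>")
        case True
        then have u: "u / \<mu> \<le> \<delta>" "- \<delta> \<le> u / \<mu>" using that by (auto simp: field_simps)
        have "h T * exp (- (2 * \<delta>)) \<le> h T * exp (- ((T + \<delta> - u / \<mu>) - T))"
          using u by (intro mult_left_mono h_nonneg) auto
        also have "\<dots> \<le> h (T + \<delta> - u / \<mu>)" using u by (intro h_decay) auto
        finally show ?thesis using True by (simp add: mult_right_mono fejer_nonneg)
      qed (simp add: h_nonneg fejer_nonneg)
    qed measurable
    finally show ?thesis .
  qed
  have lower: "(\<integral>u. h (T - \<delta> - u / \<mu>) * fejer u \<partial>lborel) \<le> h T * exp (2 * \<delta>) * c + B * tail (\<mu> * \<delta>)"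
    if "\<mu> > 0" for T \<delta> \<mu>
  proof -
    have "(\<integral>u. h (T - \<delta> - u / \<mu>) * fejer u \<partial>lborel) \<le>
       (\<integral>u. (h T * exp (2 * \<delta>)) * fejer u + B * (indicator {u. \<bar>u\<bar> > \<mu> * \<delta>} u * fejer u) \<partial>lborel)"
    proof (rule integral_mono[OF integrable_h_fejer])
      show "integrable lborel (\<lambda>u. (h T * exp (2 * \<delta>)) * fejer u + B * (indicator {u. \<bar>u\<bar> > \<mu> * \<delta>} u * fejer u))"
        by (intro Bochner_Integration.integrable_add integrable_mult_right integrable_fejer int_ind) measurable
      fix u
      show "h (T - \<delta> - u / \<mu>) * fejer u \<le> (h T * exp (2 * \<delta>)) * fejer u + B * (indicator {u. \<bar>u\<bar> > \<mu> * \<delta>} u * fejer u)"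
      proof (cases "\<bar>u\<bar> > \<mu> * \<delta>")
        case True
        have "h (T - \<delta> - u / \<mu>) * fejer u \<le> B * fejer u" by (intro mult_right_mono B fejer_nonneg)
        moreover have "0 \<le> (h T * exp (2 * \<delta>)) * fejer u" by (simp add: h_nonneg fejer_nonneg)
        ultimately show ?thesis using True by simp
      next
        case False
        then have u: "u / \<mu> \<le> \<delta>" "- \<delta> \<le> u / \<mu>" using that by (auto simp: field_simps)
        have "h (T - \<delta> - u / \<mu>) * exp (- (2 * \<delta>)) \<le> h (T - \<delta> - u / \<mu>) * exp (- (T - (T - \<delta> - u / \<mu>)))"
          using u by (intro mult_left_mono h_nonneg) auto
        also have "\<dots> \<le> h T" using u by (intro h_decay) auto
        finally have "h (T - \<delta> - u / \<mu>) \<le> h T * exp (2 * \<delta>)"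
          by (simp add: exp_minus field_simps)
        then show ?thesis using False by (simp add: mult_right_mono fejer_nonneg)
      qed
    qed
    also have "\<dots> = h T * exp (2 * \<delta>) * c + B * tail (\<mu> * \<delta>)"
      unfolding c_def tail_def
      by (subst Bochner_Integration.integral_add) (auto intro!: integrable_mult_right integrable_fejer int_ind)
    finally show ?thesis .
  qed
  have tail_limit: "((\<lambda>\<mu>. tail (\<mu> * \<delta>)) \<longlongrightarrow> 0) at_top" if "\<delta> > 0" for \<delta>
  proof -
    have "filterlim (\<lambda>\<mu>. \<mu> * \<delta>) at_top at_top" using that by real_asymp
    from filterlim_compose[OF tail0 this] show ?thesis by simp
  qed
  show ?thesis
  proof (rule order_tendstoI)
    fix a :: real assume a: "a > 1"
    have "((\<lambda>\<delta>. a * exp (- (2 * \<delta>))) \<longlongrightarrow> a * exp (- (2 * 0))) (at_right 0)"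
      by (intro tendsto_intros)
    then have "\<forall>\<^sub>F \<delta> in at_right 0. 1 < a * exp (- (2 * \<delta>))"
      using a by (intro order_tendstoD) auto
    then have "\<forall>\<^sub>F \<delta> in at_right (0::real). 1 < a * exp (- (2 * \<delta>)) \<and> \<delta> > 0"
      using eventually_at_right_less by (rule eventually_conj)
    then obtain \<delta> where \<delta>: "1 < a * exp (- (2 * \<delta>))" "\<delta> > 0"
      using eventually_happens'[OF trivial_limit_at_right_real] by blast
    have "((\<lambda>\<mu>. a * exp (- (2 * \<delta>)) * (c - tail (\<mu> * \<delta>))) \<longlongrightarrow> a * exp (- (2 * \<delta>)) * (c - 0)) at_top"
      by (intro tendsto_intros tail_limit \<delta>)
    moreover have "c < a * exp (- (2 * \<delta>)) * (c - 0)" using \<delta> c_pos by simp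
    ultimately have "\<forall>\<^sub>F \<mu> in at_top. c < a * exp (- (2 * \<delta>)) * (c - tail (\<mu> * \<delta>))"
      by (rule order_tendstoD)
    then have "\<forall>\<^sub>F \<mu> in at_top. c < a * exp (- (2 * \<delta>)) * (c - tail (\<mu> * \<delta>)) \<and> \<mu> > 0"
      using eventually_gt_at_top by (rule eventually_conj)
    then obtain \<mu> where \<mu>: "c < a * exp (- (2 * \<delta>)) * (c - tail (\<mu> * \<delta>))" "\<mu> > 0"
      using eventually_happens'[OF trivial_limit_at_top_linorder] by blast
    have "filterlim (\<lambda>T. T + \<delta>) at_top at_top" by real_asymp
    from filterlim_compose[OF average_tendsto[OF \<mu>(2)] this]
    have "\<forall>\<^sub>F T in at_top. (\<integral>u. h (T + \<delta> - u / \<mu>) * fejer u \<partial>lborel) < a * exp (- (2 * \<delta>)) * (c - tail (\<mu> * \<delta>))"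
      using \<mu>(1) unfolding c_def[symmetric] by (rule order_tendstoD)
    then show "\<forall>\<^sub>F T in at_top. h T < a"
    proof eventually_elim
      case (elim T)
      have pos: "c - tail (\<mu> * \<delta>) > 0" using \<mu>(1) c_pos a by (smt (verit) exp_gt_zero mult_nonneg_nonpos mult_pos_pos)
      have "h T * exp (- (2 * \<delta>)) * (c - tail (\<mu> * \<delta>)) < a * exp (- (2 * \<delta>)) * (c - tail (\<mu> * \<delta>))"
        using upper[OF \<mu>(2), of T \<delta>] elim by linarith
      then show ?case using pos by simp
    qed
  next
    fix a :: real assume a: "a < 1"
    have "((\<lambda>\<delta>. a * exp (2 * \<delta>)) \<longlongrightarrow> a * exp (2 * 0)) (at_right 0)"
      by (intro tendsto_intros)
    then have "\<forall>\<^sub>F \<delta> in at_right 0. a * exp (2 * \<delta>) < 1"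
      using a by (intro order_tendstoD) auto
    then have "\<forall>\<^sub>F \<delta> in at_right (0::real). a * exp (2 * \<delta>) < 1 \<and> \<delta> > 0"
      using eventually_at_right_less by (rule eventually_conj)
    then obtain \<delta> where \<delta>: "a * exp (2 * \<delta>) < 1" "\<delta> > 0"
      using eventually_happens'[OF trivial_limit_at_right_real] by blast
    have "((\<lambda>\<mu>. a * exp (2 * \<delta>) * c + B * tail (\<mu> * \<delta>)) \<longlongrightarrow> a * exp (2 * \<delta>) * c + B * 0) at_top"
      by (intro tendsto_intros tail_limit \<delta>)
    moreover have "a * exp (2 * \<delta>) * c + B * 0 < c" using \<delta> c_pos by simp
    ultimately have "\<forall>\<^sub>F \<mu> in at_top. a * exp (2 * \<delta>) * c + B * tail (\<mu> * \<delta>) < c"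
      by (rule order_tendstoD)
    then have "\<forall>\<^sub>F \<mu> in at_top. a * exp (2 * \<delta>) * c + B * tail (\<mu> * \<delta>) < c \<and> \<mu> > 0"
      using eventually_gt_at_top by (rule eventually_conj)
    then obtain \<mu> where \<mu>: "a * exp (2 * \<delta>) * c + B * tail (\<mu> * \<delta>) < c" "\<mu> > 0"
      using eventually_happens'[OF trivial_limit_at_top_linorder] by blast
    have "filterlim (\<lambda>T. T - \<delta>) at_top at_top" by real_asymp
    from filterlim_compose[OF average_tendsto[OF \<mu>(2)] this]
    have "\<forall>\<^sub>F T in at_top. a * exp (2 * \<delta>) * c + B * tail (\<mu> * \<delta>) < (\<integral>u. h (T - \<delta> - u / \<mu>) * fejer u \<partial>lborel)"
      using \<mu>(1) unfolding c_def[symmetric] by (rule order_tendstoD)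
    then show "\<forall>\<^sub>F T in at_top. a < h T"
    proof eventually_elim
      case (elim T)
      have "a * (exp (2 * \<delta>) * c) < h T * (exp (2 * \<delta>) * c)"
        using lower[OF \<mu>(2), of T \<delta>] elim unfolding mult.assoc by linarith
      then show ?case using c_pos by simp
    qed
  qed
qed

end

subsection \<open>Dirichlet series\<close>

text \<open>Summation may start at 0 because \<open>0 powr (- s) = 0\<close>, whatever
  \<open>a 0\<close> is.\<close>

definition dser :: "(nat \<Rightarrow> complex) \<Rightarrow> complex \<Rightarrow> complex" where
  "dser a s = (\<Sum>n. a n * of_nat n powr (- s))"

lemma norm_of_nat_powr: "norm ((of_nat n :: complex) powr s) = real n powr Re s"
  by (simp add: norm_powr_real_powr)

text \<open>The growth \<open>1 + ln n\<close> covers characters, their Mangoldt twists and the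
  coefficients of the derivative alike. Half of the gap \<open>Re s - 1\<close> is spent on
  absorbing the logarithm.\<close>

lemma summable_norm_dser:
  assumes a: "\<And>n. n > 0 \<Longrightarrow> norm (a n) \<le> 1 + ln (real n)" and s: "Re s > 1"
  shows "summable (\<lambda>n. norm (a n * of_nat n powr (- s)))"
proof (rule summable_comparison_test)
  define \<delta> where "\<delta> = (Re s - 1) / 2"
  have \<delta>: "\<delta> > 0" "\<delta> - Re s < -1" using s by (auto simp: \<delta>_def field_simps)
  show "summable (\<lambda>n. (1 + 1 / \<delta>) * real n powr (\<delta> - Re s))"
    using \<delta> by (intro summable_mult) (simp add: summable_real_powr_iff)
  show "\<exists>N. \<forall>n\<ge>N. norm (norm (a n * of_nat n powr (- s))) \<le> (1 + 1 / \<delta>) * real n powr (\<delta> - Re s)"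
  proof (intro exI[of _ 1] allI impI)
    fix n :: nat assume n: "n \<ge> 1"
    have "norm (a n) \<le> 1 + ln (real n)" using a n by simp
    also have "\<dots> \<le> real n powr \<delta> + real n powr \<delta> / \<delta>"
      using n \<delta> by (intro add_mono ln_powr_bound) (auto simp: ge_one_powr_ge_zero)
    also have "\<dots> = (1 + 1 / \<delta>) * real n powr \<delta>" by (simp add: field_simps)
    finally have "norm (a n) * real n powr (- Re s) \<le> (1 + 1 / \<delta>) * real n powr \<delta> * real n powr (- Re s)"
      by (rule mult_right_mono) simp
    also have "\<dots> = (1 + 1 / \<delta>) * real n powr (\<delta> - Re s)"
      by (simp add: mult.assoc flip: powr_add)
    finally show "norm (norm (a n * of_nat n powr (- s))) \<le> (1 + 1 / \<delta>) * real n powr (\<delta> - Re s)"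
      by (simp add: norm_mult norm_of_nat_powr)
  qed
qed

lemma dser_sums:
  assumes "\<And>n. n > 0 \<Longrightarrow> norm (a n) \<le> 1 + ln (real n)" "Re s > 1"
  shows "(\<lambda>n. a n * of_nat n powr (- s)) sums dser a s"
  unfolding dser_def by (rule summable_sums[OF summable_norm_cancel[OF summable_norm_dser[OF assms]]])

lemma dser_has_sum:
  assumes "\<And>n. n > 0 \<Longrightarrow> norm (a n) \<le> 1 + ln (real n)" "Re s > 1"
  shows "((\<lambda>n. a n * of_nat n powr (- s)) has_sum dser a s) UNIV"
  using norm_summable_imp_has_sum[OF summable_norm_dser[OF assms] dser_sums[OF assms]] .

lemma open_halfplane: "open {s. Re s > c}"
  by (simp add: open_halfspace_Re_gt)

lemma of_nat_powr_has_derivative: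
  "((\<lambda>s. (of_nat n :: complex) powr (- s)) has_field_derivative - (of_real (ln (real n)) * of_nat n powr (- s))) (at s)"
proof (cases "n = 0")
  case False
  then have "Ln (of_nat n :: complex) = of_real (ln (real n))" using Ln_of_real[of "real n"] by simp
  moreover have "((\<lambda>s. (of_nat n :: complex) powr (- s)) has_field_derivative (Ln (of_nat n) * of_nat n powr (- s)) * (- 1)) (at s)"
    by (rule DERIV_chain2[OF has_field_derivative_powr_right]) (use False in \<open>auto intro!: derivative_eq_intros\<close>)
  ultimately show ?thesis by simp
qed simp

text \<open>On the disc of radius \<open>(Re x - 1) / 2\<close> the terms are dominated by a
  convergent series. Being holomorphic, they may then be differentiated termwise without a separate
  bound for the derivatives.\<close>

lemma dser_has_derivative:
  assumes a: "\<And>n. norm (a n) \<le> 1" and s: "Re s > 1"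
  shows "(dser a has_field_derivative - dser (\<lambda>n. a n * of_real (ln (real n))) s) (at s)"
proof -
  have "\<exists>g g'. \<forall>x \<in> {s. Re s > 1}. ((\<lambda>n. a n * of_nat n powr (- x)) sums g x) \<and>
      ((\<lambda>n. a n * - (of_real (ln (real n)) * of_nat n powr (- x))) sums g' x) \<and> (g has_field_derivative g' x) (at x)"
  proof (rule series_and_derivative_comparison_local[OF open_halfplane])
    fix n and x :: complex
    show "((\<lambda>x. a n * of_nat n powr (- x)) has_field_derivative a n * - (of_real (ln (real n)) * of_nat n powr (- x))) (at x)"
      by (rule DERIV_cmult[OF of_nat_powr_has_derivative])
  next
    fix x assume "x \<in> {s. Re s > 1}"
    then have x: "Re x > 1" by simp
    define d where "d = (Re x - 1) / 2"
    have "norm (a n * of_nat n powr (- y)) \<le> real n powr (- (1 + d))" if "y \<in> ball x d" for n y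
    proof (cases "n = 0")
      case False
      have "\<bar>Re x - Re y\<bar> < d" using that abs_Re_le_cmod[of "x - y"] by (simp add: dist_norm)
      moreover have "Re x = 1 + 2 * d" by (simp add: d_def field_simps)
      ultimately have "Re y \<ge> 1 + d" by linarith
      then have "real n powr (- Re y) \<le> real n powr (- (1 + d))" using False by (intro powr_mono) auto
      moreover have "norm (a n) * real n powr (- Re y) \<le> 1 * real n powr (- Re y)"
        by (intro mult_right_mono a) auto
      ultimately show ?thesis by (simp add: norm_mult norm_of_nat_powr)
    qed simp
    moreover have "d > 0" using x by (simp add: d_def)
    moreover have "summable (\<lambda>n. real n powr (- (1 + d)))" using \<open>d > 0\<close> by (subst summable_real_powr_iff) simp
    ultimately show "\<exists>d h. 0 < d \<and> summable h \<and> (\<forall>\<^sub>F n in sequentially. \<forall>y\<in>ball x d \<inter> {s. Re s > 1}. norm (a n * of_nat n powr (- y)) \<le> h n)"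
      by (intro exI[of _ d] exI[of _ "\<lambda>n. real n powr (- (1 + d))"]) auto
  qed
  then obtain g g' where g: "\<And>x. Re x > 1 \<Longrightarrow> (\<lambda>n. a n * of_nat n powr (- x)) sums g x"
     "\<And>x. Re x > 1 \<Longrightarrow> (\<lambda>n. a n * - (of_real (ln (real n)) * of_nat n powr (- x))) sums g' x"
     "\<And>x. Re x > 1 \<Longrightarrow> (g has_field_derivative g' x) (at x)" by auto
  have "g x = dser a x" if "Re x > 1" for x using g(1)[OF that] by (simp add: dser_def sums_iff)
  moreover have "g' s = - dser (\<lambda>n. a n * of_real (ln (real n))) s"
  proof -
    have "(\<lambda>n. - (a n * - (of_real (ln (real n)) * of_nat n powr (- s)))) sums (- g' s)"
      using g(2)[OF s] by (rule sums_minus)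
    then show ?thesis by (simp add: dser_def sums_iff mult.assoc)
  qed
  ultimately show ?thesis
    using g(3)[OF s] s
    by (auto intro: has_field_derivative_transform_within_open[OF _ open_halfplane[of 1]])
qed

text \<open>Complete multiplicativity pulls \<open>a N\<close> out of the sum over the divisors of
  \<open>N\<close>, where \<open>mangoldt\<close> sums to \<open>ln N\<close>; absolute summability
  permits this regrouping. The product form expresses the logarithmic derivative without dividing by
  a series that might vanish.\<close>

lemma dser_mult_mangoldt:
  assumes a: "\<And>n. norm (a n) \<le> 1" and mult: "\<And>m n. a (m * n) = a m * a n" and s: "Re s > 1"
  shows "dser a s * dser (\<lambda>n. a n * mangoldt n) s = dser (\<lambda>n. a n * of_real (ln (real n))) s"
proof -
  have a1: "norm (a n) \<le> 1 + ln (real n)" if "n > 0" for n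
    using a[of n] that by (smt (verit) ln_ge_zero_iff of_nat_0_less_iff of_nat_1 of_nat_le_iff One_nat_def Suc_leI)
  have a2: "norm (a n * mangoldt n) \<le> 1 + ln (real n)" if "n > 0" for n
  proof -
    have "norm (a n) * mangoldt n \<le> 1 * ln (real n)"
      using a[of n] mangoldt_le[OF that] that by (intro mult_mono mangoldt_nonneg) auto
    then show ?thesis by (simp add: norm_mult)
  qed
  have a3: "norm (a n * of_real (ln (real n))) \<le> 1 + ln (real n)" if "n > 0" for n
  proof -
    have "norm (a n) * ln (real n) \<le> 1 * ln (real n)" using a[of n] that by (intro mult_right_mono) auto
    then show ?thesis using that by (simp add: norm_mult)
  qed
  define F where "F m = a m * of_nat m powr (- s)" for m
  define G where "G n = a n * mangoldt n * of_nat n powr (- s)" for n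
  have F: "(F has_sum dser a s) UNIV" unfolding F_def[abs_def] by (rule dser_has_sum[OF a1 s])
  have G: "(G has_sum dser (\<lambda>n. a n * mangoldt n) s) UNIV" unfolding G_def[abs_def] by (rule dser_has_sum[OF a2 s])
  have Fn: "(\<lambda>n. norm (F n)) summable_on UNIV"
    using summable_norm_dser[OF a1 s] by (subst summable_on_UNIV_nonneg_real_iff) (auto simp: F_def)
  have Gn: "(\<lambda>n. norm (G n)) summable_on UNIV"
    using summable_norm_dser[OF a2 s] by (subst summable_on_UNIV_nonneg_real_iff) (auto simp: G_def)
  have "(\<lambda>p. norm (case p of (m, n) \<Rightarrow> F m * G n)) summable_on (UNIV \<times> UNIV)"
    unfolding Infinite_Sum.abs_summable_on_Sigma_iff using Fn Gn
    by (auto simp: norm_mult infsum_cmult_right' abs_mult intro!: summable_on_cmult_right summable_on_cmult_left)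
  then have summ: "(\<lambda>(m, n). F m * G n) summable_on (UNIV \<times> UNIV)"
    by (rule abs_summable_summable)
  have "((\<lambda>(m, n). F m * G n) has_sum (dser a s * dser (\<lambda>n. a n * mangoldt n) s)) (UNIV \<times> UNIV)"
  proof (rule has_sum_SigmaI[OF _ _ summ])
    show "((\<lambda>n. case (m, n) of (m, n) \<Rightarrow> F m * G n) has_sum F m * dser (\<lambda>n. a n * mangoldt n) s) UNIV" for m
      using has_sum_cmult_right[OF G] by simp
    show "((\<lambda>m. F m * dser (\<lambda>n. a n * mangoldt n) s) has_sum dser a s * dser (\<lambda>n. a n * mangoldt n) s) UNIV"
      by (rule has_sum_cmult_left[OF F])
  qed
  \<comment> \<open>Zero indices contribute nothing, but they must go:
    \<open>(m, n) \<mapsto> (m * n, n)\<close> is injective only for \<open>n > 0\<close>, and 0 has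
    infinitely many divisors.\<close>
  then have "((\<lambda>(m, n). F m * G n) has_sum (dser a s * dser (\<lambda>n. a n * mangoldt n) s)) ({0<..} \<times> {0<..})"
    by (rule has_sum_cong_neutral[THEN iffD1, rotated -1]) (auto simp: F_def G_def)
  then have "((\<lambda>(N, n). F (N div n) * G n) has_sum (dser a s * dser (\<lambda>n. a n * mangoldt n) s)) (Sigma {0<..} (\<lambda>N. {n. n dvd N}))"
    by (rule has_sum_reindex_bij_witness[where i = "\<lambda>(N, n). (N div n, n)" and j = "\<lambda>(m, n). (m * n, n)",
        THEN iffD1, rotated -1])
       (auto simp: dvd_pos_nat elim!: dvdE)
  then have "((\<lambda>N. a N * of_real (ln (real N)) * of_nat N powr (- s)) has_sum (dser a s * dser (\<lambda>n. a n * mangoldt n) s)) {0<..}"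
  proof (rule has_sum_SigmaD)
    fix N :: nat assume "N \<in> {0<..}"
    then have N: "N > 0" by simp
    have "F (N div n) * G n = a N * of_nat N powr (- s) * mangoldt n" if n: "n dvd N" for n
    proof -
      obtain m where m: "N = n * m" using n by blast
      have "n > 0" using m N by auto
      then have "F (N div n) * G n = (a m * a n) * ((of_nat m powr (- s)) * (of_nat n powr (- s))) * mangoldt n"
        by (simp add: F_def G_def m mult_ac)
      also have "(of_nat m :: complex) powr (- s) * of_nat n powr (- s) = of_nat N powr (- s)"
        unfolding m of_nat_mult by (subst powr_times_real) (auto simp: mult.commute)
      also have "a m * a n = a N" by (simp add: m mult mult.commute)
      finally show ?thesis by simp
    qed
    then have "(\<Sum>n | n dvd N. F (N div n) * G n) = a N * of_nat N powr (- s) * (\<Sum>n | n dvd N. mangoldt n)"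
      by (simp add: sum_distrib_left)
    also have "\<dots> = a N * of_real (ln (real N)) * of_nat N powr (- s)"
      using N by (simp add: mangoldt_sum)
    finally have "a N * of_real (ln (real N)) * of_nat N powr (- s) = (\<Sum>n | n dvd N. F (N div n) * G n)" ..
    then show "((\<lambda>n. case (N, n) of (N, n) \<Rightarrow> F (N div n) * G n) has_sum a N * of_real (ln (real N)) * of_nat N powr (- s)) {n. n dvd N}"
      using N by (simp add: has_sum_finite)
  qed
  then have "((\<lambda>N. a N * of_real (ln (real N)) * of_nat N powr (- s)) has_sum (dser a s * dser (\<lambda>n. a n * mangoldt n) s)) UNIV"
    by (rule has_sum_cong_neutral[THEN iffD1, rotated -1]) auto
  moreover have "((\<lambda>N. a N * of_real (ln (real N)) * of_nat N powr (- s)) has_sum dser (\<lambda>n. a n * of_real (ln (real n))) s) UNIV"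
    by (rule dser_has_sum[OF a3 s])
  ultimately show ?thesis by (rule has_sum_unique)
qed

subsection \<open>The Dedekind zeta function of the Gaussian integers\<close>

text \<open>A difference gains one power of \<open>x\<close> over a single term. This extra power is
  what makes the two series below converge absolutely for \<open>Re s > 0\<close>.\<close>

lemma powr_diff_bound:
  fixes s :: complex
  assumes xy: "0 < x" "x \<le> y" and s: "Re s > 0"
  shows "norm (of_real x powr (- s) - of_real y powr (- s)) \<le> norm s * x powr (- Re s - 1) * (y - x)"
proof -
  have "norm ((of_real x :: complex) powr (- s) - of_real y powr (- s)) \<le> norm s * x powr (- Re s - 1) * norm (of_real x - of_real y :: complex)"
  proof (rule field_differentiable_bound[where S = "closed_segment (of_real x) (of_real y)" and f' = "\<lambda>z. - s * z powr (- s - 1)"])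
    fix z assume "z \<in> closed_segment (of_real x) (complex_of_real y)"
    then have "z \<in> of_real ` closed_segment x y" by (simp only: closed_segment_of_real)
    then obtain r where r: "z = of_real r" "x \<le> r" "r \<le> y"
      using xy by (auto simp: closed_segment_eq_real_ivl)
    have "z \<notin> \<real>\<^sub>\<le>\<^sub>0" using r xy by (auto simp: complex_nonpos_Reals_iff)
    then show "((\<lambda>z. z powr (- s)) has_field_derivative - s * z powr (- s - 1)) (at z within closed_segment (of_real x) (of_real y))"
      by (rule has_field_derivative_at_within[OF has_field_derivative_powr])
    have "norm (- s * z powr (- s - 1)) = norm s * r powr (- Re s - 1)"
      using r xy by (simp add: norm_mult norm_powr_real_powr)
    also have "\<dots> \<le> norm s * x powr (- Re s - 1)"
      using r xy s by (intro mult_left_mono powr_mono2') auto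
    finally show "norm (- s * z powr (- s - 1)) \<le> norm s * x powr (- Re s - 1)" .
  qed auto
  also have "norm (of_real x - of_real y :: complex) = y - x"
    using xy by (simp add: norm_of_real flip: of_real_diff)
  finally show ?thesis .
qed

text \<open>With \<open>m = Suc n\<close> this is \<open>s - 1\<close> times the difference between
  \<open>m powr (- s)\<close> and the integral of \<open>t powr (- s)\<close> over
  \<open>{m..m + 1}\<close>. The factor clears the pole at 1.\<close>

definition zeta_term :: "nat \<Rightarrow> complex \<Rightarrow> complex" where
  "zeta_term n s = (s - 1) * of_nat (Suc n) powr (- s) + of_nat (Suc (Suc n)) powr (1 - s) - of_nat (Suc n) powr (1 - s)"

text \<open>This is \<open>(s - 1) \<zeta>(s)\<close>, continued to \<open>Re s > 0\<close> by comparing the sum with the integral.\<close>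

definition zeta1 :: "complex \<Rightarrow> complex" where
  "zeta1 s = 1 + (\<Sum>n. zeta_term n s)"

definition chi4 :: "nat \<Rightarrow> real" where
  "chi4 n = (if n mod 4 = 1 then 1 else if n mod 4 = 3 then -1 else 0)"

text \<open>Pairing the residues 1 and 3 gives absolute convergence for \<open>Re s > 0\<close>,
  which single terms do not have.\<close>

definition L4_term :: "nat \<Rightarrow> complex \<Rightarrow> complex" where
  "L4_term k s = of_nat (4 * k + 1) powr (- s) - of_nat (4 * k + 3) powr (- s)"

definition L4 :: "complex \<Rightarrow> complex" where
  "L4 s = (\<Sum>k. L4_term k s)"

lemma zeta_term_bound:
  assumes s: "Re s > 0"
  shows "norm (zeta_term n s) \<le> norm s * norm (s - 1) * real (Suc n) powr (- Re s - 1)"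
proof -
  define m where "m = real (Suc n)"
  have m: "m > 0" by (simp add: m_def)
  \<comment> \<open>\<open>zeta_term n s\<close> is the increment of \<open>G\<close> from
    \<open>m\<close> to \<open>m + 1\<close>. Its derivative
    \<open>(s - 1) * (m powr (- s) - w powr (- s))\<close> vanishes at \<open>w = m\<close> and is
    small on the segment by \<open>powr_diff_bound\<close>.\<close>
  define G where "G w = (s - 1) * w * of_real m powr (- s) + w powr (1 - s)" for w :: complex
  have "norm (G (of_real (m + 1)) - G (of_real m)) \<le> norm (s - 1) * (norm s * m powr (- Re s - 1)) * norm (of_real (m + 1) - of_real m :: complex)"
  proof (rule field_differentiable_bound[where S = "closed_segment (of_real m) (of_real (m + 1))"
        and f' = "\<lambda>z. (s - 1) * (of_real m powr (- s) - z powr (- s))"])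
    fix z assume "z \<in> closed_segment (of_real m) (complex_of_real (m + 1))"
    then have "z \<in> of_real ` closed_segment m (m + 1)" by (simp only: closed_segment_of_real)
    then obtain r where r: "z = of_real r" "m \<le> r" "r \<le> m + 1"
      by (auto simp: closed_segment_eq_real_ivl)
    have "z \<notin> \<real>\<^sub>\<le>\<^sub>0" using r m by (auto simp: complex_nonpos_Reals_iff)
    then have "(G has_field_derivative (s - 1) * of_real m powr (- s) + (1 - s) * z powr (1 - s - 1)) (at z)"
      unfolding G_def[abs_def] by (auto intro!: derivative_eq_intros has_field_derivative_powr)
    moreover have "(s - 1) * of_real m powr (- s) + (1 - s) * z powr (1 - s - 1) = (s - 1) * (of_real m powr (- s) - z powr (- s))"
      by (simp add: algebra_simps)
    ultimately show "(G has_field_derivative (s - 1) * (of_real m powr (- s) - z powr (- s))) (at z within closed_segment (of_real m) (of_real (m + 1)))"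
      by (auto intro: has_field_derivative_at_within)
    have "norm (of_real m powr (- s) - z powr (- s)) \<le> norm s * m powr (- Re s - 1) * (r - m)"
      unfolding r(1) using powr_diff_bound[OF m r(2) s] .
    also have "\<dots> \<le> norm s * m powr (- Re s - 1) * 1" using r by (intro mult_left_mono) auto
    finally show "norm ((s - 1) * (of_real m powr (- s) - z powr (- s))) \<le> norm (s - 1) * (norm s * m powr (- Re s - 1))"
      unfolding norm_mult by (intro mult_left_mono) auto
  qed auto
  moreover have "G (of_real (m + 1)) - G (of_real m) = zeta_term n s"
  proof -
    have "complex_of_real m = of_nat (Suc n)" "complex_of_real (m + 1) = of_nat (Suc (Suc n))" by (simp_all add: m_def)
    then show ?thesis unfolding G_def zeta_term_def by (simp add: algebra_simps)
  qed
  ultimately show ?thesis by (simp add: m_def mult_ac)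
qed

lemma L4_term_bound:
  assumes s: "Re s > 0"
  shows "norm (L4_term k s) \<le> 2 * norm s * real (Suc k) powr (- Re s - 1)"
proof -
  have "norm (L4_term k s) \<le> norm s * real (4 * k + 1) powr (- Re s - 1) * (real (4 * k + 3) - real (4 * k + 1))"
    using powr_diff_bound[of "real (4 * k + 1)" "real (4 * k + 3)" s] s by (simp add: L4_term_def)
  also have "\<dots> = 2 * norm s * real (4 * k + 1) powr (- Re s - 1)" by simp
  also have "\<dots> \<le> 2 * norm s * real (Suc k) powr (- Re s - 1)"
    using s by (intro mult_left_mono powr_mono2') auto
  finally show ?thesis .
qed

text \<open>On the disc of radius \<open>d = Re x / 2\<close> the continuous \<open>C\<close> is
  bounded and the exponent stays below \<open>- d - 1\<close>, so convergence is locally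
  uniform.\<close>

lemma series_holomorphic_halfplane:
  fixes f :: "nat \<Rightarrow> complex \<Rightarrow> complex"
  assumes holo: "\<And>n. f n holomorphic_on {s. Re s > 0}"
    and bound: "\<And>n s. Re s > 0 \<Longrightarrow> norm (f n s) \<le> C s * real (Suc n) powr (- Re s - 1)"
    and C: "continuous_on UNIV C"
  shows "(\<lambda>s. \<Sum>n. f n s) holomorphic_on {s. Re s > 0}" and "\<And>s. Re s > 0 \<Longrightarrow> (\<lambda>n. f n s) sums (\<Sum>n. f n s)"
proof -
  have "\<exists>g g'. \<forall>x \<in> {s. Re s > 0}. ((\<lambda>n. f n x) sums g x) \<and> ((\<lambda>n. deriv (f n) x) sums g' x) \<and> (g has_field_derivative g' x) (at x)"
  proof (rule series_and_derivative_comparison_local[OF open_halfplane])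
    fix n x assume "x \<in> {s. Re s > 0}"
    then show "(f n has_field_derivative deriv (f n) x) (at x)"
      by (rule holomorphic_derivI[OF holo open_halfplane])
  next
    fix x assume "x \<in> {s. Re s > 0}"
    then have x: "Re x > 0" by simp
    define d where "d = Re x / 2"
    have "compact (C ` cball x d)" using C by (intro compact_continuous_image) (auto intro: continuous_on_subset)
    then obtain M where M: "\<And>y. y \<in> cball x d \<Longrightarrow> norm (C y) \<le> M"
      using compact_imp_bounded bounded_iff by (metis (no_types, lifting) imageI)
    have "norm (f n y) \<le> M * real (Suc n) powr (- d - 1)" if "y \<in> ball x d" for n y
    proof -
      have "\<bar>Re x - Re y\<bar> < d" using that abs_Re_le_cmod[of "x - y"] by (simp add: dist_norm)
      moreover have "Re x = 2 * d" by (simp add: d_def)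
      ultimately have y: "Re y \<ge> d" "d > 0" using x by linarith+
      have "norm (f n y) \<le> C y * real (Suc n) powr (- Re y - 1)" using bound y by simp
      also have "\<dots> \<le> norm (C y) * real (Suc n) powr (- Re y - 1)" by (intro mult_right_mono) auto
      also have "\<dots> \<le> M * real (Suc n) powr (- d - 1)"
        using y M[of y] that by (intro mult_mono powr_mono) (auto intro: order_trans[OF norm_ge_zero])
      finally show ?thesis .
    qed
    moreover have "d > 0" using x by (simp add: d_def)
    moreover have "summable (\<lambda>n. real n powr (- d - 1))" using \<open>d > 0\<close> by (subst summable_real_powr_iff) simp
    then have "summable (\<lambda>n. M * real (Suc n) powr (- d - 1))"
      by (intro summable_mult) (subst summable_Suc_iff)
    ultimately show "\<exists>d h. 0 < d \<and> summable h \<and> (\<forall>\<^sub>F n in sequentially. \<forall>y\<in>ball x d \<inter> {s. Re s > 0}. norm (f n y) \<le> h n)"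
      by (intro exI[of _ d] exI[of _ "\<lambda>n. M * real (Suc n) powr (- d - 1)"]) auto
  qed
  then obtain g g' where g: "\<And>x. Re x > 0 \<Longrightarrow> (\<lambda>n. f n x) sums g x"
     "\<And>x. Re x > 0 \<Longrightarrow> (g has_field_derivative g' x) (at x)" by auto
  have eq: "g x = (\<Sum>n. f n x)" if "Re x > 0" for x using g(1)[OF that] by (simp add: sums_iff)
  show "(\<lambda>n. f n s) sums (\<Sum>n. f n s)" if "Re s > 0" for s using g(1)[OF that] eq[OF that] by simp
  have "g holomorphic_on {s. Re s > 0}"
    using g(2) by (subst holomorphic_on_open[OF open_halfplane]) auto
  then show "(\<lambda>s. \<Sum>n. f n s) holomorphic_on {s. Re s > 0}"
    by (rule holomorphic_transform) (use eq in auto)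
qed

lemma zeta_term_holomorphic: "zeta_term n holomorphic_on S"
  unfolding zeta_term_def[abs_def] by (intro holomorphic_intros) (auto simp del: of_nat_Suc)

lemma L4_term_holomorphic: "L4_term n holomorphic_on S"
  unfolding L4_term_def[abs_def] by (intro holomorphic_intros) (auto simp del: of_nat_add of_nat_mult)

lemma zeta1_holomorphic: "zeta1 holomorphic_on {s. Re s > 0}"
  and zeta_term_sums: "Re s > 0 \<Longrightarrow> (\<lambda>n. zeta_term n s) sums (zeta1 s - 1)"
proof -
  have C: "continuous_on UNIV (\<lambda>s::complex. norm s * norm (s - 1))" by (intro continuous_intros)
  note * = series_holomorphic_halfplane[OF zeta_term_holomorphic zeta_term_bound C]
  show "zeta1 holomorphic_on {s. Re s > 0}"
    unfolding zeta1_def[abs_def] by (intro holomorphic_intros *)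
  show "Re s > 0 \<Longrightarrow> (\<lambda>n. zeta_term n s) sums (zeta1 s - 1)"
    using *(2) by (simp add: zeta1_def)
qed

lemma L4_holomorphic: "L4 holomorphic_on {s. Re s > 0}"
  and L4_term_sums: "Re s > 0 \<Longrightarrow> (\<lambda>n. L4_term n s) sums (L4 s)"
proof -
  have C: "continuous_on UNIV (\<lambda>s::complex. 2 * norm s)" by (intro continuous_intros)
  note * = series_holomorphic_halfplane[OF L4_term_holomorphic L4_term_bound C]
  show "L4 holomorphic_on {s. Re s > 0}"
    unfolding L4_def[abs_def] by (rule *)
  show "Re s > 0 \<Longrightarrow> (\<lambda>n. L4_term n s) sums (L4 s)"
    using *(2) by (simp add: L4_def)
qed

lemma one_le_one_plus_ln: "n > 0 \<Longrightarrow> 1 \<le> 1 + ln (real n)"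
  by simp

text \<open>For \<open>Re s > 1\<close> the two halves of \<open>zeta_term\<close> converge
  separately. The telescoping half sums to \<open>-1\<close> and cancels the 1 in
  \<open>zeta1\<close>.\<close>

lemma zeta1_eq_dser:
  assumes s: "Re s > 1"
  shows "zeta1 s = (s - 1) * dser (\<lambda>_. 1) s"
proof -
  have "(\<lambda>n. 1 * of_nat n powr (- s)) sums dser (\<lambda>_. 1) s"
    by (rule dser_sums[OF _ s]) simp
  then have "(\<lambda>n. of_nat (Suc n) powr (- s)) sums dser (\<lambda>_. 1) s"
    by (subst sums_Suc_iff) simp
  then have 1: "(\<lambda>n. (s - 1) * of_nat (Suc n) powr (- s)) sums ((s - 1) * dser (\<lambda>_. 1) s)"
    by (rule sums_mult)
  have "(\<lambda>n. of_nat (Suc n) powr (1 - s)) \<longlonglongrightarrow> 0"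
    using s by (intro tendsto_neg_powr_complex_of_nat filterlim_Suc) auto
  from telescope_sums[OF this]
  have 2: "(\<lambda>n. of_nat (Suc (Suc n)) powr (1 - s) - of_nat (Suc n) powr (1 - s)) sums - 1" by simp
  have "(\<lambda>n. zeta_term n s) sums ((s - 1) * dser (\<lambda>_. 1) s + - 1)"
    using sums_add[OF 1 2] by (simp add: zeta_term_def algebra_simps)
  moreover have "(\<lambda>n. zeta_term n s) sums (zeta1 s - 1)" using s by (intro zeta_term_sums) simp
  ultimately have "zeta1 s - 1 = (s - 1) * dser (\<lambda>_. 1) s + - 1" by (metis sums_unique2)
  then show ?thesis by simp
qed

lemma norm_chi4: "norm (of_real (chi4 n) :: complex) \<le> 1"
  by (simp add: chi4_def)

lemma L4_eq_dser:
  assumes s: "Re s > 1"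
  shows "L4 s = dser (\<lambda>n. of_real (chi4 n)) s"
proof -
  have "(\<lambda>n. of_real (chi4 n) * of_nat n powr (- s)) sums dser (\<lambda>n. of_real (chi4 n)) s"
    by (rule dser_sums[OF _ s]) (rule order_trans[OF norm_chi4 one_le_one_plus_ln])
  from sums_group[OF this, of 4]
  have "(\<lambda>k. \<Sum>n\<in>{k * 4..<k * 4 + 4}. of_real (chi4 n) * of_nat n powr (- s)) sums dser (\<lambda>n. of_real (chi4 n)) s"
    by simp
  moreover have "(\<Sum>n\<in>{k * 4..<k * 4 + 4}. of_real (chi4 n) * of_nat n powr (- s)) = L4_term k s" for k
  proof -
    have "{k * 4..<k * 4 + 4} = {4 * k, 4 * k + 1, 4 * k + 2, 4 * k + 3}" by auto
    moreover have "(4 * k + 1) mod 4 = 1" "(4 * k + 2) mod 4 = 2" "(4 * k + 3) mod 4 = 3" by presburger+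
    ultimately show ?thesis by (simp add: chi4_def L4_term_def)
  qed
  ultimately have "(\<lambda>k. L4_term k s) sums dser (\<lambda>n. of_real (chi4 n)) s" by simp
  moreover have "(\<lambda>k. L4_term k s) sums L4 s" using s by (intro L4_term_sums) simp
  ultimately show ?thesis by (metis sums_unique2)
qed

lemma chi4_mult: "chi4 (m * n) = chi4 m * chi4 n"
proof -
  have *: "(m * n) mod 4 = ((m mod 4) * (n mod 4)) mod 4" by (simp add: mod_mult_eq)
  consider "m mod 4 = 0" | "m mod 4 = 1" | "m mod 4 = 2" | "m mod 4 = 3" by linarith
  note m = this
  consider "n mod 4 = 0" | "n mod 4 = 1" | "n mod 4 = 2" | "n mod 4 = 3" by linarith
  then show ?thesis
    by cases (rule m; simp add: chi4_def *)+
qed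

text \<open>Not the zeta function of the Gaussian integers itself but \<open>s - 1\<close> times it,
  so that the pole at 1 becomes a nonzero value.\<close>

definition dedekind :: "complex \<Rightarrow> complex" where
  "dedekind s = zeta1 s * L4 s"

text \<open>Twice \<open>mangoldt\<close> on residue 1 mod 4, nothing on residue 3, and
  \<open>mangoldt\<close> itself on powers of 2. The weight 2 makes up for half of the primes being
  lost.\<close>

definition coeff4 :: "nat \<Rightarrow> real" where
  "coeff4 n = (1 + chi4 n) * mangoldt n"

lemma coeff4_nonneg: "coeff4 n \<ge> 0"
  by (simp add: coeff4_def chi4_def mangoldt_nonneg)

lemma coeff4_bound: "n > 0 \<Longrightarrow> coeff4 n \<le> 2 * ln (real n)"
  unfolding coeff4_def by (intro mult_mono mangoldt_le mangoldt_nonneg) (auto simp: chi4_def)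

lemma dedekind_holomorphic: "dedekind holomorphic_on {s. Re s > 0}"
  unfolding dedekind_def[abs_def] by (intro holomorphic_intros zeta1_holomorphic L4_holomorphic)

text \<open>At \<open>s = 1\<close> every \<open>zeta_term\<close> is 0, so \<open>zeta1\<close> has
  value 1, and every pair in the series of \<open>L4\<close> is positive.\<close>

lemma dedekind_1: "dedekind 1 \<noteq> 0"
proof -
  have "zeta_term n 1 = 0" for n by (simp add: zeta_term_def del: of_nat_Suc)
  then have "zeta1 1 = 1" by (simp add: zeta1_def)
  moreover have "L4 1 \<noteq> 0"
  proof -
    have "L4_term k 1 = of_real (1 / real (4 * k + 1) - 1 / real (4 * k + 3))" for k
      by (simp add: L4_term_def powr_minus divide_inverse)
    then have "(\<lambda>k. of_real (1 / real (4 * k + 1) - 1 / real (4 * k + 3))) sums L4 1"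
      using L4_term_sums[of 1] by simp
    from sums_Re[OF this] have S: "(\<lambda>k. 1 / real (4 * k + 1) - 1 / real (4 * k + 3)) sums Re (L4 1)" by simp
    have "0 < (\<Sum>k. 1 / real (4 * k + 1) - 1 / real (4 * k + 3))"
      using S by (intro suminf_pos) (auto simp: sums_iff intro!: divide_strict_left_mono)
    then show ?thesis using S by (auto simp: sums_iff)
  qed
  ultimately show ?thesis by (simp add: dedekind_def)
qed

lemma dser_coeff4:
  assumes s: "Re s > 1"
  shows "dser (\<lambda>n. of_real (coeff4 n)) s = dser (\<lambda>n. 1 * mangoldt n) s + dser (\<lambda>n. of_real (chi4 n) * mangoldt n) s"
proof -
  have 1: "(\<lambda>n. (1 * mangoldt n) * of_nat n powr (- s)) sums dser (\<lambda>n. 1 * mangoldt n) s"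
    by (rule dser_sums[OF _ s]) (auto intro: order_trans[OF mangoldt_le])
  have 2: "(\<lambda>n. (of_real (chi4 n) * mangoldt n) * of_nat n powr (- s)) sums dser (\<lambda>n. of_real (chi4 n) * mangoldt n) s"
  proof (rule dser_sums[OF _ s])
    fix n :: nat assume n: "n > 0"
    have "norm (of_real (chi4 n) :: complex) * mangoldt n \<le> 1 * ln (real n)"
      using n norm_chi4 by (intro mult_mono mangoldt_le mangoldt_nonneg) auto
    then show "norm (of_real (chi4 n) * mangoldt n :: complex) \<le> 1 + ln (real n)" by (simp add: norm_mult)
  qed
  show ?thesis using sums_add[OF 1 2] unfolding dser_def
    by (simp add: sums_iff coeff4_def distrib_right)
qed

text \<open>The denominators are cleared because nonvanishing of \<open>dedekind\<close> on
  \<open>Re s > 1\<close> is not yet available; it is itself deduced from this identity.\<close>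

lemma dedekind_log_derivative:
  assumes s: "Re s > 1"
  shows "deriv dedekind s * (s - 1) = dedekind s * (1 - (s - 1) * dser (\<lambda>n. of_real (coeff4 n)) s)"
proof -
  let ?A = "dser (\<lambda>_. 1)" and ?X = "dser (\<lambda>n. of_real (chi4 n))"
  let ?B = "dser (\<lambda>n. 1 * mangoldt n)" and ?Y = "dser (\<lambda>n. of_real (chi4 n) * mangoldt n)"
  have A: "(?A has_field_derivative - (?A s * ?B s)) (at s)"
    using dser_has_derivative[of "\<lambda>_. 1" s] dser_mult_mangoldt[of "\<lambda>_. 1" s] s by simp
  have X: "(?X has_field_derivative - (?X s * ?Y s)) (at s)"
    using dser_has_derivative[of "\<lambda>n. of_real (chi4 n)" s] dser_mult_mangoldt[of "\<lambda>n. of_real (chi4 n)" s] s norm_chi4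
    by (simp add: chi4_mult)
  have "((\<lambda>s. (s - 1) * ?A s * ?X s) has_field_derivative
      (?A s * ?X s + (s - 1) * (- (?A s * ?B s)) * ?X s + (s - 1) * ?A s * (- (?X s * ?Y s)))) (at s)"
    by (rule derivative_eq_intros A X refl | simp add: algebra_simps)+
  then have "(dedekind has_field_derivative
      (?A s * ?X s + (s - 1) * (- (?A s * ?B s)) * ?X s + (s - 1) * ?A s * (- (?X s * ?Y s)))) (at s)"
    by (rule has_field_derivative_transform_within_open[OF _ open_halfplane[of 1]])
       (use s in \<open>auto simp: dedekind_def zeta1_eq_dser L4_eq_dser\<close>)
  then have dd: "deriv dedekind s = ?A s * ?X s + (s - 1) * (- (?A s * ?B s)) * ?X s + (s - 1) * ?A s * (- (?X s * ?Y s))"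
    by (rule DERIV_imp_deriv)
  show ?thesis
    unfolding dd dser_coeff4[OF s] by (simp add: dedekind_def zeta1_eq_dser[OF s] L4_eq_dser[OF s] algebra_simps)
qed

section \<open>Zeros of the Dedekind zeta function and its logarithmic derivative\<close>

text \<open>Near \<open>z\<close> one has \<open>f w = g w * (w - z) ^ m\<close> with
  \<open>g z \<noteq> 0\<close>, so \<open>deriv f / f\<close> has residue \<open>m\<close>. Stated
  as a limit, the multiplicity can be compared with Dirichlet series approaching
  \<open>z\<close>.\<close>

lemma log_derivative_order:
  fixes f :: "complex \<Rightarrow> complex"
  assumes f: "f holomorphic_on S" "open S" "connected S" "z \<in> S" "\<exists>w\<in>S. f w \<noteq> 0"
  obtains m :: nat where "f z = 0 \<longleftrightarrow> m > 0" "((\<lambda>s. (s - z) * (deriv f s / f s)) \<longlongrightarrow> of_nat m) (at z)"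
proof -
  define m where "m = nat (zorder f z)"
  obtain r where r: "r > 0" "cball z r \<subseteq> S" "zor_poly f z holomorphic_on cball z r"
      "\<And>w. w \<in> cball z r \<Longrightarrow> f w = zor_poly f z w * (w - z) ^ m \<and> zor_poly f z w \<noteq> 0"
      and m: "f z = 0 \<longleftrightarrow> m > 0"
    using zorder_exist_zero[OF f] unfolding m_def by (metis less_numeral_extra(3) nat_0 zero_less_nat_eq)
  define g where "g = zor_poly f z"
  have g: "g holomorphic_on ball z r" using r(3) ball_subset_cball holomorphic_on_subset unfolding g_def by blast
  have fg: "f w = g w * (w - z) ^ m" "g w \<noteq> 0" if "w \<in> ball z r" for w
    using r(4)[of w] that unfolding g_def by auto
  have "((\<lambda>s. (s - z) * (deriv g s / g s) + of_nat m) \<longlongrightarrow> (z - z) * (deriv g z / g z) + of_nat m) (at z)"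
  proof -
    have "isCont g z" using g r(1) holomorphic_on_imp_continuous_on continuous_on_eq_continuous_at by (metis centre_in_ball open_ball)
    moreover have "deriv g holomorphic_on ball z r" using g by (rule holomorphic_deriv) auto
    then have "isCont (deriv g) z" using r(1) holomorphic_on_imp_continuous_on continuous_on_eq_continuous_at by (metis centre_in_ball open_ball)
    ultimately show ?thesis using fg(2)[of z] r(1) by (intro tendsto_intros) (auto simp: isCont_def)
  qed
  then have "((\<lambda>s. (s - z) * (deriv g s / g s) + of_nat m) \<longlongrightarrow> of_nat m) (at z)" by simp
  moreover have "(s - z) * (deriv g s / g s) + of_nat m = (s - z) * (deriv f s / f s)" if s: "s \<in> ball z r" "s \<noteq> z" for s
  proof -
    have "(g has_field_derivative deriv g s) (at s)" using g s by (intro holomorphic_derivI) auto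
    then have "((\<lambda>w. g w * (w - z) ^ m) has_field_derivative deriv g s * (s - z) ^ m + g s * (of_nat m * (s - z) ^ (m - 1))) (at s)"
      by (auto intro!: derivative_eq_intros)
    then have "(f has_field_derivative deriv g s * (s - z) ^ m + g s * (of_nat m * (s - z) ^ (m - 1))) (at s)"
      by (rule has_field_derivative_transform_within_open[OF _ open_ball[of z r] s(1)]) (use fg in auto)
    then have d: "deriv f s = deriv g s * (s - z) ^ m + g s * (of_nat m * (s - z) ^ (m - 1))" by (rule DERIV_imp_deriv)
    have "(s - z) * deriv f s = (s - z) * deriv g s * (s - z) ^ m + g s * of_nat m * (s - z) ^ m"
      unfolding d by (cases m) (auto simp: algebra_simps)
    then have "(s - z) * (deriv f s / f s) = ((s - z) * deriv g s * (s - z) ^ m + g s * of_nat m * (s - z) ^ m) / (g s * (s - z) ^ m)"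
      using fg(1)[OF s(1)] by simp
    also have "\<dots> = (s - z) * (deriv g s / g s) + of_nat m"
      using fg(2)[OF s(1)] s(2) by (simp add: add_divide_distrib)
    finally show ?thesis ..
  qed
  then have "\<forall>\<^sub>F s in at z. (s - z) * (deriv g s / g s) + of_nat m = (s - z) * (deriv f s / f s)"
    using r(1) by (auto simp: eventually_at dist_commute intro!: exI[of _ r])
  ultimately have "((\<lambda>s. (s - z) * (deriv f s / f s)) \<longlongrightarrow> of_nat m) (at z)"
    by (rule Lim_transform_eventually)
  with m show ?thesis by (rule that)
qed

lemma dedekind_order:
  assumes "Re z > 0"
  obtains m :: nat where "dedekind z = 0 \<longleftrightarrow> m > 0"
    "((\<lambda>s. (s - z) * (deriv dedekind s / dedekind s)) \<longlongrightarrow> of_nat m) (at z)"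
proof (rule log_derivative_order[OF dedekind_holomorphic open_halfplane])
  show "connected {s. 0 < Re s}" by (intro convex_connected convex_halfspace_Re_gt)
  show "\<exists>w\<in>{s. 0 < Re s}. dedekind w \<noteq> 0" using dedekind_1 by (intro bexI[of _ 1]) auto
qed (use assms that in auto)

abbreviation D4 :: "complex \<Rightarrow> complex" where
  "D4 \<equiv> dser (\<lambda>n. of_real (coeff4 n))"

text \<open>Halving brings \<open>coeff4\<close>, which is at most \<open>2 * ln n\<close>, under
  the general growth condition for \<open>dser\<close>.\<close>

lemma half_coeff4_bound: "n > 0 \<Longrightarrow> norm (of_real (coeff4 n / 2) :: complex) \<le> 1 + ln (real n)"
  using coeff4_bound[of n] coeff4_nonneg[of n] by simp

lemma summable_norm_D4:
  assumes s: "Re s > 1"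
  shows "summable (\<lambda>n. norm (of_real (coeff4 n) * of_nat n powr (- s) :: complex))"
  using summable_mult[OF summable_norm_dser[OF half_coeff4_bound s], of 2] coeff4_nonneg
  by (simp add: norm_mult)

lemma D4_sums:
  assumes s: "Re s > 1"
  shows "(\<lambda>n. of_real (coeff4 n) * of_nat n powr (- s)) sums D4 s"
  unfolding dser_def by (rule summable_sums[OF summable_norm_cancel[OF summable_norm_D4[OF s]]])

lemma D4_bounded:
  assumes "\<sigma> > 1"
  obtains C where "\<And>s. Re s \<ge> \<sigma> \<Longrightarrow> norm (D4 s) \<le> C"
proof
  fix s assume s: "Re s \<ge> \<sigma>"
  have "norm (D4 s) \<le> (\<Sum>n. norm (of_real (coeff4 n) * of_nat n powr (- s) :: complex))"
    unfolding dser_def using s assms by (intro summable_norm summable_norm_D4) auto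
  also have "\<dots> \<le> (\<Sum>n. norm (of_real (coeff4 n) * of_nat n powr (- of_real \<sigma>) :: complex))"
  proof (rule suminf_le)
    fix n :: nat
    show "norm (of_real (coeff4 n) * of_nat n powr (- s) :: complex) \<le> norm (of_real (coeff4 n) * of_nat n powr (- of_real \<sigma>) :: complex)"
      using s by (cases "n = 0") (auto simp: norm_mult norm_of_nat_powr intro!: mult_left_mono powr_mono)
  qed (use s assms in \<open>auto intro!: summable_norm_D4\<close>)
  finally show "norm (D4 s) \<le> (\<Sum>n. norm (of_real (coeff4 n) * of_nat n powr (- of_real \<sigma>) :: complex))" .
qed

lemma D4_eq:
  assumes s: "Re s > 1" "dedekind s \<noteq> 0"
  shows "D4 s = 1 / (s - 1) - deriv dedekind s / dedekind s"
proof -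
  have "s \<noteq> 1" using s by auto
  then show ?thesis using dedekind_log_derivative[OF s(1)] s(2) by (simp add: field_simps)
qed

text \<open>No Euler product is used. A zero would give \<open>deriv dedekind / dedekind\<close> a
  positive residue, but this quotient equals \<open>1 / (s - 1) - D4 s\<close> and stays bounded to
  the right of any \<open>\<sigma> > 1\<close>.\<close>

lemma dedekind_nonzero_gt_1:
  assumes s0: "Re z > 1"
  shows "dedekind z \<noteq> 0"
proof
  assume 0: "dedekind z = 0"
  obtain m where m: "m > 0" "((\<lambda>s. (s - z) * (deriv dedekind s / dedekind s)) \<longlongrightarrow> of_nat m) (at z)"
    using dedekind_order[of z] s0 0 by (metis less_trans zero_less_one)
  define \<sigma> where "\<sigma> = (1 + Re z) / 2"
  have \<sigma>: "1 < \<sigma>" "\<sigma> < Re z" using s0 by (auto simp: \<sigma>_def)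
  obtain C where C: "\<And>s. Re s \<ge> \<sigma> \<Longrightarrow> norm (D4 s) \<le> C" using D4_bounded[OF \<sigma>(1)] by blast
  have "C \<ge> 0" using C[of z] \<sigma> norm_ge_zero[of "D4 z"] by (smt (verit))
  have "((\<lambda>s. (s - z) * (deriv dedekind s / dedekind s)) \<longlongrightarrow> 0) (at z)"
  proof (rule Lim_null_comparison)
    have "\<forall>\<^sub>F s in at z. Re s \<in> {\<sigma><..}"
      using \<sigma> by (intro topological_tendstoD[OF tendsto_Re[OF tendsto_ident_at]]) auto
    then show "\<forall>\<^sub>F s in at z. norm ((s - z) * (deriv dedekind s / dedekind s)) \<le> norm (s - z) * (1 / (\<sigma> - 1) + C)"
    proof eventually_elim
      case (elim s)
      then have s: "Re s > \<sigma>" "Re s > 1" using \<sigma> by auto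
      have "norm (deriv dedekind s / dedekind s) \<le> 1 / (\<sigma> - 1) + C"
      \<comment> \<open>At further zeros the quotient is 0 by the convention on division, so the
        bound holds there too.\<close>
      proof (cases "dedekind s = 0")
        case False
        have "\<sigma> - 1 \<le> norm (s - 1)" using s complex_Re_le_cmod[of "s - 1"] by simp
        then have "norm (1 / (s - 1)) \<le> 1 / (\<sigma> - 1)" using \<sigma> by (simp add: norm_divide frac_le)
        moreover have "deriv dedekind s / dedekind s = 1 / (s - 1) - D4 s" using D4_eq[OF s(2) False] by simp
        ultimately show ?thesis using C[of s] s norm_triangle_ineq4[of "1 / (s - 1)" "D4 s"] by simp
      qed (use \<sigma> \<open>C \<ge> 0\<close> in simp)
      then show ?case unfolding norm_mult by (intro mult_left_mono) auto
    qed
    have "((\<lambda>s. norm (s - z) * (1 / (\<sigma> - 1) + C)) \<longlongrightarrow> norm (z - z) * (1 / (\<sigma> - 1) + C)) (at z)"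
      by (intro tendsto_intros)
    then show "((\<lambda>s. norm (s - z) * (1 / (\<sigma> - 1) + C)) \<longlongrightarrow> 0) (at z)" by simp
  qed
  with m(2) have "of_nat m = (0 :: complex)" using tendsto_unique by (metis at_neq_bot)
  with m(1) show False by simp
qed

lemma Re_of_nat_powr:
  "n > 0 \<Longrightarrow> Re (of_nat n powr (- Complex \<sigma> y)) = real n powr (- \<sigma>) * cos (y * ln (real n))"
proof -
  assume n: "n > 0"
  then have "Ln (of_nat n :: complex) = of_real (ln (real n))" using Ln_of_real[of "real n"] by simp
  then show ?thesis using n by (simp add: powr_def Re_exp mult.commute)
qed

lemma D4_three_four_one:
  assumes \<sigma>: "\<sigma> > 1"
  shows "0 \<le> Re (3 * D4 (Complex \<sigma> 0) + 4 * D4 (Complex \<sigma> y) + D4 (Complex \<sigma> (2 * y)))"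
proof -
  let ?f = "\<lambda>y n. of_real (coeff4 n) * of_nat n powr (- Complex \<sigma> y) :: complex"
  have S: "?f y sums D4 (Complex \<sigma> y)" for y using \<sigma> by (intro D4_sums) simp
  have "(\<lambda>n. 3 * ?f 0 n + 4 * ?f y n + ?f (2 * y) n) sums (3 * D4 (Complex \<sigma> 0) + 4 * D4 (Complex \<sigma> y) + D4 (Complex \<sigma> (2 * y)))"
    by (intro sums_add sums_mult S)
  then have sums: "(\<lambda>n. Re (3 * ?f 0 n + 4 * ?f y n + ?f (2 * y) n)) sums Re (3 * D4 (Complex \<sigma> 0) + 4 * D4 (Complex \<sigma> y) + D4 (Complex \<sigma> (2 * y)))"
    by (rule sums_Re)
  have nonneg: "0 \<le> Re (3 * ?f 0 n + 4 * ?f y n + ?f (2 * y) n)" for n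
  proof (cases "n = 0")
    case False
    define \<theta> where "\<theta> = y * ln (real n)"
    have "Re (3 * ?f 0 n + 4 * ?f y n + ?f (2 * y) n) = coeff4 n * (real n powr (- \<sigma>) * (3 + 4 * cos \<theta> + cos (2 * \<theta>)))"
      using False by (simp add: Re_of_nat_powr \<theta>_def algebra_simps)
    also have "3 + 4 * cos \<theta> + cos (2 * \<theta>) = 2 * (1 + cos \<theta>)\<^sup>2"
      unfolding cos_double_cos by (simp add: power2_eq_square algebra_simps)
    finally show ?thesis by (simp add: coeff4_nonneg)
  qed simp
  show ?thesis by (rule sums_le[OF nonneg sums_zero sums])
qed

text \<open>Multiplying the 3-4-1 inequality at real part \<open>1 + x\<close> by \<open>x\<close>
  and letting \<open>x\<close> tend to 0 from the right leaves
  \<open>0 \<le> 3 * (1 - k) - 4 * m - l\<close>, where \<open>k\<close>, \<open>m\<close>,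
  \<open>l\<close> are the orders at \<open>1\<close>, \<open>1 + \<i> y\<close> and
  \<open>1 + 2 \<i> y\<close>. Since \<open>k = 0\<close>, the order \<open>m\<close> must
  vanish.\<close>

lemma dedekind_nonzero:
  assumes "Re z \<ge> 1"
  shows "dedekind z \<noteq> 0"
proof (cases "Re z = 1 \<and> Im z \<noteq> 0")
  case False
  then consider "Re z > 1" | "z = 1" using assms le_less[of 1 "Re z"] by (auto simp: complex_eq_iff)
  then show ?thesis using dedekind_nonzero_gt_1 dedekind_1 by cases auto
next
  case True
  define y where "y = Im z"
  have y: "y \<noteq> 0" and z: "z = Complex 1 y" using True by (auto simp: y_def complex_eq_iff)
  \<comment> \<open>The limit is the order of the pole minus the order of the zero:
    \<open>1 / (s - 1)\<close> contributes only at height \<open>v = 0\<close>.\<close>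
  have lim: "((\<lambda>x. of_real x * D4 (Complex (1 + x) v)) \<longlongrightarrow> (if v = 0 then 1 else 0) - of_nat m) (at_right 0)"
    if m: "((\<lambda>s. (s - Complex 1 v) * (deriv dedekind s / dedekind s)) \<longlongrightarrow> of_nat m) (at (Complex 1 v))" for v m
  proof -
    have fl: "filterlim (\<lambda>x. Complex (1 + x) v) (at (Complex 1 v)) (at_right 0)"
    proof (rule filterlim_atI)
      have "((\<lambda>x. Complex (1 + x) v) \<longlongrightarrow> Complex (1 + 0) v) (at_right 0)" by (intro tendsto_intros)
      then show "((\<lambda>x. Complex (1 + x) v) \<longlongrightarrow> Complex 1 v) (at_right 0)" by simp
      show "\<forall>\<^sub>F x in at_right 0. Complex (1 + x) v \<noteq> Complex 1 v"
        using eventually_at_right_less[of "0::real"] by eventually_elim simp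
    qed
    have 1: "((\<lambda>x. of_real x * (deriv dedekind (Complex (1 + x) v) / dedekind (Complex (1 + x) v))) \<longlongrightarrow> of_nat m) (at_right 0)"
    proof -
      have "Complex (1 + x) v - Complex 1 v = of_real x" for x by (simp add: complex_eq_iff)
      then show ?thesis using filterlim_compose[OF m fl] by simp
    qed
    have 2: "((\<lambda>x. of_real x / (Complex (1 + x) v - 1)) \<longlongrightarrow> (if v = 0 then 1 else 0)) (at_right 0)"
    proof (cases "v = 0")
      case True
      have "\<forall>\<^sub>F x in at_right 0. 1 = of_real x / (Complex (1 + x) v - 1)"
        using eventually_at_right_less[of "0::real"] by eventually_elim (auto simp: True Complex_eq)
      then show ?thesis using True by (simp add: Lim_transform_eventually[OF tendsto_const])
    next
      case False
      have "((\<lambda>x. of_real x / (Complex (1 + x) v - 1)) \<longlongrightarrow> of_real 0 / (Complex (1 + 0) v - 1)) (at_right 0)"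
        using False by (intro tendsto_intros) (auto simp: complex_eq_iff)
      then show ?thesis using False by simp
    qed
    show ?thesis
    proof (rule Lim_transform_eventually[OF tendsto_diff[OF 2 1]])
      show "\<forall>\<^sub>F x in at_right 0. of_real x / (Complex (1 + x) v - 1) - of_real x * (deriv dedekind (Complex (1 + x) v) / dedekind (Complex (1 + x) v))
          = of_real x * D4 (Complex (1 + x) v)"
        using eventually_at_right_less[of "0::real"]
        by eventually_elim (subst D4_eq, auto simp: dedekind_nonzero_gt_1 right_diff_distrib)
    qed
  qed
  obtain k where k: "dedekind (Complex 1 0) = 0 \<longleftrightarrow> k > 0"
      "((\<lambda>s. (s - Complex 1 0) * (deriv dedekind s / dedekind s)) \<longlongrightarrow> of_nat k) (at (Complex 1 0))"
    by (rule dedekind_order[of "Complex 1 0"]) auto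
  obtain m where m: "dedekind (Complex 1 y) = 0 \<longleftrightarrow> m > 0"
      "((\<lambda>s. (s - Complex 1 y) * (deriv dedekind s / dedekind s)) \<longlongrightarrow> of_nat m) (at (Complex 1 y))"
    by (rule dedekind_order[of "Complex 1 y"]) auto
  obtain l where l: "((\<lambda>s. (s - Complex 1 (2 * y)) * (deriv dedekind s / dedekind s)) \<longlongrightarrow> of_nat l) (at (Complex 1 (2 * y)))"
    by (rule dedekind_order[of "Complex 1 (2 * y)"]) auto
  have "Complex 1 0 = 1" by (simp add: complex_eq_iff)
  then have "k = 0" using k(1) dedekind_1 by simp
  have "((\<lambda>x. Re (3 * (of_real x * D4 (Complex (1 + x) 0)) + 4 * (of_real x * D4 (Complex (1 + x) y)) + of_real x * D4 (Complex (1 + x) (2 * y))))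
      \<longlongrightarrow> Re (3 * ((if (0::real) = 0 then 1 else 0) - of_nat k) + 4 * ((if y = 0 then 1 else 0) - of_nat m) + ((if 2 * y = 0 then 1 else 0) - of_nat l))) (at_right 0)"
    by (intro tendsto_intros lim k(2) m(2) l)
  moreover have "\<forall>\<^sub>F x in at_right 0. 0 \<le> Re (3 * (of_real x * D4 (Complex (1 + x) 0)) + 4 * (of_real x * D4 (Complex (1 + x) y)) + of_real x * D4 (Complex (1 + x) (2 * y)))"
    using eventually_at_right_less[of "0::real"]
  proof eventually_elim
    case (elim x)
    have "0 \<le> x * Re (3 * D4 (Complex (1 + x) 0) + 4 * D4 (Complex (1 + x) y) + D4 (Complex (1 + x) (2 * y)))"
      using elim by (intro mult_nonneg_nonneg D4_three_four_one) auto
    then show ?case by (simp add: algebra_simps)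
  qed
  ultimately have "0 \<le> Re (3 * ((if (0::real) = 0 then 1 else 0) - of_nat k) + 4 * ((if y = 0 then 1 else 0) - of_nat m) + ((if 2 * y = 0 then 1 else 0) - of_nat l))"
    by (rule tendsto_lowerbound) simp
  then have "m = 0" using y \<open>k = 0\<close> by simp
  then show ?thesis using m(1) z by simp
qed

subsection \<open>Primes congruent to 1 modulo 4\<close>

text \<open>The logarithmic scale turns the Dirichlet series of \<open>coeff4\<close> into a Laplace
  transform.\<close>

definition psi4 :: "real \<Rightarrow> real" where
  "psi4 t = (\<Sum>n\<in>{1..nat \<lfloor>exp t\<rfloor>}. coeff4 n)"

lemma le_exp_iff: "n > 0 \<Longrightarrow> n \<le> nat \<lfloor>exp t\<rfloor> \<longleftrightarrow> ln (real n) \<le> t"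
proof -
  assume n: "n > 0"
  have "n \<le> nat \<lfloor>exp t\<rfloor> \<longleftrightarrow> real n \<le> exp t" by (simp add: le_nat_iff le_floor_iff)
  also have "\<dots> \<longleftrightarrow> ln (real n) \<le> t" using n ln_le_cancel_iff[of "real n" "exp t"] by simp
  finally show ?thesis .
qed

lemma psi4_mono: "mono psi4"
proof (rule monoI)
  fix s t :: real assume "s \<le> t"
  then have "nat \<lfloor>exp s\<rfloor> \<le> nat \<lfloor>exp t\<rfloor>" by (intro nat_mono floor_mono) simp
  then show "psi4 s \<le> psi4 t" unfolding psi4_def by (intro sum_mono2) (auto simp: coeff4_nonneg)
qed

lemma psi4_neg: "t < 0 \<Longrightarrow> psi4 t = 0"
proof -
  assume "t < 0"
  then have "\<lfloor>exp t\<rfloor> = 0" by (simp add: floor_eq_iff)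
  then show ?thesis by (simp add: psi4_def)
qed

lemma psi4_nonneg: "psi4 t \<ge> 0"
  unfolding psi4_def by (intro sum_nonneg coeff4_nonneg)

lemma coeff4_0: "coeff4 0 = 0"
  by (simp add: coeff4_def)

text \<open>Writing \<open>psi4\<close> as a series of steps at \<open>ln n\<close> prepares the
  termwise Laplace transform. The value of \<open>ln\<close> at 0 does not matter because
  \<open>coeff4 0 = 0\<close>.\<close>

lemma psi4_sums: "(\<lambda>n. coeff4 n * indicator {ln (real n)..} t) sums psi4 t"
proof -
  have "(\<lambda>n. coeff4 n * indicator {ln (real n)..} t) sums (\<Sum>n\<in>{1..nat \<lfloor>exp t\<rfloor>}. coeff4 n * indicator {ln (real n)..} t)"
  proof (rule sums_finite)
    fix n assume "n \<notin> {1..nat \<lfloor>exp t\<rfloor>}"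
    then show "coeff4 n * indicator {ln (real n)..} t = 0"
      using le_exp_iff[of n t] by (cases "n = 0") (auto simp: coeff4_0)
  qed simp
  also have "(\<Sum>n\<in>{1..nat \<lfloor>exp t\<rfloor>}. coeff4 n * indicator {ln (real n)..} t) = psi4 t"
    unfolding psi4_def
  proof (rule sum.cong)
    fix n assume "n \<in> {1..nat \<lfloor>exp t\<rfloor>}"
    then show "coeff4 n * indicator {ln (real n)..} t = coeff4 n" using le_exp_iff[of n t] by simp
  qed simp
  finally show ?thesis .
qed

text \<open>Each step transforms into \<open>n powr (- s) / s\<close>; absolute convergence of
  \<open>D4\<close> justifies exchanging sum and integral.\<close>

lemma psi4_laplace:
  assumes s: "Re s > 1"
  shows "integrable lborel (\<lambda>t. of_real (psi4 t) * exp (- s * of_real t))"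
    and "(\<integral>t. of_real (psi4 t) * exp (- s * of_real t) \<partial>lborel) = D4 s / s"
proof -
  have s0: "Re s > 0" "s \<noteq> 0" using s by auto
  define f where "f n t = complex_of_real (coeff4 n) * (indicator {ln (real n)..} t * exp (- s * of_real t))" for n t
  have int: "integrable lborel (f n)" for n
    unfolding f_def by (intro integrable_mult_right laplace_exp_atLeast s0)
  have nf: "norm (f n t) = coeff4 n * (indicator {ln (real n)..} t * exp (- Re s * t))" for n t
    by (simp add: f_def norm_mult coeff4_nonneg split: split_indicator)
  have powr: "(of_nat n :: complex) powr (- z) = exp (- z * of_real (ln (real n)))" if "n > 0" for n z
    using Ln_of_real[of "real n"] that by (simp add: powr_def)
  have If: "(\<integral>t. f n t \<partial>lborel) = of_real (coeff4 n) * of_nat n powr (- s) / s" for n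
    using laplace_exp_atLeast(2)[OF s0(1), of "ln (real n)"]
    by (cases "n = 0") (auto simp: f_def powr coeff4_0)
  have fs: "(\<lambda>n. f n t) sums (of_real (psi4 t) * exp (- s * of_real t))" for t
  proof -
    have "(\<lambda>n. complex_of_real (coeff4 n * indicator {ln (real n)..} t) * exp (- s * of_real t)) sums (of_real (psi4 t) * exp (- s * of_real t))"
      by (intro sums_mult2 sums_of_real psi4_sums)
    moreover have "complex_of_real (indicator {ln (real n)..} t) = indicator {ln (real n)..} t" for n
      by (simp split: split_indicator)
    ultimately show ?thesis by (simp add: f_def mult.assoc)
  qed
  have sn: "summable (\<lambda>n. norm (f n t))" for t
  proof -
    have "summable (\<lambda>n. coeff4 n * indicator {ln (real n)..} t * exp (- Re s * t))"
      using psi4_sums[of t] by (intro summable_mult2) (simp add: sums_iff)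
    then show ?thesis by (simp add: nf mult.assoc)
  qed
  have si: "summable (\<lambda>n. \<integral>t. norm (f n t) \<partial>lborel)"
  proof -
    have "(\<integral>t. norm (f n t) \<partial>lborel) = norm (of_real (coeff4 n) * of_nat n powr (- s) :: complex) / Re s" for n
    proof (cases "n = 0")
      case False
      have "complex_of_real (\<integral>t. norm (f n t) \<partial>lborel) = (\<integral>t. complex_of_real (norm (f n t)) \<partial>lborel)"
        by (rule integral_complex_of_real[symmetric])
      also have "\<dots> = (\<integral>t. complex_of_real (coeff4 n) * (indicator {ln (real n)..} t * exp (- complex_of_real (Re s) * of_real t)) \<partial>lborel)"
        unfolding nf by (intro Bochner_Integration.integral_cong) (auto simp: indicator_def simp flip: exp_of_real)
      also have "\<dots> = of_real (coeff4 n) * (exp (- complex_of_real (Re s) * of_real (ln (real n))) / of_real (Re s))"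
        using laplace_exp_atLeast(2)[of "of_real (Re s)" "ln (real n)"] s0 by simp
      also have "\<dots> = of_real (coeff4 n * exp (- Re s * ln (real n)) / Re s)"
        by (simp flip: exp_of_real)
      finally have "(\<integral>t. norm (f n t) \<partial>lborel) = coeff4 n * exp (- Re s * ln (real n)) / Re s"
        by (simp only: of_real_eq_iff)
      then show ?thesis using False by (simp add: norm_mult coeff4_nonneg norm_of_nat_powr powr_def)
    qed (simp add: nf coeff4_0)
    then show ?thesis using summable_divide[OF summable_norm_D4[OF s], of "Re s"] by simp
  qed
  have eq: "(\<Sum>n. f n t) = of_real (psi4 t) * exp (- s * of_real t)" for t
    using fs by (simp add: sums_iff)
  show "integrable lborel (\<lambda>t. of_real (psi4 t) * exp (- s * of_real t))"
    using integrable_suminf[OF int AE_I2[OF sn] si] by (simp only: eq)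
  have "(\<integral>t. of_real (psi4 t) * exp (- s * of_real t) \<partial>lborel) = (\<Sum>n. of_real (coeff4 n) * of_nat n powr (- s) / s)"
    using integral_suminf[OF int AE_I2[OF sn] si] by (simp only: eq If)
  also have "\<dots> = D4 s / s"
    using sums_divide[OF D4_sums[OF s], of s] by (simp add: sums_iff)
  finally show "(\<integral>t. of_real (psi4 t) * exp (- s * of_real t) \<partial>lborel) = D4 s / s" .
qed

lemma psi4_asymptotic: "((\<lambda>t. psi4 t * exp (- t)) \<longlongrightarrow> 1) at_top"
proof -
  \<comment> \<open>What is left of \<open>D4 (1 + z) / (1 + z)\<close> after removing
    \<open>1 / z\<close>. It is continuous up to \<open>Re z = 0\<close> precisely because
    \<open>dedekind\<close> has no zero on \<open>Re s \<ge> 1\<close>.\<close>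
  define g where "g z = - (1 + deriv dedekind (1 + z) / dedekind (1 + z)) / (1 + z)" for z
  interpret laplace_tauberian psi4 g
  proof
    show "mono psi4" by (rule psi4_mono)
    show "psi4 t = 0" if "t < 0" for t using that by (rule psi4_neg)
    show "integrable lborel (\<lambda>t. psi4 t * exp (- (1 + x) * t))" if x: "x > 0" for x
    proof -
      have "integrable lborel (\<lambda>t. norm (of_real (psi4 t) * exp (- complex_of_real (1 + x) * of_real t)))"
        using x by (intro integrable_norm psi4_laplace) simp
      then show ?thesis by (simp add: norm_mult psi4_nonneg)
    qed
    show "(\<integral>t. of_real (psi4 t) * exp (- (1 + z) * of_real t) \<partial>lborel) = 1 / z + g z" if z: "Re z > 0" for z
    proof -
      have z1: "Re (1 + z) > 1" and nz: "z \<noteq> 0" "1 + z \<noteq> 0" using z by (auto simp: complex_eq_iff)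
      have "(\<integral>t. of_real (psi4 t) * exp (- (1 + z) * of_real t) \<partial>lborel) = D4 (1 + z) / (1 + z)"
        by (rule psi4_laplace(2)[OF z1])
      also have "D4 (1 + z) = 1 / z - deriv dedekind (1 + z) / dedekind (1 + z)"
        using D4_eq[OF z1 dedekind_nonzero_gt_1[OF z1]] by simp
      also have "(1 / z - q) / (1 + z) = 1 / z + - (1 + q) / (1 + z)" for q
        using nz by (simp add: field_simps)
      finally show ?thesis unfolding g_def .
    qed
    show "continuous_on {z. Re z \<ge> 0} g"
    proof -
      have c1: "continuous_on {z. Re z \<ge> 0} (\<lambda>z. dedekind (1 + z))"
        by (rule continuous_on_compose2[OF holomorphic_on_imp_continuous_on[OF dedekind_holomorphic]])
           (auto intro!: continuous_intros)
      have "deriv dedekind holomorphic_on {s. Re s > 0}"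
        by (rule holomorphic_deriv[OF dedekind_holomorphic open_halfplane])
      then have c2: "continuous_on {z. Re z \<ge> 0} (\<lambda>z. deriv dedekind (1 + z))"
        by (rule continuous_on_compose2[OF holomorphic_on_imp_continuous_on]) (auto intro!: continuous_intros)
      have "1 + z \<noteq> 0" if "Re z \<ge> 0" for z using that by (auto simp: complex_eq_iff)
      then show ?thesis unfolding g_def[abs_def]
        by (intro continuous_intros c1 c2) (auto intro!: dedekind_nonzero)
    qed
  qed
  show ?thesis using h_tendsto_1 unfolding h_def[abs_def] .
qed

text \<open>If \<open>k = p ^ j\<close> with \<open>j \<ge> 2\<close>, then \<open>p\<close> is at
  most the square root of \<open>n\<close>, and \<open>2 ^ j \<le> n\<close>. This crude count is
  already \<open>o(n / ln n)\<close>.\<close>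

lemma proper_prime_powers_card:
  "card {k. k \<le> n \<and> primepow k \<and> \<not> prime k} \<le> (nat \<lfloor>sqrt (real n)\<rfloor> + 1) * (nat \<lfloor>log 2 (real n)\<rfloor> + 1)"
proof -
  let ?A = "{0..nat \<lfloor>sqrt (real n)\<rfloor>}" and ?B = "{0..nat \<lfloor>log 2 (real n)\<rfloor>}"
  have "{k. k \<le> n \<and> primepow k \<and> \<not> prime k} \<subseteq> (\<lambda>(a, j). a ^ j) ` (?A \<times> ?B)"
  proof
    fix k assume "k \<in> {k. k \<le> n \<and> primepow k \<and> \<not> prime k}"
    then have k: "k \<le> n" "primepow k" "\<not> prime k" by auto
    then obtain p j where pj: "prime p" "j > 0" "k = p ^ j" by (auto simp: primepow_def)
    have "j \<noteq> 1" using pj k(3) by auto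
    then have j: "j \<ge> 2" using pj(2) by simp
    have p2: "p \<ge> 2" using pj(1) by (rule prime_ge_2_nat)
    have "p ^ 2 \<le> p ^ j" using p2 j by (intro power_increasing) auto
    then have "real (p ^ 2) \<le> real n" using k(1) pj(3) by simp
    then have "real p \<le> sqrt (real n)" by (intro real_le_rsqrt) simp
    then have a: "p \<in> ?A" by (simp add: le_nat_floor)
    have "2 ^ j \<le> p ^ j" using p2 by (intro power_mono) auto
    then have "2 ^ j \<le> n" using k(1) pj(3) by simp
    then have "real (2 ^ j) \<le> real n" by (simp only: of_nat_le_iff)
    then have "2 powr real j \<le> real n" by (simp add: powr_realpow)
    moreover have "n > 0" using \<open>2 ^ j \<le> n\<close> by (cases n) auto
    ultimately have "real j \<le> log 2 (real n)" by (subst le_log_iff) auto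
    then have "j \<in> ?B" by (simp add: le_nat_floor)
    with a show "k \<in> (\<lambda>(a, j). a ^ j) ` (?A \<times> ?B)" using pj(3) by (intro image_eqI[of _ _ "(p, j)"]) auto
  qed
  then have "card {k. k \<le> n \<and> primepow k \<and> \<not> prime k} \<le> card ((\<lambda>(a, j). a ^ j) ` (?A \<times> ?B))"
    by (intro card_mono) auto
  also have "\<dots> \<le> card (?A \<times> ?B)" by (intro card_image_le) auto
  finally show ?thesis by simp
qed

text \<open>The mass of \<open>coeff4\<close> on \<open>((1 - \<epsilon>) n, n]\<close> is
  asymptotically \<open>\<epsilon> n\<close>. Without a prime of residue 1 there, only proper prime
  powers could contribute, and their total is \<open>o(n)\<close>. The threshold
  \<open>\<epsilon> / 2\<close> separates the two estimates.\<close>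

theorem prime_1_mod_4_in_short_interval:
  assumes \<epsilon>: "0 < \<epsilon>" "\<epsilon> < 1"
  shows "\<forall>\<^sub>F n in sequentially. \<exists>p. prime p \<and> p mod 4 = 1 \<and> (1 - \<epsilon>) * real n < real p \<and> p \<le> n"
proof -
  define a where "a = 1 - \<epsilon>"
  have a: "a > 0" "a < 1" using \<epsilon> by (auto simp: a_def)
  define S where "S x = psi4 (ln x)" for x
  have S: "((\<lambda>x. S x / x) \<longlongrightarrow> 1) at_top"
  proof -
    have "((\<lambda>x. psi4 (ln x) * exp (- ln x)) \<longlongrightarrow> 1) at_top"
      by (rule filterlim_compose[OF psi4_asymptotic ln_at_top])
    then show ?thesis
    proof (rule Lim_transform_eventually)
      show "\<forall>\<^sub>F x in at_top. psi4 (ln x) * exp (- ln x) = S x / x"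
        using eventually_gt_at_top[of "0::real"]
        by eventually_elim (simp add: S_def exp_minus divide_inverse)
    qed
  qed
  have 1: "(\<lambda>n. S (real n) / real n) \<longlonglongrightarrow> 1"
    by (rule filterlim_compose[OF S filterlim_real_sequentially])
  have "filterlim (\<lambda>n. a * real n) at_top sequentially" using a by real_asymp
  from filterlim_compose[OF S this] have 2: "(\<lambda>n. S (a * real n) / (a * real n)) \<longlonglongrightarrow> 1" .
  have "(\<lambda>n. S (real n) / real n - a * (S (a * real n) / (a * real n))) \<longlonglongrightarrow> 1 - a * 1"
    by (intro tendsto_intros 1 2)
  then have ev1: "\<forall>\<^sub>F n in sequentially. \<epsilon> / 2 < S (real n) / real n - a * (S (a * real n) / (a * real n))"
    using \<epsilon> by (intro order_tendstoD) (auto simp: a_def)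
  have "(\<lambda>n. 2 * ln (real n) * ((sqrt (real n) + 1) * (log 2 (real n) + 1)) / real n) \<longlonglongrightarrow> 0"
    by real_asymp
  then have ev2: "\<forall>\<^sub>F n in sequentially. 2 * ln (real n) * ((sqrt (real n) + 1) * (log 2 (real n) + 1)) / real n < \<epsilon> / 2"
    using \<epsilon> by (intro order_tendstoD) auto
  \<comment> \<open>Keeps the prime 2 out of the interval, where \<open>coeff4\<close> does not
    vanish; the remaining primes are odd.\<close>
  have ev3: "\<forall>\<^sub>F n in sequentially. a * real n > 2" using a by real_asymp
  show ?thesis using ev1 ev2 ev3 eventually_gt_at_top[of 0]
  proof eventually_elim
    case (elim n)
    show ?case
    proof (rule ccontr)
      assume none: "\<not> ?thesis"
      define Q where "Q = {k. k \<le> n \<and> primepow k \<and> \<not> prime k}"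
      define m where "m = nat \<lfloor>a * real n\<rfloor>"
      have finQ: "finite Q" unfolding Q_def by (rule finite_subset[of _ "{..n}"]) auto
      have "a * real n \<le> real n" using a by (intro mult_left_le_one_le) auto
      then have mn: "m \<le> n" unfolding m_def by linarith
      have Sn: "S (real n) = (\<Sum>k\<in>{1..n}. coeff4 k)" using elim by (simp add: S_def psi4_def)
      have Sa: "S (a * real n) = (\<Sum>k\<in>{1..m}. coeff4 k)" using elim a by (simp add: S_def psi4_def m_def)
      have "S (real n) - S (a * real n) = (\<Sum>k\<in>{1..n} - {1..m}. coeff4 k)"
        unfolding Sn Sa using mn by (subst sum_diff) auto
      also have "\<dots> = (\<Sum>k\<in>({1..n} - {1..m}) \<inter> Q. coeff4 k)"
      proof (rule sum.mono_neutral_right)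
        show "\<forall>k\<in>({1..n} - {1..m}) - ({1..n} - {1..m}) \<inter> Q. coeff4 k = 0"
        proof
          fix k assume k: "k \<in> ({1..n} - {1..m}) - ({1..n} - {1..m}) \<inter> Q"
          then have k': "k \<le> n" "k > m" "k \<notin> Q" by auto
          have kr: "a * real n < real k" using k'(2) unfolding m_def by linarith
          show "coeff4 k = 0"
          proof (cases "prime k")
            case False
            then have "\<not> primepow k" using k' by (auto simp: Q_def)
            then show ?thesis by (simp add: coeff4_def mangoldt_def)
          next
            case True
            have "k mod 4 \<noteq> 1" using none True kr k'(1) by (auto simp: a_def)
            moreover have "odd k" using True kr elim by (intro prime_odd_nat) auto
            then have "k mod 4 = 1 \<or> k mod 4 = 3" by presburger
            ultimately show ?thesis by (simp add: coeff4_def chi4_def)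
          qed
        qed
      qed auto
      also have "\<dots> \<le> (\<Sum>k\<in>({1..n} - {1..m}) \<inter> Q. 2 * ln (real n))"
      proof (rule sum_mono)
        fix k assume "k \<in> ({1..n} - {1..m}) \<inter> Q"
        then have k: "k > 0" "k \<le> n" by auto
        have "coeff4 k \<le> 2 * ln (real k)" using k by (intro coeff4_bound)
        also have "\<dots> \<le> 2 * ln (real n)" using k by simp
        finally show "coeff4 k \<le> 2 * ln (real n)" .
      qed
      also have "\<dots> \<le> 2 * ln (real n) * real (card Q)"
      proof -
        have "real (card (({1..n} - {1..m}) \<inter> Q)) \<le> real (card Q)" using finQ by (intro of_nat_mono card_mono) auto
        then have "2 * ln (real n) * real (card (({1..n} - {1..m}) \<inter> Q)) \<le> 2 * ln (real n) * real (card Q)"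
          using elim by (intro mult_left_mono) auto
        then show ?thesis by (simp add: mult_ac)
      qed
      also have "\<dots> \<le> 2 * ln (real n) * ((sqrt (real n) + 1) * (log 2 (real n) + 1))"
      proof (rule mult_left_mono)
        have "real (card Q) \<le> real ((nat \<lfloor>sqrt (real n)\<rfloor> + 1) * (nat \<lfloor>log 2 (real n)\<rfloor> + 1))"
          unfolding Q_def by (intro of_nat_mono proper_prime_powers_card)
        also have "\<dots> = (real (nat \<lfloor>sqrt (real n)\<rfloor>) + 1) * (real (nat \<lfloor>log 2 (real n)\<rfloor>) + 1)" by (simp add: algebra_simps)
        also have "\<dots> \<le> (sqrt (real n) + 1) * (log 2 (real n) + 1)"
        proof -
          have "log 2 (real n) \<ge> 0" using elim by (intro zero_le_log_cancel_iff[THEN iffD2]) auto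
          then show ?thesis by (intro mult_mono add_mono order_refl of_nat_floor) auto
        qed
        finally show "real (card Q) \<le> (sqrt (real n) + 1) * (log 2 (real n) + 1)" .
      qed (use elim in auto)
      also have "\<dots> < \<epsilon> / 2 * real n" using elim by (simp add: field_simps)
      finally have "S (real n) - S (a * real n) < \<epsilon> / 2 * real n" .
      moreover have "\<epsilon> / 2 * real n < S (real n) - S (a * real n)"
      proof -
        have "S (real n) / real n - a * (S (a * real n) / (a * real n)) = (S (real n) - S (a * real n)) / real n"
          using a by (simp add: diff_divide_distrib)
        then show ?thesis using elim by (simp add: less_divide_eq)
      qed
      ultimately show False by simp
    qed
  qed
qed

subsection \<open>Asymptotics of the extremal function\<close>

theorem theorem1p2:
  assumes "CARD('d::finite) \<ge> 2"
  shows "(\<exists>e :: nat \<Rightarrow> real. e \<in> o(\<lambda>n. real n) \<and>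
            (\<forall>n\<ge>1. real n - e n \<le> real (max_no_sphere (grid n :: (real ^ 'd) set)))) \<and>
         (\<forall>n\<ge>1. max_no_sphere (grid n :: (real ^ 'd) set) \<le> CARD('d) * n)"
proof (intro conjI)
  define f where "f n = max_no_sphere (grid n :: (real ^ 'd) set)" for n
  \<comment> \<open>Truncation at 0 is for the norm in the Landau symbol: the extremal function
    might exceed \<open>n\<close>.\<close>
  define e where "e n = max 0 (real n - real (f n))" for n
  have "e \<in> o(\<lambda>n. real n)"
  proof (rule landau_o.smallI)
    fix c :: real assume c: "c > 0"
    \<comment> \<open>The cap \<open>1 / 2\<close> keeps \<open>1 - \<epsilon>\<close> positive, so
      that the prime found eventually exceeds \<open>2 * CARD('d)\<close> as well.\<close>
    define \<epsilon> where "\<epsilon> = min c (1 / 2)"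
    have \<epsilon>: "0 < \<epsilon>" "\<epsilon> < 1" "\<epsilon> \<le> c" using c by (auto simp: \<epsilon>_def)
    have "\<forall>\<^sub>F n in sequentially. (1 - \<epsilon>) * real n > 2 * real CARD('d)" using \<epsilon>(2) by real_asymp
    with prime_1_mod_4_in_short_interval[OF \<epsilon>(1,2)]
    show "\<forall>\<^sub>F n in sequentially. norm (e n) \<le> c * norm (real n)"
    proof eventually_elim
      case (elim n)
      then obtain p where p: "prime p" "p mod 4 = 1" "(1 - \<epsilon>) * real n < real p" "p \<le> n" by blast
      have "real (2 * CARD('d)) < real p" using elim p(3) by simp
      then have "2 * CARD('d) < p" by (simp only: of_nat_less_iff)
      then have "p \<le> f n" unfolding f_def by (rule max_no_sphere_grid_ge_prime[OF assms p(1,2) _ p(4)])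
      then have "real n - real (f n) \<le> real n - (1 - \<epsilon>) * real n" using p(3) by linarith
      also have "\<dots> = \<epsilon> * real n" by (simp add: algebra_simps)
      also have "\<dots> \<le> c * real n" using \<epsilon>(3) by (intro mult_right_mono) auto
      finally show ?case using c by (simp add: e_def)
    qed
  qed
  then show "\<exists>e :: nat \<Rightarrow> real. e \<in> o(\<lambda>n. real n) \<and>
      (\<forall>n\<ge>1. real n - e n \<le> real (max_no_sphere (grid n :: (real ^ 'd) set)))"
    by (intro exI[of _ e]) (auto simp: e_def f_def)
  show "\<forall>n\<ge>1. max_no_sphere (grid n :: (real ^ 'd) set) \<le> CARD('d) * n"
    by (simp add: max_no_sphere_grid_le)
qed

end
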